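(* The map of graded sets $$\{\mathbf{P}^1,\mathbf{P}^1\}^{\mathrm{N}}=\coprod_{n\ge0}\{\mathbf{P}^1,\mathbf{P}^1\}^{\mathrm{N}}_n\longrightarrow\coprod_{n\ge0}\mathrm{MW}^{\mathrm{s}}_n(k)\times_{k^\times/k^{\times2}}k^\times/k^{\times2n},\qquad\Big[\tfrac{A}{B}\Big]\mapsto\big[\mathrm{B\acute{e}z}(A,B),\ \det\mathrm{B\acute{e}z}(A,B)\big]$$ is a bijection.
   Context: Let $k$ be a field. For $n\ge0$, $\mathscr{U}_n$ is the open subscheme of $\mathbf{P}^{2n+1}=\mathrm{Proj}\,k[a_0,\dots,a_n,b_0,\dots,b_n]$ complementary to the hypersurface $\mathrm{res}_{n,n}(a_nX^n+\dots+a_0,\,b_nX^n+\dots+b_0)=0$. (Unpointed) scheme endomorphisms of $\mathbf{P}^1_k$ correspond to pairs ($n$, element of $\mathscr{U}_n(k)$), i.e. pairs $(A,B)$ of polynomials of degree $\le n$ with non-vanishing resultant up to a common scalar in $k^\times$; unpointed naive homotopies $\mathbf{P}^1\times\mathbf{A}^1\to\mathbf{P}^1$ correspond to elements of $\mathscr{U}_n(k[T])$, with source/target given by $T=0,1$. $\{\mathbf{P}^1,\mathbf{P}^1\}^{\mathrm{N}}$ is the set of endomorphisms modulo the equivalence relation generated by unpointed naive homotopies; it splits by degree $n$. Bézout form: writing $\frac{A(X)B(Y)-A(Y)B(X)}{X-Y}=\sum_{1\le p,q\le n}c_{p,q}X^{p-1}Y^{q-1}$, $\mathrm{B\acute{e}z}(A,B)=[c_{p,q}]$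 (a non-degenerate symmetric matrix, defined up to multiplication by squares of units since $(A,B)$ is defined up to scalar). $\mathrm{MW}^{\mathrm{s}}_n(k)$ is the set of stable isomorphism classes of rank-$n$ non-degenerate symmetric bilinear forms over $k$ ($b,b'$ identified if $b\oplus b''\simeq b'\oplus b''$ for some $b''$); $k^{\times2n}$ is the subgroup of $2n$-th powers; the fibre product is over the discriminant map $\mathrm{MW}^{\mathrm{s}}_n(k)\to k^\times/k^{\times2}$ (determinant mod squares) and the projection $k^\times/k^{\times2n}\to k^\times/k^{\times2}$.
   Formalization: Proved for each degree n ≥ 1; degree 0 is excluded because there the source is one class while the fibre product is the set of squares in k^×, so the claimed bijection fails for n = 0 unless every square in k^× is 1 (k = F_2 or F_3). *)

theory Defs
  imports "Subresultants.Resultant_Prelim"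
begin

text \<open>An R-point of U_n (R = k or k[T]) is represented by a pair (A,B) of polynomials
  in X over R of degree at most n whose resultant res_{n,n}(A,B) (determinant of the
  2n x 2n Sylvester matrix with formal degrees n,n) is a unit of R.  For R = k this
  means res_{n,n}(A,B) \<noteq> 0.  Points of projective space are classes of such pairs
  modulo common scalars; the scalar action is built into the equivalence relation below.\<close>

definition inU :: "nat \<Rightarrow> ('r::idom) poly \<times> 'r poly \<Rightarrow> bool" where
  "inU n AB \<longleftrightarrow> degree (fst AB) \<le> n \<and> degree (snd AB) \<le> n
      \<and> resultant_sub n n (fst AB) (snd AB) dvd 1"

definition Upts :: "nat \<Rightarrow> ('a::field poly \<times> 'a poly) set" where
  "Upts n = {AB. inU n AB}"

text \<open>Naive homotopy: H = (A(T,X), B(T,X)) in U_n(k[T]); polynomials in X with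
  coefficients in k[T].  Source and target: specialisation T = t.\<close>

definition ev_hom :: "'a::comm_ring_1 \<Rightarrow> 'a poly poly \<times> 'a poly poly \<Rightarrow> 'a poly \<times> 'a poly" where
  "ev_hom t H = (map_poly (\<lambda>c. poly c t) (fst H), map_poly (\<lambda>c. poly c t) (snd H))"

definition naive_step :: "nat \<Rightarrow> (('a::field poly \<times> 'a poly) \<times> ('a poly \<times> 'a poly)) set" where
  "naive_step n = {(x, y). x \<in> Upts n \<and> y \<in> Upts n \<and>
      ((\<exists>c. c \<noteq> 0 \<and> y = (smult c (fst x), smult c (snd x))) \<or>
       (\<exists>H. inU n H \<and> x = ev_hom 0 H \<and> y = ev_hom 1 H))}"

definition naive_rel :: "nat \<Rightarrow> (('a::field poly \<times> 'a poly) \<times> ('a poly \<times> 'a poly)) set" where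
  "naive_rel n = (naive_step n \<union> (naive_step n)\<inverse>)\<^sup>*"

definition naive_classes :: "nat \<Rightarrow> ('a::field poly \<times> 'a poly) set set" where
  "naive_classes n = Upts n // naive_rel n"

text \<open>(A(X)B(Y) - A(Y)B(X)) / (X - Y) as a bivariate polynomial: outer variable X,
  inner variable Y.\<close>
definition bez_quot :: "'a::field poly \<Rightarrow> 'a poly \<Rightarrow> 'a poly poly" where
  "bez_quot A B =
     (map_poly (\<lambda>a. [:a:]) A * [:B:] - map_poly (\<lambda>a. [:a:]) B * [:A:])
       div [: - [:0, 1:], 1 :]"

text \<open>Bez(A,B) = [c_{p,q}]_{1\<le>p,q\<le>n}, with c_{p,q} the coefficient of X^(p-1) Y^(q-1)
  (0-indexed here).\<close>
definition bez :: "nat \<Rightarrow> 'a::field poly \<Rightarrow> 'a poly \<Rightarrow> 'a mat" where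
  "bez n A B = mat n n (\<lambda>(p, q). coeff (coeff (bez_quot A B) p) q)"

definition nondeg_sym :: "nat \<Rightarrow> 'a::field mat set" where
  "nondeg_sym n = {M. M \<in> carrier_mat n n \<and> transpose_mat M = M \<and> det M \<noteq> 0}"

definition isom_forms :: "'a::field mat \<Rightarrow> 'a mat \<Rightarrow> bool" where
  "isom_forms M M' \<longleftrightarrow> (\<exists>P. P \<in> carrier_mat (dim_row M) (dim_row M) \<and> det P \<noteq> 0
        \<and> transpose_mat P * M * P = M')"

definition orth_sum :: "'a::field mat \<Rightarrow> 'a mat \<Rightarrow> 'a mat" where
  "orth_sum M N = four_block_mat M (0\<^sub>m (dim_row M) (dim_col N)) (0\<^sub>m (dim_row N) (dim_col M)) N"

definition stably_isom :: "'a::field mat \<Rightarrow> 'a mat \<Rightarrow> bool" where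
  "stably_isom M M' \<longleftrightarrow> (\<exists>m N. N \<in> nondeg_sym m \<and> isom_forms (orth_sum M N) (orth_sum M' N))"

definition stab_class :: "nat \<Rightarrow> 'a::field mat \<Rightarrow> 'a mat set" where
  "stab_class n M = {M'. M' \<in> nondeg_sym n \<and> stably_isom M M'}"

definition MWs :: "nat \<Rightarrow> 'a::field mat set set" where
  "MWs n = stab_class n ` nondeg_sym n"

definition pow_class :: "nat \<Rightarrow> 'a::field \<Rightarrow> 'a set" where
  "pow_class m d = {d'. d' \<noteq> 0 \<and> (\<exists>u. u \<noteq> 0 \<and> d' = u ^ m * d)}"

definition units_mod_pow :: "nat \<Rightarrow> 'a::field set set" where
  "units_mod_pow m = pow_class m ` (UNIV - {0})"

text \<open>MW^s_n(k) x_{k^x/k^x2} k^x/k^x(2n): pairs whose discriminant (det mod squares)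
  and class mod squares agree.\<close>
definition fibre_prod :: "nat \<Rightarrow> ('a::field mat set \<times> 'a set) set" where
  "fibre_prod n = {(c, e). c \<in> MWs n \<and> e \<in> units_mod_pow (2 * n) \<and>
      (\<exists>M\<in>c. \<exists>d\<in>e. \<exists>s. s \<noteq> 0 \<and> d = s ^ 2 * det M)}"

definition bez_map :: "nat \<Rightarrow> ('a::field poly \<times> 'a poly) set \<Rightarrow> 'a mat set \<times> 'a set" where
  "bez_map n C = the_elem ((\<lambda>(A, B). (stab_class n (bez n A B), pow_class (2 * n) (det (bez n A B)))) ` C)"

end

theory Submission
  imports Defs
begin

text \<open>Elementary matrices act by naive homotopies, so every class contains a pointed function: numerator
  monic of degree \<open>n\<close>, denominator of smaller degree. Following Euclid's algorithm, a pointed function is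
  deformed to a continued fraction with parameters \<open>u\<^sub>1, \<dots>, u\<^sub>n\<close>, whose Bezout form is
  \<open>\<langle>u\<^sub>1, \<dots>, u\<^sub>n\<rangle>\<close> with determinant exactly \<open>u\<^sub>1 \<cdots> u\<^sub>n\<close>. Paths of binary symmetric forms lift
  to homotopies that change two neighbouring parameters. These moves connect any two diagonal forms that are
  stably isometric and have the same determinant, in every characteristic: if the forms become isometric after
  adding a common summand, then either the first entry of one is represented by the other and can be split off from both,
  or both are isotropic and a hyperbolic pair can be split off from both.

  That the stable class of the Bezout form is a homotopy invariant holds for every symmetric matrix over
  \<open>k[T]\<close> with unit determinant: after adding metabolic forms the matrix becomes linear in \<open>T\<close>, a linear matrix
  that is not constant has a constant isotropic vector, and splitting off metabolic planes makes it constant.\<close>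

section \<open>Stable isometry\<close>

text \<open>In characteristic 2 Witt cancellation fails and an alternating form has no orthogonal
  basis. A homotopy keeps the determinant of the Bezout form exactly, because the units of k[T] are
  constants. So the moves on the parameters must keep their product exactly too, whereas an isometry
  controls it only up to squares. The 2n-th powers come from the scalars: (cA, cB) has c^2 times the
  Bezout form of (A, B). Conversely, a scalar combined with elementary matrices leads from A/B to
  A/(w^2 B). This multiplies each of the n parameters by w^2, hence their product by w^(2n).\<close>

lemma nondeg_symD:
  assumes "M \<in> nondeg_sym n"
  shows "M \<in> carrier_mat n n" "M\<^sup>T = M" "det M \<noteq> 0" "dim_row M = n" "dim_col M = n"
  using assms by (auto simp: nondeg_sym_def)

lemma nondeg_symI: "M \<in> carrier_mat n n \<Longrightarrow> M\<^sup>T = M \<Longrightarrow> det M \<noteq> 0 \<Longrightarrow> M \<in> nondeg_sym n"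
  by (simp add: nondeg_sym_def)

lemma det_congruence:
  assumes "M \<in> carrier_mat n n" "P \<in> carrier_mat n n"
  shows "det (P\<^sup>T * M * P) = det P ^ 2 * det M"
  using assms by (simp add: det_mult[of _ n] det_transpose[of P n] power2_eq_square)

lemma congruence_transpose:
  assumes "M \<in> carrier_mat n n" "P \<in> carrier_mat n m" "M\<^sup>T = M"
  shows "(P\<^sup>T * M * P)\<^sup>T = P\<^sup>T * M * (P :: 'a::comm_ring_1 mat)"
proof -
  have "(P\<^sup>T * M * P)\<^sup>T = P\<^sup>T * (P\<^sup>T * M)\<^sup>T"
    using assms by (intro transpose_mult[of _ m n]) auto
  also have "(P\<^sup>T * M)\<^sup>T = M\<^sup>T * P\<^sup>T\<^sup>T"
    using assms by (intro transpose_mult[of _ m n]) auto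
  finally show ?thesis using assms by simp
qed

lemma isom_formsI:
  assumes "M \<in> carrier_mat n n" "P \<in> carrier_mat n n" "P\<^sup>T * M * P = M'" "det M' \<noteq> 0"
  shows "isom_forms M M'"
  using assms det_congruence[OF assms(1,2)] unfolding isom_forms_def
  by (intro exI[of _ P]) auto

lemma isom_formsE:
  assumes "isom_forms M M'" "M \<in> carrier_mat n n"
  obtains P where "P \<in> carrier_mat n n" "det P \<noteq> 0" "P\<^sup>T * M * P = M'"
  using assms unfolding isom_forms_def by auto

lemma isom_forms_nondeg:
  assumes "isom_forms M M'" "M \<in> nondeg_sym n"
  shows "M' \<in> nondeg_sym n"
proof -
  note M = nondeg_symD[OF assms(2)]
  obtain P where P: "P \<in> carrier_mat n n" "det P \<noteq> 0" "P\<^sup>T * M * P = M'"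
    using isom_formsE[OF assms(1) M(1)] .
  show ?thesis
    using P M det_congruence[OF M(1) P(1)] congruence_transpose[OF M(1) P(1) M(2)]
    by (intro nondeg_symI) auto
qed

lemma isom_forms_refl: "M \<in> carrier_mat n n \<Longrightarrow> isom_forms M M"
  unfolding isom_forms_def by (intro exI[of _ "1\<^sub>m n"]) auto

lemma congruence_mult:
  assumes "(M :: 'a::comm_ring_1 mat) \<in> carrier_mat n n" "P \<in> carrier_mat n n" "Q \<in> carrier_mat n n"
  shows "Q\<^sup>T * (P\<^sup>T * M * P) * Q = (P * Q)\<^sup>T * M * (P * Q)"
proof -
  have "Q\<^sup>T * (P\<^sup>T * M * P) * Q = Q\<^sup>T * (P\<^sup>T * M * P * Q)"
    using assms by (intro assoc_mult_mat[of _ n n _ n _ n]) auto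
  also have "P\<^sup>T * M * P * Q = P\<^sup>T * (M * (P * Q))"
    using assms by (simp add: assoc_mult_mat[of _ n n _ n _ n])
  also have "Q\<^sup>T * (P\<^sup>T * (M * (P * Q))) = Q\<^sup>T * P\<^sup>T * (M * (P * Q))"
    using assms by (intro assoc_mult_mat[of _ n n _ n _ n, symmetric]) auto
  also have "\<dots> = (P * Q)\<^sup>T * M * (P * Q)"
    using assms by (subst assoc_mult_mat[of "Q\<^sup>T * P\<^sup>T" n n M n "P * Q" n, symmetric])
      (auto simp: transpose_mult[of _ n n] simp del: assoc_mult_mat)
  finally show ?thesis .
qed

lemma isom_forms_trans:
  assumes "isom_forms M M'" "isom_forms M' M''" "M \<in> carrier_mat n n"
  shows "isom_forms M M''"
proof -
  obtain P where P: "P \<in> carrier_mat n n" "det P \<noteq> 0" "P\<^sup>T * M * P = M'"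
    using isom_formsE[OF assms(1,3)] .
  have M': "M' \<in> carrier_mat n n" using P assms(3) by auto
  obtain Q where Q: "Q \<in> carrier_mat n n" "det Q \<noteq> 0" "Q\<^sup>T * M' * Q = M''"
    using isom_formsE[OF assms(2) M'] .
  have 1: "(P * Q)\<^sup>T * M * (P * Q) = M''"
    using congruence_mult[OF assms(3) P(1) Q(1)] P(3) Q(3) by simp
  show ?thesis unfolding isom_forms_def
    using 1 P Q assms(3) by (intro exI[of _ "P * Q"]) (auto simp: det_mult[of _ n])
qed

text \<open>The adjugate needs no division, so this also covers matrices over k[T] with unit
  determinant, where the paths of forms live.\<close>

lemma unit_det_inverse:
  fixes P :: "'a::comm_ring_1 mat"
  assumes "P \<in> carrier_mat n n" "det P dvd 1"
  obtains Q where "Q \<in> carrier_mat n n" "P * Q = 1\<^sub>m n" "Q * P = 1\<^sub>m n"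
proof -
  obtain c where c: "1 = det P * c" using assms(2) by (rule dvdE)
  define Q where "Q = c \<cdot>\<^sub>m adj_mat P"
  have Q: "Q \<in> carrier_mat n n" using adj_mat(1)[OF assms(1)] by (simp add: Q_def)
  have s: "c \<cdot>\<^sub>m (det P \<cdot>\<^sub>m 1\<^sub>m n) = 1\<^sub>m n" using c by (intro eq_matI) (auto simp: mult.commute)
  have 1: "P * Q = 1\<^sub>m n"
    unfolding Q_def mult_smult_distrib[OF assms(1) adj_mat(1)[OF assms(1)]] adj_mat(2)[OF assms(1)] by (rule s)
  have 2: "Q * P = 1\<^sub>m n"
    unfolding Q_def mult_smult_assoc_mat[OF adj_mat(1)[OF assms(1)] assms(1)] adj_mat(3)[OF assms(1)] by (rule s)
  from that[OF Q 1 2] show thesis .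
qed

lemma invertible_mat_ex:
  fixes P :: "'a::field mat"
  assumes "P \<in> carrier_mat n n" "det P \<noteq> 0"
  obtains Q where "Q \<in> carrier_mat n n" "P * Q = 1\<^sub>m n" "Q * P = 1\<^sub>m n" "det Q \<noteq> 0"
proof -
  obtain Q where Q: "Q \<in> carrier_mat n n" "P * Q = 1\<^sub>m n" "Q * P = 1\<^sub>m n"
    using unit_det_inverse[OF assms(1)] assms(2) by (metis dvd_field_iff one_neq_zero)
  have "det P * det Q = 1" using Q(2) assms(1) Q det_mult[of P n Q] by simp
  then have "det Q \<noteq> 0" by auto
  with that Q show thesis by blast
qed

lemma isom_forms_sym:
  assumes "isom_forms M M'" "M \<in> carrier_mat n n"
  shows "isom_forms M' M"
proof -
  obtain P where P: "P \<in> carrier_mat n n" "det P \<noteq> 0" "P\<^sup>T * M * P = M'"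
    using isom_formsE[OF assms] .
  obtain Q where Q: "Q \<in> carrier_mat n n" "P * Q = 1\<^sub>m n" "Q * P = 1\<^sub>m n" "det Q \<noteq> 0"
    using invertible_mat_ex[OF P(1,2)] .
  have "Q\<^sup>T * (P\<^sup>T * M * P) * Q = (P * Q)\<^sup>T * M * (P * Q)"
    using congruence_mult[OF assms(2) P(1) Q(1)] .
  also have "\<dots> = M" unfolding Q(2) using assms(2) by simp
  finally have 3: "Q\<^sup>T * M' * Q = M" unfolding P(3) .
  have "dim_row M' = n" using P(1) unfolding P(3)[symmetric] by simp
  then show ?thesis unfolding isom_forms_def
    using Q(1,4) 3 by (intro exI[of _ Q]) simp
qed

lemma orth_sum_carrier [simp]:
  "M \<in> carrier_mat n n \<Longrightarrow> N \<in> carrier_mat m m \<Longrightarrow> orth_sum M N \<in> carrier_mat (n + m) (n + m)"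
  by (simp add: orth_sum_def)

lemma orth_sum_assoc:
  assumes "L \<in> carrier_mat l l" "M \<in> carrier_mat m m" "N \<in> carrier_mat n n"
  shows "orth_sum (orth_sum L M) N = orth_sum L (orth_sum M N)"
  unfolding orth_sum_def using assoc_four_block_mat[of L M N] by simp

lemma orth_sum_eq:
  "M \<in> carrier_mat n n \<Longrightarrow> N \<in> carrier_mat m m \<Longrightarrow>
   orth_sum M N = four_block_mat M (0\<^sub>m n m) (0\<^sub>m m n) N"
  by (auto simp: orth_sum_def)

lemma det_orth_sum:
  "M \<in> carrier_mat n n \<Longrightarrow> N \<in> carrier_mat m m \<Longrightarrow> det (orth_sum M N) = det M * det N"
  by (simp add: orth_sum_eq det_four_block_mat_upper_right_zero)

lemma orth_sum_nondeg [simp]: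
  assumes "M \<in> nondeg_sym n" "N \<in> nondeg_sym m"
  shows "orth_sum M N \<in> nondeg_sym (n + m)"
proof -
  note M = nondeg_symD[OF assms(1)] and N = nondeg_symD[OF assms(2)]
  show ?thesis
    using M N det_orth_sum[OF M(1) N(1)] by (intro nondeg_symI)
      (auto simp: transpose_four_block_mat[of _ n n _ m _ m] orth_sum_eq[OF M(1) N(1)])
qed

lemma orth_sum_congruence:
  assumes "M \<in> carrier_mat n n" "N \<in> carrier_mat m m" "P \<in> carrier_mat n n" "Q \<in> carrier_mat m m"
  shows "(orth_sum P Q)\<^sup>T * orth_sum M N * orth_sum P Q = orth_sum (P\<^sup>T * M * P) (Q\<^sup>T * N * Q)"
proof -
  have c: "P\<^sup>T * M * P \<in> carrier_mat n n" "Q\<^sup>T * N * Q \<in> carrier_mat m m" using assms by auto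
  show ?thesis
  unfolding orth_sum_eq[OF c] orth_sum_eq[OF assms(3,4)] orth_sum_eq[OF assms(1,2)]
  using assms
  by (simp add: transpose_four_block_mat[of _ n n _ m _ m]
      mult_four_block_mat[of _ n n _ m _ m _ _ n _ m])
qed

lemma isom_forms_orth_sum:
  assumes "isom_forms M M'" "isom_forms N N'" "M \<in> carrier_mat n n" "N \<in> carrier_mat m m"
  shows "isom_forms (orth_sum M N) (orth_sum M' N')"
proof -
  obtain P where P: "P \<in> carrier_mat n n" "det P \<noteq> 0" "P\<^sup>T * M * P = M'"
    using isom_formsE[OF assms(1,3)] .
  obtain Q where Q: "Q \<in> carrier_mat m m" "det Q \<noteq> 0" "Q\<^sup>T * N * Q = N'"
    using isom_formsE[OF assms(2,4)] .
  have c: "orth_sum P Q \<in> carrier_mat (n + m) (n + m)" "orth_sum M N \<in> carrier_mat (n + m) (n + m)"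
    using orth_sum_carrier[OF P(1) Q(1)] orth_sum_carrier[OF assms(3,4)] by auto
  show ?thesis unfolding isom_forms_def
  proof (intro exI conjI)
    show "(orth_sum P Q)\<^sup>T * orth_sum M N * orth_sum P Q = orth_sum M' N'"
      unfolding orth_sum_congruence[OF assms(3,4) P(1) Q(1)] P(3) Q(3) ..
    show "det (orth_sum P Q) \<noteq> 0" using det_orth_sum[OF P(1) Q(1)] P Q by simp
  qed (use c in auto)
qed

lemma isom_forms_orth_sum_commute:
  assumes M: "M \<in> nondeg_sym m" and N: "N \<in> nondeg_sym n"
  shows "isom_forms (orth_sum M N) (orth_sum N M)"
proof -
  note M = M nondeg_symD[OF M] and N = N nondeg_symD[OF N]
  let ?P = "four_block_mat (0\<^sub>m m n) (1\<^sub>m m) (1\<^sub>m n) (0\<^sub>m n m) :: 'a mat"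
  have c: "?P \<in> carrier_mat (m + n) (m + n)" by (rule carrier_matI) auto
  have 1: "?P\<^sup>T = four_block_mat (0\<^sub>m n m) (1\<^sub>m n) (1\<^sub>m m) (0\<^sub>m m n)"
    by (simp add: transpose_four_block_mat[of _ m n _ m _ n])
  have 2: "?P\<^sup>T * orth_sum M N = four_block_mat (0\<^sub>m n m) N M (0\<^sub>m m n)"
    unfolding orth_sum_eq[OF M(2) N(2)] 1 using M(2) N(2)
    by (subst mult_four_block_mat[of _ n m _ n _ m _ _ m _ n]) auto
  have "?P\<^sup>T * orth_sum M N * ?P = orth_sum N M"
    unfolding 2 orth_sum_eq[OF N(2) M(2)] using M(2) N(2)
    by (subst mult_four_block_mat[of _ n m _ n _ m _ _ n _ m]) auto
  moreover have "det (orth_sum N M) \<noteq> 0" using nondeg_symD[OF orth_sum_nondeg[OF N(1) M(1)]] by simp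
  ultimately show ?thesis
    using isom_formsI[OF orth_sum_carrier[OF M(2) N(2)] c] by blast
qed

lemma stably_isomI:
  "N \<in> nondeg_sym m \<Longrightarrow> isom_forms (orth_sum M N) (orth_sum M' N) \<Longrightarrow> stably_isom M M'"
  by (auto simp: stably_isom_def)

lemma isom_forms_stably_isom:
  assumes "isom_forms M M'" "M \<in> nondeg_sym n"
  shows "stably_isom M M'"
proof (rule stably_isomI)
  show "1\<^sub>m 1 \<in> nondeg_sym 1" by (auto intro: nondeg_symI)
  show "isom_forms (orth_sum M (1\<^sub>m 1)) (orth_sum M' (1\<^sub>m 1))"
    using assms nondeg_symD[OF assms(2)]
    by (auto intro!: isom_forms_orth_sum isom_forms_refl)
qed

lemma stably_isom_refl: "M \<in> nondeg_sym n \<Longrightarrow> stably_isom M M"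
  by (rule isom_forms_stably_isom[OF isom_forms_refl[OF nondeg_symD(1)]])

lemma stably_isom_sym:
  assumes "stably_isom M M'" "M \<in> nondeg_sym n"
  shows "stably_isom M' M"
proof -
  from assms(1) obtain m N where N: "N \<in> nondeg_sym m"
    and *: "isom_forms (orth_sum M N) (orth_sum M' N)" unfolding stably_isom_def by blast
  have "orth_sum M N \<in> carrier_mat (n + m) (n + m)"
    using N assms(2) by (simp add: nondeg_symD(1))
  then show ?thesis by (intro stably_isomI[OF N] isom_forms_sym[OF *])
qed

text \<open>Each isometry is enlarged by the auxiliary summand of the other. The two sides are then
  stabilised by \<open>orth_sum N N'\<close> and \<open>orth_sum N' N\<close>, which differ only by
  a swap.\<close>

lemma stably_isom_trans:
  assumes 1: "stably_isom M M'" and 2: "stably_isom M' M''"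
    and M: "M \<in> nondeg_sym n" and M': "M' \<in> nondeg_sym n" and M'': "M'' \<in> nondeg_sym n"
  shows "stably_isom M M''"
proof -
  from 1 obtain m N where N: "N \<in> nondeg_sym m"
    and i: "isom_forms (orth_sum M N) (orth_sum M' N)" unfolding stably_isom_def by blast
  from 2 obtain m' N' where N': "N' \<in> nondeg_sym m'"
    and i': "isom_forms (orth_sum M' N') (orth_sum M'' N')" unfolding stably_isom_def by blast
  note c = nondeg_symD(1)[OF M] nondeg_symD(1)[OF M'] nondeg_symD(1)[OF M'']
    nondeg_symD(1)[OF N] nondeg_symD(1)[OF N']
  have a: "isom_forms (orth_sum M (orth_sum N N')) (orth_sum M' (orth_sum N N'))"
    using isom_forms_orth_sum[OF i isom_forms_refl[OF c(5)] orth_sum_carrier[OF c(1,4)] c(5)]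
    by (simp add: orth_sum_assoc[OF c(1,4,5)] orth_sum_assoc[OF c(2,4,5)])
  have swap: "isom_forms (orth_sum L (orth_sum A B)) (orth_sum L (orth_sum B A))"
    if "L \<in> nondeg_sym n" "A \<in> nondeg_sym a" "B \<in> nondeg_sym b" for L A B a b
    using that nondeg_symD(1)[OF orth_sum_nondeg[OF that(2,3)]]
    by (intro isom_forms_orth_sum[OF isom_forms_refl isom_forms_orth_sum_commute])
       (auto dest: nondeg_symD)
  have b: "isom_forms (orth_sum M' (orth_sum N' N)) (orth_sum M'' (orth_sum N' N))"
    using isom_forms_orth_sum[OF i' isom_forms_refl[OF c(4)] orth_sum_carrier[OF c(2,5)] c(4)]
    by (simp add: orth_sum_assoc[OF c(2,5,4)] orth_sum_assoc[OF c(3,5,4)])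
  note d = orth_sum_carrier[OF c(1) orth_sum_carrier[OF c(4,5)]]
    orth_sum_carrier[OF c(2) orth_sum_carrier[OF c(4,5)]]
    orth_sum_carrier[OF c(2) orth_sum_carrier[OF c(5,4)]]
  have "isom_forms (orth_sum M' (orth_sum N' N)) (orth_sum M'' (orth_sum N N'))"
    by (rule isom_forms_trans[OF b swap[OF M'' N' N] d(3)])
  then have "isom_forms (orth_sum M' (orth_sum N N')) (orth_sum M'' (orth_sum N N'))"
    by (rule isom_forms_trans[OF swap[OF M' N N'] _ d(2)])
  then have "isom_forms (orth_sum M (orth_sum N N')) (orth_sum M'' (orth_sum N N'))"
    by (rule isom_forms_trans[OF a _ d(1)])
  then show ?thesis by (rule stably_isomI[OF orth_sum_nondeg[OF N N']])
qed

lemma stably_isom_orth_sum_left: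
  assumes "stably_isom M M'" "L \<in> nondeg_sym l" "M \<in> nondeg_sym n" "M' \<in> nondeg_sym n"
  shows "stably_isom (orth_sum L M) (orth_sum L M')"
proof -
  from assms(1) obtain m N where N: "N \<in> nondeg_sym m"
    and i: "isom_forms (orth_sum M N) (orth_sum M' N)" unfolding stably_isom_def by blast
  note c = nondeg_symD(1)[OF assms(2)] nondeg_symD(1)[OF assms(3)] nondeg_symD(1)[OF assms(4)]
    nondeg_symD(1)[OF N]
  show ?thesis
    using isom_forms_orth_sum[OF isom_forms_refl[OF c(1)] i c(1) orth_sum_carrier[OF c(2,4)]] N
    by (intro stably_isomI[of N m]) (simp_all add: orth_sum_assoc[OF c(1,2,4)] orth_sum_assoc[OF c(1,3,4)])
qed

lemma stably_isom_orth_sum_commute: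
  "M \<in> nondeg_sym m \<Longrightarrow> N \<in> nondeg_sym n \<Longrightarrow> stably_isom (orth_sum M N) (orth_sum N M)"
  by (rule isom_forms_stably_isom[OF isom_forms_orth_sum_commute orth_sum_nondeg])

lemma stably_isom_orth_sum_right:
  assumes "stably_isom M M'" "L \<in> nondeg_sym l" "M \<in> nondeg_sym n" "M' \<in> nondeg_sym n"
  shows "stably_isom (orth_sum M L) (orth_sum M' L)"
proof -
  have n: "orth_sum M L \<in> nondeg_sym (n + l)" "orth_sum M' L \<in> nondeg_sym (n + l)"
    "orth_sum L M \<in> nondeg_sym (n + l)" "orth_sum L M' \<in> nondeg_sym (n + l)"
    using assms(2-4) orth_sum_nondeg[of L l _ n] by (auto simp: add.commute[of l n])
  have "stably_isom (orth_sum L M) (orth_sum M' L)"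
    by (rule stably_isom_trans[OF stably_isom_orth_sum_left[OF assms]
         stably_isom_orth_sum_commute[OF assms(2,4)] n(3,4,2)])
  then show ?thesis
    by (rule stably_isom_trans[OF stably_isom_orth_sum_commute[OF assms(3,2)] _ n(1,3,2)])
qed

text \<open>This cancellation is formal: the cancelled summand joins the auxiliary one, and nothing
  like Witt's theorem enters.\<close>

lemma stably_isom_cancel:
  assumes "stably_isom (orth_sum M L) (orth_sum M' L)"
    "L \<in> nondeg_sym l" "M \<in> nondeg_sym n" "M' \<in> nondeg_sym n"
  shows "stably_isom M M'"
proof -
  from assms(1) obtain m N where N: "N \<in> nondeg_sym m"
    and i: "isom_forms (orth_sum (orth_sum M L) N) (orth_sum (orth_sum M' L) N)"
    unfolding stably_isom_def by blast
  note c = nondeg_symD(1)[OF assms(2)] nondeg_symD(1)[OF assms(3)] nondeg_symD(1)[OF assms(4)]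
    nondeg_symD(1)[OF N]
  show ?thesis
    using i assms(2) N by (intro stably_isomI[of "orth_sum L N" "l + m"])
     (simp_all add: orth_sum_assoc[OF c(2,1,4)] orth_sum_assoc[OF c(3,1,4)])
qed

section \<open>Metabolic and diagonal forms\<close>

text \<open>In a basis \<open>f, g\<close> the span of \<open>f\<close> is its own orthogonal
  complement. Where 2 is invertible, \<open>g\<close> can be corrected by half of \<open>C\<close>
  to make \<open>C\<close> vanish; in general it cannot, so \<open>C\<close> is part of the
  data.\<close>

definition metabolic :: "'a::comm_ring_1 mat \<Rightarrow> 'a mat" where
  "metabolic C = four_block_mat (0\<^sub>m (dim_row C) (dim_row C)) (1\<^sub>m (dim_row C)) (1\<^sub>m (dim_row C)) C"

lemma metabolic_carrier [simp]: "C \<in> carrier_mat n n \<Longrightarrow> metabolic C \<in> carrier_mat (n + n) (n + n)"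
  by (simp add: metabolic_def)

lemma metabolic_eq: "C \<in> carrier_mat n n \<Longrightarrow> metabolic C = four_block_mat (0\<^sub>m n n) (1\<^sub>m n) (1\<^sub>m n) C"
  by (simp add: metabolic_def)

lemma transpose_metabolic: "C \<in> carrier_mat n n \<Longrightarrow> C\<^sup>T = C \<Longrightarrow> (metabolic C)\<^sup>T = metabolic C"
  by (simp add: metabolic_eq transpose_four_block_mat[of _ n n _ n _ n])

lemma det_metabolic_dvd_1:
  assumes "C \<in> carrier_mat n n"
  shows "det (metabolic C) dvd 1"
proof -
  let ?Q = "four_block_mat (- C) (1\<^sub>m n) (1\<^sub>m n) (0\<^sub>m n n)"
  have Q: "?Q \<in> carrier_mat (n + n) (n + n)" using assms by auto
  have "- C + C = 0\<^sub>m n n" "- 0\<^sub>m n n + 1\<^sub>m n = (1\<^sub>m n :: 'a mat)"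
    using assms by (auto intro!: eq_matI)
  then have "metabolic C * ?Q = 1\<^sub>m (n + n)"
    using assms unfolding metabolic_eq[OF assms]
    by (subst mult_four_block_mat[of _ n n _ n _ n _ _ n _ n]) auto
  then have "det (metabolic C) * det ?Q = 1"
    using det_mult[OF metabolic_carrier[OF assms] Q] by simp
  then show ?thesis by (metis dvd_triv_left)
qed

lemma metabolic_nondeg [simp]:
  assumes "(C :: 'a::field mat) \<in> carrier_mat n n" "C\<^sup>T = C"
  shows "metabolic C \<in> nondeg_sym (n + n)"
  using det_metabolic_dvd_1[OF assms(1)] transpose_metabolic[OF assms] assms
  by (intro nondeg_symI) auto

lemma uminus_sym: "(C :: 'a::field mat) \<in> carrier_mat n n \<Longrightarrow> C\<^sup>T = C \<Longrightarrow> (- C)\<^sup>T = - C"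
  by (metis transpose_uminus)

text \<open>With bases \<open>f, g\<close> of the first and \<open>f', g'\<close> of the second summand, the isometry is
  \<open>g \<mapsto> g + g'\<close>, \<open>f' \<mapsto> f' - f\<close>, \<open>g' \<mapsto> g' + C f\<close>.\<close>

lemma metabolic_orth_sum_metabolic:
  assumes C: "(C :: 'a::field mat) \<in> carrier_mat n n" and sym: "C\<^sup>T = C"
  shows "isom_forms (orth_sum (metabolic C) (metabolic (- C))) (orth_sum (metabolic (0\<^sub>m n n)) (metabolic (- C)))"
proof -
  have C': "- C \<in> carrier_mat n n" "(- C)\<^sup>T = - C" using C sym by (auto simp: uminus_sym)
  have Z: "0\<^sub>m n n \<in> carrier_mat n n" "(0\<^sub>m n n :: 'a mat)\<^sup>T = 0\<^sub>m n n" by auto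
  have I: "1\<^sub>m n \<in> carrier_mat n n" "- 1\<^sub>m n \<in> carrier_mat n n" "(- 1\<^sub>m n :: 'a mat)\<^sup>T = - 1\<^sub>m n"
    by (auto simp: transpose_uminus)
  define A where "A = metabolic C"
  define N where "N = metabolic (- C)"
  define X :: "'a mat" where "X = four_block_mat (0\<^sub>m n n) (0\<^sub>m n n) (0\<^sub>m n n) (1\<^sub>m n)"
  define Y where "Y = four_block_mat (- 1\<^sub>m n) C (0\<^sub>m n n) (0\<^sub>m n n)"
  define P where "P = four_block_mat (1\<^sub>m (n + n)) Y X (1\<^sub>m (n + n))"
  have cA: "A \<in> carrier_mat (n + n) (n + n)" unfolding A_def using C by simp
  have cN: "N \<in> carrier_mat (n + n) (n + n)" unfolding N_def using C' by simp
  have cX: "X \<in> carrier_mat (n + n) (n + n)" unfolding X_def by simp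
  have cY: "Y \<in> carrier_mat (n + n) (n + n)" unfolding Y_def using C by simp
  have cP: "P \<in> carrier_mat (n + n + (n + n)) (n + n + (n + n))" unfolding P_def using cX cY by simp
  note bl = mult_four_block_mat[of _ n n _ n _ n _ _ n _ n]
  have XT: "X\<^sup>T = X" unfolding X_def by (simp add: transpose_four_block_mat[of _ n n _ n _ n])
  have YT: "Y\<^sup>T = four_block_mat (- 1\<^sub>m n) (0\<^sub>m n n) C (0\<^sub>m n n)" unfolding Y_def
    using C sym I by (simp add: transpose_four_block_mat[of _ n n _ n _ n])
  have mI: "- 1\<^sub>m n * D = - D" "D * - 1\<^sub>m n = - D" if "D \<in> carrier_mat n n" for D :: "'a mat"
    using that by auto
  have un: "- D + D = 0\<^sub>m n n" "D - D = 0\<^sub>m n n" "D + - D = 0\<^sub>m n n" if "D \<in> carrier_mat n n" for D :: "'a mat"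
    using that by (auto intro!: eq_matI)
  have XN: "X\<^sup>T * N = four_block_mat (0\<^sub>m n n) (0\<^sub>m n n) (1\<^sub>m n) (- C)"
    unfolding XT unfolding X_def N_def metabolic_eq[OF C'(1)] using C C'
    by (subst bl) auto
  have NX: "N * X = four_block_mat (0\<^sub>m n n) (1\<^sub>m n) (0\<^sub>m n n) (- C)"
    unfolding X_def N_def metabolic_eq[OF C'(1)] using C C'
    by (subst bl) auto
  have AY: "A * Y = four_block_mat (0\<^sub>m n n) (0\<^sub>m n n) (- 1\<^sub>m n) C"
    unfolding Y_def A_def metabolic_eq[OF C(1)] using C C' I
    by (subst bl) (auto simp: mI)
  have YA: "Y\<^sup>T * A = four_block_mat (0\<^sub>m n n) (- 1\<^sub>m n) (0\<^sub>m n n) C"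
    unfolding YT unfolding A_def metabolic_eq[OF C(1)] using C C' I
    by (subst bl) (auto simp: mI)
  have XNX: "X\<^sup>T * N * X = four_block_mat (0\<^sub>m n n) (0\<^sub>m n n) (0\<^sub>m n n) (- C)"
    unfolding XN unfolding X_def using C C' I
    by (subst bl) (auto simp: mI)
  have YAY: "Y\<^sup>T * A * Y = 0\<^sub>m (n + n) (n + n)"
    unfolding YA unfolding Y_def four_block_zero_mat[symmetric] using C C' I
    by (subst bl) (auto simp: mI)
  have P1: "P\<^sup>T = four_block_mat (1\<^sub>m (n + n)) X\<^sup>T Y\<^sup>T (1\<^sub>m (n + n))"
    unfolding P_def using cX cY by (simp add: transpose_four_block_mat[of _ "n+n" "n+n" _ "n+n" _ "n+n"])
  have P2: "P\<^sup>T * orth_sum A N = four_block_mat A (X\<^sup>T * N) (Y\<^sup>T * A) N"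
    unfolding P1 orth_sum_eq[OF cA cN] using cA cN cX cY
    by (subst mult_four_block_mat[of _ "n+n" "n+n" _ "n+n" _ "n+n" _ _ "n+n" _ "n+n"]) auto
  have P3: "P\<^sup>T * orth_sum A N * P = four_block_mat (A + X\<^sup>T * N * X) (A * Y + X\<^sup>T * N)
     (Y\<^sup>T * A + N * X) (Y\<^sup>T * A * Y + N)"
    unfolding P2 unfolding P_def using cA cN cX cY
    by (subst mult_four_block_mat[of _ "n+n" "n+n" _ "n+n" _ "n+n" _ _ "n+n" _ "n+n"])
      auto
  have B1: "A + X\<^sup>T * N * X = metabolic (0\<^sub>m n n)"
    unfolding A_def metabolic_eq[OF C(1)] metabolic_eq[OF Z(1)] XNX using C C' I un
    by (subst add_four_block_mat[of _ n n _ n _ n]) auto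
  have B2: "A * Y + X\<^sup>T * N = 0\<^sub>m (n + n) (n + n)"
    unfolding AY XN four_block_zero_mat[symmetric] using C C' I un
    by (subst add_four_block_mat[of _ n n _ n _ n]) auto
  have B3: "Y\<^sup>T * A + N * X = 0\<^sub>m (n + n) (n + n)"
    unfolding YA NX four_block_zero_mat[symmetric] using C C' I un
    by (subst add_four_block_mat[of _ n n _ n _ n]) auto
  have "P\<^sup>T * orth_sum A N * P = orth_sum (metabolic (0\<^sub>m n n)) N"
    unfolding P3 B1 B2 B3 YAY orth_sum_eq[OF metabolic_carrier[OF Z(1)] cN] using cN by simp
  then show ?thesis unfolding A_def N_def
    using nondeg_symD(3)[OF orth_sum_nondeg[OF metabolic_nondeg[OF Z] metabolic_nondeg[OF C']]]
      orth_sum_carrier[OF metabolic_carrier[OF C] metabolic_carrier[OF C'(1)]]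
    by (intro isom_formsI[OF _ cP]) auto
qed

text \<open>With \<open>metabolic (- C)\<close> as auxiliary summand, \<open>metabolic C\<close>
  becomes isometric to the hyperbolic form, which is thus a common reference for all
  \<open>C\<close> of one size.\<close>

lemma stably_isom_metabolic:
  assumes "(C :: 'a::field mat) \<in> carrier_mat n n" "C\<^sup>T = C" "C' \<in> carrier_mat n n" "C'\<^sup>T = C'"
  shows "stably_isom (metabolic C) (metabolic C')"
proof -
  have Z: "0\<^sub>m n n \<in> carrier_mat n n" "(0\<^sub>m n n :: 'a mat)\<^sup>T = 0\<^sub>m n n" by auto
  have *: "stably_isom (metabolic C) (metabolic (0\<^sub>m n n))" if "C \<in> carrier_mat n n" "C\<^sup>T = C" for C :: "'a mat"
    using metabolic_orth_sum_metabolic[OF that] that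
    by (intro stably_isomI[OF metabolic_nondeg[of "- C" n]]) (auto simp: uminus_sym)
  show ?thesis
    by (rule stably_isom_trans[OF *[OF assms(1,2)]
         stably_isom_sym[OF *[OF assms(3,4)] metabolic_nondeg[OF assms(3,4)]]
         metabolic_nondeg[OF assms(1,2)] metabolic_nondeg[OF Z] metabolic_nondeg[OF assms(3,4)]])
qed

section \<open>Diagonal forms and binary isometries\<close>

definition diag :: "'a::field list \<Rightarrow> 'a mat" where
  "diag us = mat (length us) (length us) (\<lambda>(i, j). if i = j then us ! i else 0)"

lemma diag_carrier [simp]: "diag us \<in> carrier_mat (length us) (length us)"
  by (simp add: diag_def)

lemma transpose_diag [simp]: "(diag us)\<^sup>T = diag us"
  by (rule eq_matI) (auto simp: diag_def)

lemma diag_append: "diag (us @ vs) = orth_sum (diag us) (diag vs)"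
  by (rule eq_matI) (auto simp: diag_def orth_sum_def nth_append)

lemma diag_Cons: "diag (u # us) = orth_sum (diag [u]) (diag us)"
  using diag_append[of "[u]" us] by simp

lemma diag_Cons2: "diag (u # v # us) = orth_sum (diag [u, v]) (diag us)"
  using diag_append[of "[u, v]" us] by simp

lemma det_diag: "det (diag us) = prod_list us"
proof (induction us)
  case Nil
  then show ?case by (simp add: det_dim_zero[OF diag_carrier[of "[]", simplified]])
next
  case (Cons u us)
  have "det (diag [u]) = u" using det_single[of "diag [u]"] diag_carrier[of "[u]"] by (simp add: diag_def)
  then show ?case using Cons det_orth_sum[OF diag_carrier[of "[u]"] diag_carrier[of us]]
    by (simp add: diag_Cons[of u us])
qed

lemma diag_nondeg [simp]: "0 \<notin> set us \<Longrightarrow> diag us \<in> nondeg_sym (length us)"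
  using det_diag[of us] by (intro nondeg_symI) (auto simp: prod_list_zero_iff transpose_diag)

lemma congruence_diag_2:
  assumes "P \<in> carrier_mat 2 2" "i < 2" "j < 2"
  shows "(P\<^sup>T * diag [u, v] * P) $$ (i, j) = u * P $$ (0, i) * P $$ (0, j) + v * P $$ (1, i) * P $$ (1, j)"
  using assms by (auto simp: diag_def scalar_prod_def numeral_2_eq_2)

text \<open>The first new basis vector is (x, y), of norm \<open>u'\<close>. The second is (- v y, u
  x) / u', orthogonal to it and scaled so that the base change has determinant 1; this forces its
  norm to be \<open>v'\<close>.\<close>

lemma isom_diag_pair:
  fixes u v u' v' :: "'a::field"
  assumes "u' = u * x\<^sup>2 + v * y\<^sup>2" "u' * v' = u * v" "u \<noteq> 0" "v \<noteq> 0" "u' \<noteq> 0" "v' \<noteq> 0"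
  shows "isom_forms (diag [u, v]) (diag [u', v'])"
proof -
  define P where "P = mat 2 2 (\<lambda>(i, j). if i = 0 then (if j = 0 then x else - (v * y / u'))
    else (if j = 0 then y else u * x / u'))"
  have v': "v' = u * v / u'" using assms by (simp add: field_simps)
  have e: "u * v\<^sup>2 * y\<^sup>2 + v * u\<^sup>2 * x\<^sup>2 = u * v * u'"
    unfolding assms(1) by (simp add: power2_eq_square algebra_simps)
  have "u * (v * y / u')\<^sup>2 + v * (u * x / u')\<^sup>2 = (u * v\<^sup>2 * y\<^sup>2 + v * u\<^sup>2 * x\<^sup>2) / u'\<^sup>2"
    by (simp add: power2_eq_square add_divide_distrib ac_simps)
  then have e': "u * (v * y / u')\<^sup>2 + v * (u * x / u')\<^sup>2 = v'"
    unfolding e v' using assms(5) by (simp add: power2_eq_square)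
  have c: "P \<in> carrier_mat 2 2" by (simp add: P_def)
  have "P\<^sup>T * diag [u, v] * P = diag [u', v']"
  proof (rule eq_matI)
    fix i j assume "i < dim_row (diag [u', v'])" "j < dim_col (diag [u', v'])"
    then have "i = 0 \<or> i = 1" "j = 0 \<or> j = 1" by (auto simp: diag_def)
    then show "(P\<^sup>T * diag [u, v] * P) $$ (i, j) = diag [u', v'] $$ (i, j)"
      using e' assms(1)
      by (elim disjE; simp add: congruence_diag_2[OF c]) (auto simp: P_def diag_def power2_eq_square mult.assoc)
  qed (auto simp: P_def diag_def)
  then show ?thesis
    using assms c diag_carrier[of "[u, v]"]
    by (intro isom_formsI[of _ 2 P]) (simp_all add: det_diag numeral_2_eq_2)
qed

text \<open>The vector (1/w, 1/v) is isotropic because \<open>u * v = - w\<^sup>2\<close>, and it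
  pairs to 1 with the second basis vector, which has norm \<open>v\<close>.\<close>

lemma isom_diag_metabolic:
  fixes u v w :: "'a::field"
  assumes "u * v = - w\<^sup>2" "u \<noteq> 0" "v \<noteq> 0"
  shows "isom_forms (diag [u, v]) (metabolic (diag [v]))"
proof -
  have w: "w \<noteq> 0" using assms by auto
  define P where "P = mat 2 2 (\<lambda>(i, j). if i = 0 then (if j = 0 then 1 / w else 0)
    else (if j = 0 then 1 / v else 1))"
  have c: "P \<in> carrier_mat 2 2" by (simp add: P_def)
  have "P\<^sup>T * diag [u, v] * P = metabolic (diag [v])"
  proof (rule eq_matI)
    fix i j assume "i < dim_row (metabolic (diag [v]))" "j < dim_col (metabolic (diag [v]))"
    then have "i = 0 \<or> i = 1" "j = 0 \<or> j = 1" by (auto simp: diag_def metabolic_def)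
    then show "(P\<^sup>T * diag [u, v] * P) $$ (i, j) = metabolic (diag [v]) $$ (i, j)"
      using assms w
      by (elim disjE; simp add: congruence_diag_2[OF c])
        (auto simp: P_def diag_def metabolic_def divide_simps power2_eq_square)
  qed (auto simp: P_def diag_def metabolic_def)
  then show ?thesis
    using c diag_carrier[of "[u, v]"] nondeg_symD(3)[OF metabolic_nondeg[OF diag_carrier[of "[v]"]]]
    by (intro isom_formsI[of _ 2 P]) (simp_all add: numeral_2_eq_2)
qed

text \<open>Both sides are metabolic planes, and these are stably isometric whatever their
  parameter. In characteristic 2 they need not be isometric: the form with entries u, -u takes only
  values that are u times a square.\<close>

lemma stably_isom_diag_hyperbolic:
  fixes u v w :: "'a::field"
  assumes "u * v = - w\<^sup>2" "u' * v' = - w'\<^sup>2" "u \<noteq> 0" "v \<noteq> 0" "u' \<noteq> 0" "v' \<noteq> 0"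
  shows "stably_isom (diag [u, v]) (diag [u', v'])"
proof -
  have d: "diag [v] \<in> carrier_mat 1 1" "(diag [v])\<^sup>T = diag [v]" for v :: 'a by (auto simp: diag_def)
  note m = metabolic_nondeg[OF d, simplified]
  have n: "diag [u, v] \<in> nondeg_sym 2" "diag [u', v'] \<in> nondeg_sym 2"
    "metabolic (diag [v]) \<in> nondeg_sym 2" "metabolic (diag [v']) \<in> nondeg_sym 2"
    using assms diag_nondeg[of "[u, v]"] diag_nondeg[of "[u', v']"] m by (auto simp: numeral_2_eq_2)
  note 1 = isom_forms_stably_isom[OF isom_diag_metabolic[OF assms(1,3,4)] n(1)]
  note 2 = isom_forms_stably_isom[OF isom_diag_metabolic[OF assms(2,5,6)] n(2)]
  show ?thesis
    by (rule stably_isom_trans[OF 1 stably_isom_trans[OF stably_isom_metabolic[OF d d]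
          stably_isom_sym[OF 2 n(2)] n(3,4,2)] n(1,3,2)])
qed

section \<open>Cancellation for diagonal forms\<close>

text \<open>Moves that preserve the product of the entries exactly, not only up to squares. The last one
  follows from \<open>deq_pair\<close> unless the characteristic is 2.\<close>

inductive deq :: "'a::field list \<Rightarrow> 'a list \<Rightarrow> bool" where
  deq_refl: "deq us us"
| deq_sym: "deq us vs \<Longrightarrow> deq vs us"
| deq_trans: "deq us vs \<Longrightarrow> deq vs ws \<Longrightarrow> deq us ws"
| deq_Cons: "deq us vs \<Longrightarrow> deq (c # us) (c # vs)"
| deq_pair: "u' = u * x\<^sup>2 + v * y\<^sup>2 \<Longrightarrow> u' * v' = u * v \<Longrightarrow> u \<noteq> 0 \<Longrightarrow> v \<noteq> 0 \<Longrightarrow> u' \<noteq> 0 \<Longrightarrow> v' \<noteq> 0 \<Longrightarrow>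
    deq (u # v # us) (u' # v' # us)"
| deq_hyp: "u * v = - w\<^sup>2 \<Longrightarrow> u' * v' = - w\<^sup>2 \<Longrightarrow> u \<noteq> 0 \<Longrightarrow> v \<noteq> 0 \<Longrightarrow> u' \<noteq> 0 \<Longrightarrow> v' \<noteq> 0 \<Longrightarrow>
    deq (u # v # us) (u' # v' # us)"

lemma deq_length: "deq us vs \<Longrightarrow> length us = length vs"
  by (induction rule: deq.induct) auto

lemma deq_prod_list: "deq us vs \<Longrightarrow> prod_list us = prod_list vs"
  by (induction rule: deq.induct) (auto simp: mult.assoc[symmetric])

lemma deq_nonzero: "deq us vs \<Longrightarrow> 0 \<notin> set us \<longleftrightarrow> 0 \<notin> set vs"
  by (induction rule: deq.induct) auto

lemma deq_stably_isom: "deq us vs \<Longrightarrow> 0 \<notin> set us \<Longrightarrow> stably_isom (diag us) (diag vs)"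
proof (induction rule: deq.induct)
  case (deq_refl us)
  then show ?case using stably_isom_refl diag_nondeg by blast
next
  case (deq_sym us vs)
  then show ?case using stably_isom_sym diag_nondeg deq_nonzero by blast
next
  case (deq_trans us vs ws)
  have "0 \<notin> set vs" "0 \<notin> set ws" "length us = length vs" "length us = length ws"
    using deq_trans.hyps deq_trans.prems deq_nonzero deq_length by metis+
  then show ?case
    using stably_isom_trans[OF deq_trans.IH(1)[OF deq_trans.prems] deq_trans.IH(2), of "length us"]
      diag_nondeg[of us] diag_nondeg[of vs] diag_nondeg[of ws] deq_trans.prems by simp
next
  case (deq_Cons us vs c)
  then show ?case
    using stably_isom_orth_sum_left[of "diag us" "diag vs" "diag [c]" 1 "length us"]
      diag_nondeg[of us] diag_nondeg[of vs] diag_nondeg[of "[c]"] deq_nonzero[of us vs] deq_length[of us vs]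
    by (simp add: diag_Cons[of c us] diag_Cons[of c vs])
next
  case (deq_pair u' u x v y v' us)
  have n: "diag [u, v] \<in> nondeg_sym 2" "diag [u', v'] \<in> nondeg_sym 2" "diag us \<in> nondeg_sym (length us)"
    using diag_nondeg[of "[u, v]"] diag_nondeg[of "[u', v']"] deq_pair by (auto simp: numeral_2_eq_2)
  show ?case unfolding diag_Cons2[of u v us] diag_Cons2[of u' v' us]
    by (rule stably_isom_orth_sum_right[OF isom_forms_stably_isom[OF isom_diag_pair n(1)] n(3,1,2)])
      (use deq_pair in auto)
next
  case (deq_hyp u v w u' v' us)
  have n: "diag [u, v] \<in> nondeg_sym 2" "diag [u', v'] \<in> nondeg_sym 2" "diag us \<in> nondeg_sym (length us)"
    using diag_nondeg[of "[u, v]"] diag_nondeg[of "[u', v']"] deq_hyp by (auto simp: numeral_2_eq_2)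
  show ?case unfolding diag_Cons2[of u v us] diag_Cons2[of u' v' us]
    by (rule stably_isom_orth_sum_right[OF stably_isom_diag_hyperbolic n(3,1,2)])
      (use deq_hyp in auto)
qed

lemma deq_swap: "u \<noteq> 0 \<Longrightarrow> v \<noteq> 0 \<Longrightarrow> deq (u # v # us) (v # u # us)"
  by (rule deq_pair[of _ _ 0 _ 1]) auto

text \<open>Vectors are functions on the naturals here, so that passing to the tail of the list is a
  shift of the argument.\<close>

primrec qf :: "'a::field list \<Rightarrow> (nat \<Rightarrow> 'a) \<Rightarrow> 'a" where
  "qf [] x = 0"
| "qf (u # us) x = u * (x 0)\<^sup>2 + qf us (\<lambda>i. x (Suc i))"

definition isotropic :: "'a::field list \<Rightarrow> bool" where
  "isotropic us \<longleftrightarrow> (\<exists>x. qf us x = 0 \<and> (\<exists>i<length us. x i \<noteq> 0))"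

text \<open>The value \<open>w\<close> is accumulated from the end of the list: a nonzero partial
  sum becomes an entry, and a binary move merges it with the entry before. If the tail contributes
  0, then \<open>w\<close> is \<open>u\<close> times a square and a binary move on the first two
  entries suffices.\<close>

lemma deq_represented:
  "qf (u # v # us) x = w \<Longrightarrow> w \<noteq> 0 \<Longrightarrow> 0 \<notin> set (u # v # us) \<Longrightarrow> \<exists>rs. deq (u # v # us) (w # rs)"
proof (induction us arbitrary: u v x w)
  case Nil
  then show ?case by (intro exI[of _ "[u * v / w]"] deq_pair[of _ _ "x 0" _ "x 1"]) auto
next
  case (Cons t us)
  define w' where "w' = qf (v # t # us) (\<lambda>i. x (Suc i))"
  have w: "w = u * (x 0)\<^sup>2 + w'" using Cons.prems(1) by (simp add: w'_def)
  show ?case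
  proof (cases "w' = 0")
    case True
    then have "deq (u # v # t # us) (w # (u * v / w) # t # us)"
      using Cons.prems w by (intro deq_pair[of _ _ "x 0" _ 0]) auto
    then show ?thesis by blast
  next
    case False
    from Cons.IH[OF w'_def[symmetric] False] Cons.prems(3) obtain rs where
      "deq (v # t # us) (w' # rs)" by auto
    then have "deq (u # v # t # us) (u # w' # rs)" by (rule deq_Cons)
    moreover have "deq (u # w' # rs) (w # (u * w' / w) # rs)"
      using Cons.prems w False by (intro deq_pair[of _ _ "x 0" _ 1]) auto
    ultimately show ?thesis by (blast intro: deq_trans)
  qed
qed

text \<open>If the first coordinate vanishes, the plane is found in the tail and moved to the front.
  Otherwise the tail represents \<open>- (u * (x 0)\<^sup>2)\<close>, which forms a hyperbolic pair
  with \<open>u\<close>. The pair is normalised to start with 1; the factor \<open>w\<^sup>2\<close>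
  has to stay because the product of the entries is preserved.\<close>

lemma deq_isotropic:
  "isotropic us \<Longrightarrow> 0 \<notin> set us \<Longrightarrow> \<exists>w rs. w \<noteq> 0 \<and> deq us (1 # (- w\<^sup>2) # rs)"
proof (induction us)
  case Nil
  then show ?case by (auto simp: isotropic_def)
next
  case (Cons u us)
  then obtain x i where x: "qf (u # us) x = 0" "i < length (u # us)" "x i \<noteq> 0"
    by (auto simp: isotropic_def)
  have u: "u \<noteq> 0" using Cons.prems by auto
  show ?case
  proof (cases "x 0 = 0")
    case True
    then have "i \<noteq> 0" using x(3) by (intro notI) simp
    then have "isotropic us" unfolding isotropic_def
      using x True by (intro exI[of _ "\<lambda>i. x (Suc i)"]) (auto intro!: exI[of _ "i - 1"])
    with Cons obtain w rs where w: "w \<noteq> 0" "deq us (1 # (- w\<^sup>2) # rs)" by auto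
    have "deq (u # us) (u # 1 # (- w\<^sup>2) # rs)" using w deq_Cons by blast
    moreover have "deq (u # 1 # (- w\<^sup>2) # rs) (1 # u # (- w\<^sup>2) # rs)"
      using u by (intro deq_swap) auto
    moreover have "deq (1 # u # (- w\<^sup>2) # rs) (1 # (- w\<^sup>2) # u # rs)"
      using u w by (intro deq_Cons deq_swap) auto
    ultimately show ?thesis using w by (blast intro: deq_trans)
  next
    case False
    define w where "w = u * x 0"
    have w: "w \<noteq> 0" using False u by (simp add: w_def)
    have q: "qf us (\<lambda>i. x (Suc i)) = - (u * (x 0)\<^sup>2)" using x(1) by (simp add: eq_neg_iff_add_eq_0 add.commute)
    then obtain v vs where us: "us = v # vs" using False u by (cases us) auto
    \<comment> \<open>\<open>deq_represented\<close> works with at least two entries, so a tail of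
      one entry is treated by hand.\<close>
    show ?thesis
    proof (cases vs)
      case Nil
      then have "v * (x 1)\<^sup>2 = - (u * (x 0)\<^sup>2)" using q us by simp
      moreover from this False u have x1: "x 1 \<noteq> 0" by auto
      ultimately have v: "v = - (u * (x 0)\<^sup>2) / (x 1)\<^sup>2" by (simp add: field_simps)
      have uv: "u * v = - (w / x 1)\<^sup>2" unfolding v w_def by (simp add: power2_eq_square)
      have "deq (u # v # []) (1 # (- (w / x 1)\<^sup>2) # [])"
        using uv w x1 Cons.prems us by (intro deq_hyp[of _ _ "w / x 1"]) auto
      then show ?thesis using w x1 us Nil by (intro exI[of _ "w / x 1"] exI[of _ "[]"]) auto
    next
      case (Cons t ts)
      have "\<exists>rs. deq us ((- (u * (x 0)\<^sup>2)) # rs)"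
        unfolding us Cons using deq_represented[OF q[unfolded us Cons]] Cons.prems u False us Cons by auto
      then obtain rs where "deq us ((- (u * (x 0)\<^sup>2)) # rs)" by auto
      then have "deq (u # us) (u # (- (u * (x 0)\<^sup>2)) # rs)" by (rule deq_Cons)
      moreover have "deq (u # (- (u * (x 0)\<^sup>2)) # rs) (1 # (- w\<^sup>2) # rs)"
        using u w False by (intro deq_hyp[of _ _ w]) (auto simp: w_def power2_eq_square)
      ultimately show ?thesis using w by (blast intro: deq_trans)
    qed
  qed
qed

section \<open>Solvability of linear systems by duality\<close>

text \<open>Induction on the number of columns. If \<open>r\<close> is not a combination of the
  earlier columns, some \<open>z\<close> annihilates them but not \<open>r\<close>. Either
  \<open>z\<close> annihilates the new column as well and is the obstruction, or a multiple of the
  new column is subtracted from \<open>r\<close>.\<close>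

lemma fredholm_alternative_fun:
  fixes c :: "nat \<Rightarrow> nat \<Rightarrow> 'a::field"
  shows "(\<exists>b. \<forall>i<m. r i = (\<Sum>j<k. b j * c j i)) \<or>
    (\<exists>z. (\<forall>j<k. (\<Sum>i<m. z i * c j i) = 0) \<and> (\<Sum>i<m. z i * r i) \<noteq> 0)"
proof (induction k arbitrary: r)
  case 0
  show ?case
  proof (cases "\<exists>i<m. r i \<noteq> 0")
    case True
    then obtain i where i: "i < m" "r i \<noteq> 0" by blast
    have "(\<Sum>l<m. (if l = i then 1 else 0) * r l) = (\<Sum>l<m. if l = i then r l else 0)"
      by (rule sum.cong) auto
    then have "(\<Sum>l<m. (if l = i then 1 else 0) * r l) \<noteq> 0" using i by simp
    then show ?thesis by auto
  qed auto
next
  case (Suc k)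
  show ?case
  proof (cases "\<exists>b. \<forall>i<m. r i = (\<Sum>j<k. b j * c j i)")
    case True
    then obtain b where "\<forall>i<m. r i = (\<Sum>j<k. b j * c j i)" by blast
    then have "\<forall>i<m. r i = (\<Sum>j<Suc k. (b(k := 0)) j * c j i)" by simp
    then show ?thesis by blast
  next
    case False
    with Suc[of r] obtain z where z: "\<forall>j<k. (\<Sum>i<m. z i * c j i) = 0" "(\<Sum>i<m. z i * r i) \<noteq> 0" by blast
    define zc where "zc = (\<Sum>i<m. z i * c k i)"
    show ?thesis
    proof (cases "zc = 0")
      case True
      then have "\<forall>j<Suc k. (\<Sum>i<m. z i * c j i) = 0" using z unfolding zc_def less_Suc_eq by auto
      then show ?thesis using z by blast
    next
      case nz: False
      \<comment> \<open>With this choice \<open>z\<close> annihilates \<open>r'\<close>. Hence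
        subtracting \<open>\<beta> * z\<close> from \<open>y\<close>, which makes it annihilate the
        new column, does not change its value on \<open>r'\<close>.\<close>
      define \<alpha> where "\<alpha> = (\<Sum>i<m. z i * r i) / zc"
      define r' where "r' i = r i - \<alpha> * c k i" for i
      from Suc[of r'] show ?thesis
      proof
        assume "\<exists>b. \<forall>i<m. r' i = (\<Sum>j<k. b j * c j i)"
        then obtain b where b: "\<forall>i<m. r' i = (\<Sum>j<k. b j * c j i)" by blast
        have "\<forall>i<m. r i = (\<Sum>j<Suc k. (b(k := \<alpha>)) j * c j i)"
          using b by (simp add: r'_def algebra_simps)
        then show ?thesis by blast
      next
        assume "\<exists>z. (\<forall>j<k. (\<Sum>i<m. z i * c j i) = 0) \<and> (\<Sum>i<m. z i * r' i) \<noteq> 0"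
        then obtain y where y: "\<forall>j<k. (\<Sum>i<m. y i * c j i) = 0" "(\<Sum>i<m. y i * r' i) \<noteq> 0" by blast
        define \<beta> where "\<beta> = (\<Sum>i<m. y i * c k i) / zc"
        have lin: "(\<Sum>i<m. (y i - \<beta> * z i) * f i) = (\<Sum>i<m. y i * f i) - \<beta> * (\<Sum>i<m. z i * f i)" for f
          by (simp add: algebra_simps sum_subtractf sum_distrib_left)
        have "(\<Sum>i<m. y i * r' i) = (\<Sum>i<m. y i * r i) - \<alpha> * (\<Sum>i<m. y i * c k i)"
          by (simp add: r'_def algebra_simps sum_subtractf sum_distrib_left)
        also have "\<dots> = (\<Sum>i<m. (y i - \<beta> * z i) * r i)"
          unfolding lin by (simp add: \<alpha>_def \<beta>_def)
        finally have "(\<Sum>i<m. (y i - \<beta> * z i) * r i) \<noteq> 0" using y by simp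
        moreover have "(\<Sum>i<m. (y i - \<beta> * z i) * c j i) = 0" if "j < Suc k" for j
          unfolding lin using that y z nz by (cases "j = k") (auto simp: \<beta>_def zc_def)
        ultimately show ?thesis by (intro disjI2 exI[of _ "\<lambda>i. y i - \<beta> * z i"]) auto
      qed
    qed
  qed
qed

lemma fredholm_alternative:
  fixes M :: "'a::field mat"
  assumes "M \<in> carrier_mat m k" "r \<in> carrier_vec m"
  shows "(\<exists>b\<in>carrier_vec k. M *\<^sub>v b = r) \<or> (\<exists>z\<in>carrier_vec m. M\<^sup>T *\<^sub>v z = 0\<^sub>v k \<and> z \<bullet> r \<noteq> 0)"
  using fredholm_alternative_fun[where m = m and k = k and r = "\<lambda>i. r $ i" and c = "\<lambda>j i. M $$ (i, j)"]
proof
  assume "\<exists>b. \<forall>i<m. r $ i = (\<Sum>j<k. b j * M $$ (i, j))"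
  then obtain b where "\<forall>i<m. r $ i = (\<Sum>j<k. b j * M $$ (i, j))" by blast
  then have "M *\<^sub>v vec k b = r" using assms
    by (intro eq_vecI) (auto simp: scalar_prod_def mult.commute atLeast0LessThan)
  then show ?thesis by (intro disjI1 bexI[of _ "vec k b"]) auto
next
  assume "\<exists>z. (\<forall>j<k. (\<Sum>i<m. z i * M $$ (i, j)) = 0) \<and> (\<Sum>i<m. z i * r $ i) \<noteq> 0"
  then obtain z where z: "\<forall>j<k. (\<Sum>i<m. z i * M $$ (i, j)) = 0" "(\<Sum>i<m. z i * r $ i) \<noteq> 0" by blast
  have "M\<^sup>T *\<^sub>v vec m z = 0\<^sub>v k" using assms z(1)
    by (intro eq_vecI) (auto simp: scalar_prod_def mult.commute atLeast0LessThan)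
  moreover have "vec m z \<bullet> r \<noteq> 0" using assms z(2) by (simp add: scalar_prod_def atLeast0LessThan)
  ultimately show ?thesis by (intro disjI2 bexI[of _ "vec m z"]) auto
qed

section \<open>Comparing two stably isometric diagonal forms\<close>

definition bl :: "'a::comm_ring_1 mat \<Rightarrow> 'a vec \<Rightarrow> 'a vec \<Rightarrow> 'a" where
  "bl S x y = x \<bullet> (S *\<^sub>v y)"

lemma mult_mat_zero_vec [simp]: "A \<in> carrier_mat n m \<Longrightarrow> A *\<^sub>v 0\<^sub>v m = 0\<^sub>v n"
  by (intro eq_vecI) auto

lemma zero_mat_mult_vec [simp]: "v \<in> carrier_vec m \<Longrightarrow> 0\<^sub>m n m *\<^sub>v v = 0\<^sub>v n"
  by (intro eq_vecI) auto

lemma bl_orth_sum: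
  assumes "A \<in> carrier_mat n n" "N \<in> carrier_mat m m"
    "x1 \<in> carrier_vec n" "y1 \<in> carrier_vec n" "x2 \<in> carrier_vec m" "y2 \<in> carrier_vec m"
  shows "bl (orth_sum A N) (x1 @\<^sub>v x2) (y1 @\<^sub>v y2) = bl A x1 y1 + bl N x2 y2"
  using assms unfolding bl_def orth_sum_eq[OF assms(1,2)]
  by (subst four_block_mat_mult_vec[of _ n n _ m _ m])
    (auto simp: scalar_prod_append[of _ n _ m])

lemma bl_congruence:
  assumes "S \<in> carrier_mat n n" "P \<in> carrier_mat n n" "x \<in> carrier_vec n" "y \<in> carrier_vec n"
  shows "bl (P\<^sup>T * S * P) x y = bl S (P *\<^sub>v x) (P *\<^sub>v y)"
proof -
  have "(P\<^sup>T * S * P) *\<^sub>v y = P\<^sup>T *\<^sub>v (S *\<^sub>v (P *\<^sub>v y))"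
    using assms by (simp add: assoc_mult_mat_vec[of _ n n _ n])
  then have "bl (P\<^sup>T * S * P) x y = (P\<^sup>T *\<^sub>v (S *\<^sub>v (P *\<^sub>v y))) \<bullet> x"
    unfolding bl_def using assms by (simp add: comm_scalar_prod[of _ n])
  also have "\<dots> = (S *\<^sub>v (P *\<^sub>v y)) \<bullet> (P *\<^sub>v x)"
    using assms by (intro transpose_vec_mult_scalar[of _ n n]) auto
  finally show ?thesis unfolding bl_def using assms by (simp add: comm_scalar_prod[of _ n])
qed

lemma bl_move:
  assumes "S \<in> carrier_mat n n" "S\<^sup>T = S" "x \<in> carrier_vec n" "y \<in> carrier_vec n"
  shows "bl S x y = (S *\<^sub>v x) \<bullet> y"
  using transpose_vec_mult_scalar[OF assms(1,4,3)] assms by (simp add: bl_def)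

lemma bl_diag:
  assumes "x \<in> carrier_vec (length us)" "y \<in> carrier_vec (length us)"
  shows "bl (diag us) x y = (\<Sum>i<length us. us ! i * x $ i * y $ i)"
proof -
  have "(diag us *\<^sub>v y) $ i = us ! i * y $ i" if "i < length us" for i
  proof -
    have "(diag us *\<^sub>v y) $ i = (\<Sum>j<length us. (if i = j then us ! i else 0) * y $ j)"
      using assms that by (auto simp: diag_def scalar_prod_def atLeast0LessThan)
    also have "\<dots> = (\<Sum>j<length us. if i = j then us ! i * y $ j else 0)"
      by (rule sum.cong) auto
    finally show ?thesis using that by simp
  qed
  then show ?thesis using assms unfolding bl_def scalar_prod_def
    by (auto simp: atLeast0LessThan mult_ac diag_def intro!: sum.cong)
qed

lemma qf_sum: "qf us x = (\<Sum>i<length us. us ! i * (x i)\<^sup>2)"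
proof (induction us arbitrary: x)
  case (Cons u us)
  then show ?case by (simp add: sum.lessThan_Suc_shift del: sum.lessThan_Suc)
qed simp

lemma bl_diag_qf: "x \<in> carrier_vec (length us) \<Longrightarrow> bl (diag us) x x = qf us (\<lambda>i. x $ i)"
  by (auto simp: bl_diag qf_sum power2_eq_square mult.assoc)

text \<open>Let \<open>P\<close> be an isometry between the forms with a common summand \<open>N\<close> added. If some vector \<open>(e, b)\<close>,
  with \<open>e\<close> the first basis vector, has an image with the same \<open>N\<close>-component \<open>b\<close>, the other component
  of the image has norm \<open>u\<close>. Otherwise the linear form that obstructs solving for \<open>b\<close> yields an isotropic vector.\<close>

lemma isotropic_or_represented:
  assumes st: "stably_isom (diag (u # us)) (diag vs)" and len: "length vs = Suc (length us)"
    and us: "0 \<notin> set (u # us)" and vs: "0 \<notin> set vs"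
  shows "isotropic (u # us) \<or> (\<exists>x. qf vs x = u)"
proof -
  define n where "n = Suc (length us)"
  define A where "A = diag (u # us)"
  define B where "B = diag vs"
  have A: "A \<in> nondeg_sym n" and B: "B \<in> nondeg_sym n"
    using diag_nondeg[OF us] diag_nondeg[OF vs] len by (auto simp: n_def A_def B_def)
  from st obtain m N where N: "N \<in> nondeg_sym m"
    and i: "isom_forms (orth_sum A N) (orth_sum B N)" unfolding stably_isom_def A_def B_def by blast
  note Ac = nondeg_symD[OF A] and Bc = nondeg_symD[OF B] and Nc = nondeg_symD[OF N]
  define S where "S = orth_sum A N"
  define S' where "S' = orth_sum B N"
  have Sc: "S \<in> carrier_mat (n + m) (n + m)" and S'c: "S' \<in> carrier_mat (n + m) (n + m)"
    unfolding S_def S'_def using Ac Bc Nc by auto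
  obtain P where P: "P \<in> carrier_mat (n + m) (n + m)" "det P \<noteq> 0" "P\<^sup>T * S' * P = S"
    using isom_formsE[OF isom_forms_sym[OF i] orth_sum_carrier[OF Bc(1) Nc(1)]]
      orth_sum_carrier[OF Ac(1) Nc(1)] unfolding S_def S'_def by blast
  obtain Q where Q: "Q \<in> carrier_mat (n + m) (n + m)" "P * Q = 1\<^sub>m (n + m)"
    using invertible_mat_ex[OF P(1,2)] by blast
  obtain P11 P12 P21 P22 where "split_block P n n = (P11, P12, P21, P22)"
    by (cases "split_block P n n") auto
  note sb = split_block[OF this, of m m]
  have Pc: "P11 \<in> carrier_mat n n" "P12 \<in> carrier_mat n m" "P21 \<in> carrier_mat m n" "P22 \<in> carrier_mat m m"
    and Pb: "P = four_block_mat P11 P12 P21 P22" using sb P(1) by auto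
  have Pv: "P *\<^sub>v (a @\<^sub>v b) = (P11 *\<^sub>v a + P12 *\<^sub>v b) @\<^sub>v (P21 *\<^sub>v a + P22 *\<^sub>v b)"
    if "a \<in> carrier_vec n" "b \<in> carrier_vec m" for a b
    unfolding Pb using that Pc by (intro four_block_mat_mult_vec[of _ n n _ m _ m]) auto
  define e :: "'a vec" where "e = unit_vec n 0"
  have e: "e \<in> carrier_vec n" by (simp add: e_def)
  have bA: "bl A x y = (\<Sum>i<n. (u # us) ! i * x $ i * y $ i)"
    if "x \<in> carrier_vec n" "y \<in> carrier_vec n" for x y
    using bl_diag[of x "u # us" y] that unfolding A_def n_def by simp
  have qA: "bl A x x = qf (u # us) (\<lambda>i. x $ i)" if "x \<in> carrier_vec n" for x
    using bl_diag_qf[of x "u # us"] that unfolding A_def n_def by simp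
  have qB: "bl B x x = qf vs (\<lambda>i. x $ i)" if "x \<in> carrier_vec n" for x
    using bl_diag_qf[of x vs] that len unfolding B_def n_def by simp
  \<comment> \<open>\<open>M *\<^sub>v b = P21 *\<^sub>v e\<close> says exactly that (e, b) and its
    image under \<open>P\<close> have the same \<open>N\<close>-component.\<close>
  define M where "M = 1\<^sub>m m - P22"
  have M: "M \<in> carrier_mat m m" using Pc unfolding M_def by (intro minus_carrier_mat) auto
  have r: "P21 *\<^sub>v e \<in> carrier_vec m" using Pc e by simp
  from fredholm_alternative[OF M r] show ?thesis
  proof
    assume "\<exists>b\<in>carrier_vec m. M *\<^sub>v b = P21 *\<^sub>v e"
    then obtain b where b: "b \<in> carrier_vec m" "M *\<^sub>v b = P21 *\<^sub>v e" by blast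
    have "b - P22 *\<^sub>v b = P21 *\<^sub>v e"
      using b Pc unfolding M_def by (simp add: minus_mult_distrib_mat_vec[of _ m m])
    then have "P21 *\<^sub>v e + P22 *\<^sub>v b = (b - P22 *\<^sub>v b) + P22 *\<^sub>v b" by simp
    also have "\<dots> = b" using b Pc by (intro eq_vecI) auto
    finally have fix_b: "P21 *\<^sub>v e + P22 *\<^sub>v b = b" .
    define a where "a = P11 *\<^sub>v e + P12 *\<^sub>v b"
    have a: "a \<in> carrier_vec n" using Pc e b by (simp add: a_def)
    have V: "e @\<^sub>v b \<in> carrier_vec (n + m)" using e b by simp
    have "bl S (e @\<^sub>v b) (e @\<^sub>v b) = bl S' (a @\<^sub>v b) (a @\<^sub>v b)"
      unfolding P(3)[symmetric] bl_congruence[OF S'c P(1) V V] Pv[OF e b(1)] a_def fix_b ..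
    then have "bl A e e = bl B a a"
      unfolding S_def S'_def using bl_orth_sum[OF Ac(1) Nc(1) e e b(1) b(1)]
        bl_orth_sum[OF Bc(1) Nc(1) a a b(1) b(1)] by simp
    moreover have "bl A e e = u" unfolding qA[OF e]
        by (simp add: e_def n_def qf_sum sum.lessThan_Suc_shift del: sum.lessThan_Suc)
    ultimately show ?thesis using qB[OF a] by auto
  next
    assume "\<exists>z\<in>carrier_vec m. M\<^sup>T *\<^sub>v z = 0\<^sub>v m \<and> z \<bullet> (P21 *\<^sub>v e) \<noteq> 0"
    then obtain z where z: "z \<in> carrier_vec m" "M\<^sup>T *\<^sub>v z = 0\<^sub>v m" "z \<bullet> (P21 *\<^sub>v e) \<noteq> 0" by blast
    have zP: "z \<bullet> (P22 *\<^sub>v b) = z \<bullet> b" if b: "b \<in> carrier_vec m" for b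
    proof -
      have "0 = z \<bullet> (M *\<^sub>v b)" using transpose_vec_mult_scalar[OF M b z(1)] z(2) b by simp
      also have "\<dots> = z \<bullet> b - z \<bullet> (P22 *\<^sub>v b)"
        using b z Pc unfolding M_def
        by (simp add: minus_mult_distrib_mat_vec[of _ m m] scalar_prod_minus_distrib[of _ m])
      finally show ?thesis by simp
    qed
    obtain N' where N': "N' \<in> carrier_mat m m" "N * N' = 1\<^sub>m m" "N' * N = 1\<^sub>m m"
      using invertible_mat_ex[OF Nc(1,3)] by blast
    \<comment> \<open>\<open>y\<close> represents the functional \<open>z\<close> with respect to
      \<open>N\<close>. The preimage (s, t) of (0, y) under the isometry represents the transported
      functional, and \<open>s\<close> will be the isotropic vector.\<close>
    define y where "y = N' *\<^sub>v z"
    have y: "y \<in> carrier_vec m" "N *\<^sub>v y = z"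
      unfolding y_def using N' z Nc assoc_mult_mat_vec[OF Nc(1) N'(1) z(1)] by auto
    define Z where "Z = 0\<^sub>v n @\<^sub>v y"
    define Y where "Y = Q *\<^sub>v Z"
    have Z: "Z \<in> carrier_vec (n + m)" unfolding Z_def using y by simp
    have Y: "Y \<in> carrier_vec (n + m)" unfolding Y_def using Q Z by simp
    have PY: "P *\<^sub>v Y = Z" unfolding Y_def using assoc_mult_mat_vec[OF P(1) Q(1) Z] Q(2) Z by simp
    obtain s t where st: "s \<in> carrier_vec n" "t \<in> carrier_vec m" "Y = s @\<^sub>v t"
      using Y vec_first_last_append[OF Y] by (metis vec_first_carrier vec_last_carrier)
    have eq: "bl S' Z (P *\<^sub>v V) = bl S Y V" if V: "V \<in> carrier_vec (n + m)" for V
      unfolding P(3)[symmetric] bl_congruence[OF S'c P(1) Y V] PY ..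
    have key: "z \<bullet> (P21 *\<^sub>v a + P22 *\<^sub>v b) = bl A s a + (N *\<^sub>v t) \<bullet> b"
      if a: "a \<in> carrier_vec n" and b: "b \<in> carrier_vec m" for a b
    proof -
      have "bl S' Z (P *\<^sub>v (a @\<^sub>v b)) = bl B (0\<^sub>v n) (P11 *\<^sub>v a + P12 *\<^sub>v b) + bl N y (P21 *\<^sub>v a + P22 *\<^sub>v b)"
        unfolding Pv[OF a b] Z_def S'_def using Bc Nc Pc a b y by (intro bl_orth_sum) auto
      also have "bl B (0\<^sub>v n) (P11 *\<^sub>v a + P12 *\<^sub>v b) = 0"
        unfolding bl_def using Bc Pc a b by simp
      also have "bl N y (P21 *\<^sub>v a + P22 *\<^sub>v b) = z \<bullet> (P21 *\<^sub>v a + P22 *\<^sub>v b)"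
        using bl_move[OF Nc(1,2) y(1)] y(2) Pc a b by simp
      also have "bl S' Z (P *\<^sub>v (a @\<^sub>v b)) = bl S Y (a @\<^sub>v b)" using eq a b by simp
      also have "\<dots> = bl A s a + bl N t b"
        unfolding S_def st(3) using bl_orth_sum[OF Ac(1) Nc(1) st(1) a st(2) b] .
      also have "bl N t b = (N *\<^sub>v t) \<bullet> b" using bl_move[OF Nc(1,2) st(2) b] .
      finally show ?thesis by simp
    qed
    have As0: "bl A s (0\<^sub>v n) = 0" unfolding bl_def using Ac st by simp
    \<comment> \<open>\<open>z\<close> is invariant under \<open>P22\<close>, so comparing the terms
      in \<open>b\<close> of \<open>key\<close> gives \<open>t = y\<close>. The norms of (s, y) and
      (0, y) agree, so \<open>s\<close> has norm 0; it is nonzero because \<open>key\<close> at (e,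
      0) evaluates to the nonzero obstruction.\<close>
    have "N *\<^sub>v t = z"
    proof (rule eq_vecI)
      fix j assume "j < dim_vec z"
      then have j: "j < m" using z by simp
      have "z \<bullet> (P21 *\<^sub>v 0\<^sub>v n + P22 *\<^sub>v unit_vec m j) = z $ j"
        using zP[of "unit_vec m j"] Pc z j by simp
      then show "(N *\<^sub>v t) $ j = z $ j"
        using key[of "0\<^sub>v n" "unit_vec m j"] As0 j Nc st by simp
    qed (use Nc z in auto)
    then have t: "t = y" unfolding y_def using assoc_mult_mat_vec[OF N'(1) Nc(1) st(2)] N'(3) st(2) by simp
    have "bl S' Z Z = bl S Y Y" using eq[OF Y] PY by simp
    then have "bl N y y = bl A s s + bl N y y"
      unfolding S'_def S_def Z_def st(3) t
      using bl_orth_sum[OF Ac(1) Nc(1) st(1) st(1) y(1) y(1)]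
        bl_orth_sum[OF Bc(1) Nc(1) zero_carrier_vec zero_carrier_vec y(1) y(1)] Bc
      by (simp add: bl_def)
    then have q0: "qf (u # us) (\<lambda>i. s $ i) = 0" using qA[OF st(1)] by simp
    have "s \<noteq> 0\<^sub>v n"
    proof
      assume "s = 0\<^sub>v n"
      then have "z \<bullet> (P21 *\<^sub>v e) = 0"
        using key[OF e zero_carrier_vec] Pc e Nc st Ac by (simp add: bl_def)
      then show False using z(3) by simp
    qed
    then have "\<exists>i<n. s $ i \<noteq> 0" using st(1) by (metis eq_vecI carrier_vecD index_zero_vec)
    then show ?thesis using q0 unfolding isotropic_def n_def by auto
  qed
qed

lemma stably_isom_cancel_left:
  assumes "stably_isom (orth_sum L M) (orth_sum L M')"
    "L \<in> nondeg_sym l" "M \<in> nondeg_sym n" "M' \<in> nondeg_sym n"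
  shows "stably_isom M M'"
proof -
  have n: "orth_sum M L \<in> nondeg_sym (n + l)" "orth_sum M' L \<in> nondeg_sym (n + l)"
    "orth_sum L M \<in> nondeg_sym (n + l)" "orth_sum L M' \<in> nondeg_sym (n + l)"
    using assms(2-4) orth_sum_nondeg[of L l _ n] by (auto simp: add.commute[of l n])
  show ?thesis
    by (rule stably_isom_cancel[OF stably_isom_trans[OF stably_isom_orth_sum_commute[OF assms(3,2)]
       stably_isom_trans[OF assms(1) stably_isom_orth_sum_commute[OF assms(2,4)] n(3,4,2)] n(1,3,2)] assms(2-4)])
qed

section \<open>Stable isometry with equal products implies equivalence under the moves\<close>

lemma stably_isom_diag_trans:
  assumes "stably_isom (diag us) (diag vs)" "deq us us'" "deq vs vs'" "0 \<notin> set us" "0 \<notin> set vs"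
    "length us = length vs"
  shows "stably_isom (diag us') (diag vs')"
proof -
  have n: "diag us \<in> nondeg_sym (length us)" "diag vs \<in> nondeg_sym (length us)"
    "diag us' \<in> nondeg_sym (length us)" "diag vs' \<in> nondeg_sym (length us)"
    using assms deq_nonzero[OF assms(2)] deq_nonzero[OF assms(3)] diag_nondeg[of us'] diag_nondeg[of vs']
      diag_nondeg[of us] diag_nondeg[of vs] deq_length[OF assms(2)] deq_length[OF assms(3)] by auto
  note a = stably_isom_sym[OF deq_stably_isom[OF assms(2,4)] n(1)]
  note b = deq_stably_isom[OF assms(3,5)]
  show ?thesis
    by (rule stably_isom_trans[OF a stably_isom_trans[OF assms(1) b n(1,2,4)] n(3,1,4)])
qed

lemma stably_isom_diag_append_cancel:
  assumes "stably_isom (diag (ws @ us)) (diag (ws @ vs))" "0 \<notin> set (ws @ us)" "0 \<notin> set (ws @ vs)"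
    "length us = length vs"
  shows "stably_isom (diag us) (diag vs)"
  using stably_isom_cancel_left[of "diag ws" "diag us" "diag vs" "length ws" "length us"] assms
    diag_nondeg[of us] diag_nondeg[of vs] diag_nondeg[of ws] by (simp add: diag_append)

theorem deq_if_stably_isom:
  fixes us vs :: "'a::field list"
  assumes "stably_isom (diag us) (diag vs)" "length us = length vs" "prod_list us = prod_list vs"
    "0 \<notin> set us" "0 \<notin> set vs"
  shows "deq us vs"
  using assms
proof (induction "length us" arbitrary: us vs rule: less_induct)
  case less
  \<comment> \<open>Stated for arbitrary lists because the two forms exchange roles below: it is
    enough that one of them represents the first entry of the other.\<close>
  have represented: "deq us vs"
    if st: "stably_isom (diag (u # us')) (diag vs)" and us: "us = u # us'" and lenv: "length vs = length us"
      and l2: "length us \<ge> 2" and pr: "prod_list us = prod_list vs" and nz: "0 \<notin> set us" "0 \<notin> set vs"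
      and x: "qf vs x = u" and IH: "\<And>xs ys :: 'a list. length xs < length us \<Longrightarrow> stably_isom (diag xs) (diag ys) \<Longrightarrow>
        length xs = length ys \<Longrightarrow> prod_list xs = prod_list ys \<Longrightarrow> 0 \<notin> set xs \<Longrightarrow> 0 \<notin> set ys \<Longrightarrow>
        deq xs ys"
    for u and us' us vs :: "'a list" and x :: "nat \<Rightarrow> 'a"
  proof -
    obtain a b cs where vs: "vs = a # b # cs"
      using l2 lenv by (metis One_nat_def Suc_1 Suc_le_length_iff)
    have u: "u \<noteq> 0" using us nz by auto
    obtain rs where rs: "deq vs (u # rs)" using deq_represented[of a b cs x u] x u nz vs by auto
    have r: "length rs = length us'" "0 \<notin> set rs" "prod_list rs = prod_list us'"
      using deq_length[OF rs] deq_nonzero[OF rs] deq_prod_list[OF rs] nz u pr us lenv by auto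
    have "stably_isom (diag (u # us')) (diag (u # rs))"
      using stably_isom_diag_trans[OF st deq_refl rs] nz lenv us by simp
    then have "stably_isom (diag us') (diag rs)"
      using stably_isom_diag_append_cancel[of "[u]" us' rs] r nz us by auto
    then have "deq us' rs" by (rule IH[rotated]) (use r us nz in simp_all)
    then have "deq us (u # rs)" unfolding us by (rule deq_Cons)
    then show ?thesis using rs deq_sym deq_trans by blast
  qed
  note IH = less.hyps
  have n: "diag us \<in> nondeg_sym (length us)" "diag vs \<in> nondeg_sym (length us)" using less.prems
    diag_nondeg[of us] diag_nondeg[of vs] by auto
  show ?case
  proof (cases "length us \<ge> 2")
    case False
    then consider "us = []" "vs = []" | u v where "us = [u]" "vs = [v]"
      using less.prems(2) by (cases us; cases vs; cases "tl us"; cases "tl vs") auto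
    then show ?thesis using less.prems(3) by cases (auto intro: deq_refl)
  next
    case l2: True
    then obtain u us' v vs' where us: "us = u # us'" and vs: "vs = v # vs'"
      using less.prems(2) by (cases us; cases vs) auto
    have "isotropic us \<or> (\<exists>x. qf vs x = u)"
      using isotropic_or_represented[of u us' vs] less.prems us by auto
    moreover have "isotropic vs \<or> (\<exists>x. qf us x = v)"
      using isotropic_or_represented[of v vs' us] less.prems vs stably_isom_sym[OF less.prems(1) n(1)] by auto
    moreover have ?thesis if "qf vs x = u" for x
    proof (rule represented[of u us' vs us x])
      show "deq xs ys" if "length xs < length us" "stably_isom (diag xs) (diag ys)"
        "length xs = length ys" "prod_list xs = prod_list ys" "0 \<notin> set xs" "0 \<notin> set ys" for xs ys :: "'a list"
        using that by (rule IH)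
    qed (use us l2 less.prems(1)[unfolded us] less.prems(2-5) that in \<open>assumption | simp\<close>)+
    moreover have ?thesis if "qf us x = v" for x
    proof (rule deq_sym, rule represented[of v vs' us vs x])
      show "deq xs ys" if "length xs < length vs" "stably_isom (diag xs) (diag ys)"
        "length xs = length ys" "prod_list xs = prod_list ys" "0 \<notin> set xs" "0 \<notin> set ys" for xs ys :: "'a list"
        using that(1)[folded less.prems(2)] that(2-) by (rule IH)
    qed (use vs l2 stably_isom_sym[OF less.prems(1) n(1), unfolded vs] less.prems(2-5) that in \<open>assumption | simp\<close>)+
    moreover have ?thesis if iu: "isotropic us" and iv: "isotropic vs"
    proof -
      obtain w rs where w: "w \<noteq> 0" and dw: "deq us (1 # (- w\<^sup>2) # rs)"
        using deq_isotropic[OF iu] less.prems by auto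
      obtain w' ss where w': "w' \<noteq> 0" and dw': "deq vs (1 # (- w'\<^sup>2) # ss)"
        using deq_isotropic[OF iv] less.prems by auto
      have r: "0 \<notin> set rs" "0 \<notin> set ss" "length rs = length ss" "length rs < length us"
        "w\<^sup>2 * prod_list rs = w'\<^sup>2 * prod_list ss"
        using deq_nonzero[OF dw] deq_nonzero[OF dw'] deq_length[OF dw] deq_length[OF dw']
          deq_prod_list[OF dw] deq_prod_list[OF dw'] less.prems by auto
      \<comment> \<open>The two planes must be literally equal before they are cancelled. The square
        factor by which they differ is moved into the next entry; if there is none, the equal
        products already give \<open>w\<^sup>2 = w'\<^sup>2\<close>.\<close>
      have "\<exists>ss'. deq vs (1 # (- w\<^sup>2) # ss')"
      proof (cases ss)
        case Nil
        then have "rs = []" using r by simp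
        then have "w\<^sup>2 = w'\<^sup>2" using r(5) Nil by simp
        then show ?thesis using dw' by auto
      next
        case (Cons b bs)
        have "deq ((- w'\<^sup>2) # b # bs) ((- w\<^sup>2) # (b * w'\<^sup>2 / w\<^sup>2) # bs)"
          using w w' r(2) Cons by (intro deq_pair[of _ _ "w / w'" _ 0]) (auto simp: power_divide)
        then show ?thesis using dw' unfolding Cons by (blast intro: deq_trans deq_Cons)
      qed
      then obtain ts where ts: "deq vs (1 # (- w\<^sup>2) # ts)" by blast
      have t: "0 \<notin> set ts" "length rs = length ts" "prod_list rs = prod_list ts"
        using deq_nonzero[OF dw] deq_nonzero[OF ts] deq_length[OF dw] deq_length[OF ts]
          deq_prod_list[OF dw] deq_prod_list[OF ts] less.prems w by auto
      have "stably_isom (diag (1 # (- w\<^sup>2) # rs)) (diag (1 # (- w\<^sup>2) # ts))"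
        using stably_isom_diag_trans[OF less.prems(1) dw ts] less.prems by simp
      then have "stably_isom (diag rs) (diag ts)"
        using stably_isom_diag_append_cancel[of "[1, - w\<^sup>2]" rs ts] r t w by auto
      then have "deq rs ts" using IH[of rs ts] r t by simp
      then have "deq us (1 # (- w\<^sup>2) # ts)" using dw by (blast intro: deq_trans deq_Cons)
      then show ?thesis using ts deq_sym deq_trans by blast
    qed
    ultimately show ?thesis by blast
  qed
qed

section \<open>Homotopy invariance of the stable class\<close>

abbreviation ev_mat :: "'a::comm_ring_1 \<Rightarrow> 'a poly mat \<Rightarrow> 'a mat" where
  "ev_mat t \<equiv> map_mat (\<lambda>p. poly p t)"

interpretation const_hom: comm_ring_hom "\<lambda>c::'a::comm_ring_1. [:c:]"
  by unfold_locales auto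

lemmas ev_mat_mult = semiring_hom.mat_hom_mult[OF poly_hom.semiring_hom_axioms]

lemma det_ev_mat [simp]: "det (ev_mat t M) = poly (det M) t"
  by (rule comm_ring_hom.hom_det[OF poly_hom.comm_ring_hom_axioms])

lemma poly_dvd_1_nonzero: "p dvd 1 \<Longrightarrow> poly p (t::'a::field) \<noteq> 0"
  by (metis dvd_0_left_iff one_neq_zero poly_1 poly_hom.hom_dvd)

lemma det_ev_mat_nonzero: "det M dvd 1 \<Longrightarrow> det (ev_mat (t::'a::field) M) \<noteq> 0"
  using poly_dvd_1_nonzero by (simp only: det_ev_mat not_False_eq_True)

lemma ev_mat_nondeg:
  fixes t :: "'a::field"
  assumes "M \<in> carrier_mat n n" "M\<^sup>T = M" "det M dvd 1"
  shows "ev_mat t M \<in> nondeg_sym n"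
proof (rule nondeg_symI)
  have "(ev_mat t M)\<^sup>T = ev_mat t M\<^sup>T" by (rule eq_matI) auto
  then show "(ev_mat t M)\<^sup>T = ev_mat t M" using assms by simp
qed (use assms det_ev_mat_nonzero in auto)

lemma isom_forms_ev_mat:
  fixes t :: "'a::field"
  assumes "M \<in> carrier_mat n n" "P \<in> carrier_mat n n" "P\<^sup>T * M * P = M'" "det M' dvd 1"
  shows "isom_forms (ev_mat t M) (ev_mat t M')"
proof (rule isom_formsI[of _ n "ev_mat t P"])
  have "(ev_mat t P)\<^sup>T = ev_mat t P\<^sup>T" by (rule eq_matI) auto
  then show "(ev_mat t P)\<^sup>T * ev_mat t M * ev_mat t P = ev_mat t M'"
    using assms(1,2) unfolding assms(3)[symmetric]
    by (simp add: ev_mat_mult[of "P\<^sup>T" n n "M * P" n] ev_mat_mult[of M n n P n])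
qed (use assms det_ev_mat_nonzero in auto)

lemma det_congruence_dvd_1:
  assumes "M \<in> carrier_mat n n" "P \<in> carrier_mat n n" "det P dvd 1" "det M dvd (1 :: 'a::comm_ring_1)"
  shows "det (P\<^sup>T * M * P) dvd 1"
  unfolding det_congruence[OF assms(1,2)] power2_eq_square using assms(3,4)
  by (metis mult.right_neutral mult_dvd_mono)

section \<open>Splitting off a metabolic plane over k[T]\<close>

lemma nonzero_vec_ex: "v \<in> carrier_vec n \<Longrightarrow> v \<noteq> 0\<^sub>v n \<Longrightarrow> \<exists>i<n. v $ i \<noteq> 0"
  by (metis eq_vecI carrier_vecD index_zero_vec)

text \<open>Replacing column \<open>i\<close> of the identity by \<open>x\<close> gives determinant
  \<open>x $ i\<close> by Cramer's rule, and a swap brings this column to position \<open>l\<close>.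
  The last property keeps rows of the identity where \<open>x\<close> vanishes; it lets a later base
  change fix a vector chosen earlier.\<close>

lemma ex_mat_first_col:
  fixes x :: "'a::field vec"
  assumes x: "x \<in> carrier_vec n" "i < n" "x $ i \<noteq> 0" "l < n"
  obtains P where "P \<in> carrier_mat n n" "det P \<noteq> 0" "P *\<^sub>v unit_vec n l = x"
    "\<And>j k. k < n \<Longrightarrow> j < n \<Longrightarrow> j \<noteq> l \<Longrightarrow> j \<noteq> i \<Longrightarrow> x $ j = 0 \<Longrightarrow> P $$ (j, k) = (if j = k then 1 else 0)"
proof -
  define R where "R = replace_col (1\<^sub>m n) x i"
  define P where "P = (if i = l then R else swapcols l i R)"
  have R: "R \<in> carrier_mat n n" by (simp add: R_def replace_col_def)
  have "det R = x $ i" using cramer_lemma_mat[OF one_carrier_mat x(1,2)] x(1) by (simp add: R_def)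
  then have "det P \<noteq> 0" using x det_swapcols[OF x(4,2) _ R] by (auto simp: P_def)
  moreover have P: "P \<in> carrier_mat n n" using R by (simp add: P_def)
  moreover have "P $$ (k, l) = x $ k" if "k < n" for k
    using that x by (auto simp: P_def R_def replace_col_def)
  then have "P *\<^sub>v unit_vec n l = x" using P x by (intro eq_vecI) auto
  moreover have "P $$ (j, k) = (if j = k then 1 else 0)"
    if "k < n" "j < n" "j \<noteq> l" "j \<noteq> i" "x $ j = 0" for j k
    using that x by (auto simp: P_def R_def replace_col_def)
  ultimately show thesis using that by blast
qed

text \<open>A basis in which \<open>x\<close> is the first vector and the functional
  \<open>y\<close> is the second coordinate; this is possible because \<open>y\<close> vanishes on
  \<open>x\<close>. For an isotropic \<open>x\<close> and its image \<open>y\<close> under a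
  symmetric matrix, the first column of that matrix becomes the second unit vector.\<close>

lemma ex_adapted_basis:
  fixes x y :: "'a::field vec"
  assumes x: "x \<in> carrier_vec n" "x \<noteq> 0\<^sub>v n" and y: "y \<in> carrier_vec n" "y \<noteq> 0\<^sub>v n" and xy: "x \<bullet> y = 0"
  obtains P where "2 \<le> n" "P \<in> carrier_mat n n" "det P \<noteq> 0" "P *\<^sub>v unit_vec n 0 = x"
    "P\<^sup>T *\<^sub>v y = unit_vec n 1"
proof -
  obtain i where i: "i < n" "x $ i \<noteq> 0" using nonzero_vec_ex[OF x] by blast
  obtain P1 where P1: "P1 \<in> carrier_mat n n" "det P1 \<noteq> 0" "P1 *\<^sub>v unit_vec n 0 = x"
    using ex_mat_first_col[OF x(1) i, of 0] i by (metis gr_zeroI not_less_zero)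
  define r where "r = P1\<^sup>T *\<^sub>v y"
  have r: "r \<in> carrier_vec n" using P1 y by (simp add: r_def)
  have n0: "0 < n" using i by simp
  have "r $ 0 = r \<bullet> unit_vec n 0" using r n0 by simp
  also have "\<dots> = y \<bullet> x" unfolding r_def P1(3)[symmetric]
    by (rule transpose_vec_mult_scalar[OF P1(1) _ y(1)]) simp
  also have "\<dots> = 0" using xy x y comm_scalar_prod by metis
  finally have r0: "r $ 0 = 0" .
  obtain Q1 where Q1: "Q1 \<in> carrier_mat n n" "Q1 * P1 = 1\<^sub>m n" "P1 * Q1 = 1\<^sub>m n"
    using invertible_mat_ex[OF P1(1,2)] by blast
  have "Q1\<^sup>T * P1\<^sup>T = 1\<^sub>m n" using transpose_mult[OF P1(1) Q1(1)] Q1(3) by simp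
  then have "Q1\<^sup>T *\<^sub>v r = y" unfolding r_def
    using assoc_mult_mat_vec[of "Q1\<^sup>T" n n "P1\<^sup>T" n y] Q1 P1 y by simp
  then have "r \<noteq> 0\<^sub>v n" using y(2) Q1 by auto
  then obtain k where k: "k < n" "r $ k \<noteq> 0" using nonzero_vec_ex[OF r] by blast
  have k0: "k \<noteq> 0" using k r0 by (intro notI) simp
  have n2: "2 \<le> n" using k k0 by simp
  obtain R where R: "R \<in> carrier_mat n n" "det R \<noteq> 0" "R *\<^sub>v unit_vec n 1 = r"
    and R0: "\<And>j. j < n \<Longrightarrow> R $$ (0, j) = (if 0 = j then 1 else 0)"
    using ex_mat_first_col[OF r k, of 1] n2 k0 r0 n0
    by (metis One_nat_def Suc_1 Suc_le_lessD zero_neq_one)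
  obtain Q where Q: "Q \<in> carrier_mat n n" "R * Q = 1\<^sub>m n" "Q * R = 1\<^sub>m n" "det Q \<noteq> 0"
    using invertible_mat_ex[OF R(1,2)] by blast
  have RT: "R\<^sup>T *\<^sub>v unit_vec n 0 = unit_vec n 0"
    using R R0 n0 by (intro eq_vecI) auto
  have QT: "Q\<^sup>T * R\<^sup>T = 1\<^sub>m n" using transpose_mult[OF R(1) Q(1)] Q(2) by simp
  have "Q\<^sup>T *\<^sub>v (R\<^sup>T *\<^sub>v unit_vec n 0) = unit_vec n 0"
    using assoc_mult_mat_vec[of "Q\<^sup>T" n n "R\<^sup>T" n "unit_vec n 0"] Q R QT by simp
  then have Q0: "Q\<^sup>T *\<^sub>v unit_vec n 0 = unit_vec n 0" unfolding RT .
  \<comment> \<open>Row 0 of \<open>R\<close> is a unit vector, so \<open>Q\<^sup>T\<close> fixes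
    the vector already placed first, while \<open>Q\<close> carries the functional to the second
    coordinate.\<close>
  define P where "P = P1 * Q\<^sup>T"
  have c: "P \<in> carrier_mat n n" using P1 Q by (simp add: P_def)
  have "det P \<noteq> 0" using P1 Q det_mult[of P1 n "Q\<^sup>T"] by (simp add: P_def det_transpose[of Q n])
  moreover have "P *\<^sub>v unit_vec n 0 = x"
    unfolding P_def using assoc_mult_mat_vec[of P1 n n "Q\<^sup>T" n "unit_vec n 0"] P1 Q Q0 by simp
  moreover have "P\<^sup>T *\<^sub>v y = Q *\<^sub>v r"
    unfolding P_def r_def using transpose_mult[of P1 n n "Q\<^sup>T" n] P1 Q y
      assoc_mult_mat_vec[of Q n n "P1\<^sup>T" n y] by simp
  moreover have "Q *\<^sub>v r = unit_vec n 1"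
    using assoc_mult_mat_vec[of Q n n R n "unit_vec n 1"] Q R by simp
  ultimately show thesis using that[OF n2 c] by simp
qed

text \<open>The off-diagonal block is cleared by a unipotent congruence. Taking a solution
  \<open>Y\<close> as input avoids inverting \<open>A\<close>, so the same argument serves over the
  field and over k[T].\<close>

lemma schur_complement:
  fixes A :: "'a::idom mat"
  assumes A: "A \<in> carrier_mat n n" "A\<^sup>T = A" and B: "B \<in> carrier_mat n m" and D: "D \<in> carrier_mat m m"
    and Y: "Y \<in> carrier_mat n m" "A * Y = - B"
  obtains P where "P \<in> carrier_mat (n + m) (n + m)" "det P = 1"
    "P\<^sup>T * four_block_mat A B B\<^sup>T D * P = four_block_mat A (0\<^sub>m n m) (0\<^sub>m m n) (D + B\<^sup>T * Y)"
proof -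
  define P where "P = four_block_mat (1\<^sub>m n) Y (0\<^sub>m m n) (1\<^sub>m m)"
  have c: "P \<in> carrier_mat (n + m) (n + m)" unfolding P_def by (rule four_block_carrier_mat) auto
  have d: "det P = 1" unfolding P_def using Y by (subst det_four_block_mat_lower_left_zero[of _ n _ m]) auto
  have PT: "P\<^sup>T = four_block_mat (1\<^sub>m n) (0\<^sub>m n m) Y\<^sup>T (1\<^sub>m m)"
    unfolding P_def using Y by (simp add: transpose_four_block_mat[of _ n n _ m _ m])
  have YA: "Y\<^sup>T * A = - B\<^sup>T"
    using transpose_mult[OF A(1) Y(1)] A(2) Y(2) by (simp add: transpose_uminus)
  have z: "- B\<^sup>T + B\<^sup>T = 0\<^sub>m m n" "- B + B = 0\<^sub>m n m" using B by (auto intro!: eq_matI)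
  have 1: "P\<^sup>T * four_block_mat A B B\<^sup>T D = four_block_mat A B (0\<^sub>m m n) (Y\<^sup>T * B + D)"
    unfolding PT using A B D Y
    by (subst mult_four_block_mat[of _ n n _ m _ m _ _ n _ m]) (auto simp: YA z)
  have YB: "Y\<^sup>T * B = B\<^sup>T * Y"
  proof -
    have "- (Y\<^sup>T * B) = Y\<^sup>T * (A * Y)" using Y B by simp
    also have "\<dots> = Y\<^sup>T * A * Y" using A Y by (simp add: assoc_mult_mat[of _ m n _ n _ m])
    also have "\<dots> = - (B\<^sup>T * Y)" unfolding YA using B Y by simp
    finally show ?thesis by (metis uminus_uminus_mat)
  qed
  have "P\<^sup>T * four_block_mat A B B\<^sup>T D * P = four_block_mat A (0\<^sub>m n m) (0\<^sub>m m n) (D + B\<^sup>T * Y)"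
    unfolding 1 unfolding P_def using A B D Y
    by (subst mult_four_block_mat[of _ n n _ m _ m _ _ n _ m])
        (auto simp: YB z intro!: cong_four_block_mat comm_add_mat)
  with that c d show thesis by blast
qed

lemma degree_mat_mult_le:
  fixes A B :: "'a::comm_ring_1 poly mat"
  assumes "A \<in> carrier_mat n m" "B \<in> carrier_mat m k"
    "\<And>i j. i < n \<Longrightarrow> j < m \<Longrightarrow> degree (A $$ (i, j)) \<le> a"
    "\<And>i j. i < m \<Longrightarrow> j < k \<Longrightarrow> degree (B $$ (i, j)) \<le> b"
    "i < n" "j < k"
  shows "degree ((A * B) $$ (i, j)) \<le> a + b"
proof -
  have "(A * B) $$ (i, j) = (\<Sum>l<m. A $$ (i, l) * B $$ (l, j))"
    using assms by (auto simp: scalar_prod_def atLeast0LessThan)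
  moreover have "degree (A $$ (i, l) * B $$ (l, j)) \<le> a + b" if "l < m" for l
    using degree_mult_le[of "A $$ (i, l)" "B $$ (l, j)"] assms(3)[OF assms(5) that] assms(4)[OF that assms(6)]
    by linarith
  ultimately show ?thesis by (auto intro!: degree_sum_le)
qed

text \<open>In a basis adapted to \<open>x\<close> and \<open>y\<close> the leading block is
  [[0, 1], [1, c]] and can be split off. This basis change is constant, so it respects the degree
  bound, and the Schur complement that follows leaves the remaining block as it is.\<close>

lemma split_metabolic_plane:
  fixes M :: "'a::field poly mat"
  assumes M: "M \<in> carrier_mat n n" "M\<^sup>T = M" "det M dvd 1"
    and dM: "\<And>i j. i < n \<Longrightarrow> j < n \<Longrightarrow> degree (M $$ (i, j)) \<le> d"
    and x: "x \<in> carrier_vec n" "x \<noteq> 0\<^sub>v n" and y: "y \<in> carrier_vec n"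
    and Mx: "M *\<^sub>v map_vec (\<lambda>c. [:c:]) x = map_vec (\<lambda>c. [:c:]) y" and xy: "x \<bullet> y = 0"
  obtains m c D where "n = 2 + m" "D \<in> carrier_mat m m" "D\<^sup>T = D" "det D dvd 1"
    "\<And>i j. i < m \<Longrightarrow> j < m \<Longrightarrow> degree (D $$ (i, j)) \<le> d"
    "\<And>t. isom_forms (ev_mat t M) (orth_sum (metabolic (diag [poly c t])) (ev_mat t D))"
proof -
  have "y \<noteq> 0\<^sub>v n"
  proof
    assume y0: "y = 0\<^sub>v n"
    obtain Q where Q: "Q \<in> carrier_mat n n" "Q * M = 1\<^sub>m n"
      using unit_det_inverse[OF M(1,3)] by blast
    have z: "map_vec (\<lambda>c. [:c:]) y = 0\<^sub>v n" unfolding y0 by (intro eq_vecI) auto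
    have "map_vec (\<lambda>c. [:c:]) x = Q *\<^sub>v (M *\<^sub>v map_vec (\<lambda>c. [:c:]) x)"
      using assoc_mult_mat_vec[OF Q(1) M(1), of "map_vec (\<lambda>c. [:c:]) x"] Q x by simp
    also have "\<dots> = 0\<^sub>v n" unfolding Mx z using Q by simp
    finally have "map_vec (\<lambda>c. [:c:]) x = 0\<^sub>v n" .
    then have "[:x $ i:] = 0" if "i < n" for i using that x(1)
      by (metis carrier_vecD index_map_vec(1) index_zero_vec(1))
    then have "x = 0\<^sub>v n" using x(1) by (intro eq_vecI) auto
    then show False using x(2) by simp
  qed
  then obtain P where P: "2 \<le> n" "P \<in> carrier_mat n n" "det P \<noteq> 0" "P *\<^sub>v unit_vec n 0 = x"
    "P\<^sup>T *\<^sub>v y = unit_vec n 1" using ex_adapted_basis[OF x y _ xy] by metis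
  obtain m where n: "n = 2 + m" using P(1) le_Suc_ex by blast
  let ?C = "map_mat (\<lambda>c::'a. [:c:])"
  let ?c = "map_vec (\<lambda>c::'a. [:c:])"
  have CP: "?C P \<in> carrier_mat n n" using P by simp
  have CT: "(?C P)\<^sup>T = ?C P\<^sup>T" by (rule eq_matI) auto
  have dCP: "det (?C P) dvd 1" using P(3) by (simp add: const_hom.hom_det is_unit_triv)
  define M' where "M' = (?C P)\<^sup>T * M * ?C P"
  have M': "M' \<in> carrier_mat n n" "M'\<^sup>T = M'" "det M' dvd 1"
    unfolding M'_def using M CP congruence_transpose[OF M(1) CP M(2)] det_congruence_dvd_1[OF M(1) CP dCP M(3)]
    by auto
  have dM': "degree (M' $$ (i, j)) \<le> d" if "i < n" "j < n" for i j
  proof -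
    have 1: "degree (((?C P)\<^sup>T * M) $$ (i, j)) \<le> 0 + d" if "i < n" "j < n" for i j
      by (rule degree_mat_mult_le[OF _ M(1) _ dM that]) (use P(2) in auto)
    have "degree (((?C P)\<^sup>T * M * ?C P) $$ (i, j)) \<le> (0 + d) + 0"
      by (rule degree_mat_mult_le[OF _ CP 1 _ that]) (use P(2) M(1) in auto)
    then show ?thesis by (simp add: M'_def)
  qed
  have col0: "M' *\<^sub>v unit_vec n 0 = unit_vec n 1"
  proof -
    have u: "unit_vec n i = ?c (unit_vec n i)" for i by (intro eq_vecI) (auto simp: unit_vec_def)
    have Px: "?C P *\<^sub>v unit_vec n 0 = ?c x"
      using const_hom.mult_mat_vec_hom[OF P(2), of "unit_vec n 0"] P(4) unfolding u[of 0] by simp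
    have "M' *\<^sub>v unit_vec n 0 = (?C P)\<^sup>T *\<^sub>v (M *\<^sub>v (?C P *\<^sub>v unit_vec n 0))"
      unfolding M'_def using CP M(1) by (simp add: assoc_mult_mat_vec[of _ n n _ n])
    also have "\<dots> = ?C P\<^sup>T *\<^sub>v ?c y" unfolding Px Mx CT ..
    also have "\<dots> = ?c (P\<^sup>T *\<^sub>v y)" using const_hom.mult_mat_vec_hom[of "P\<^sup>T" n n y] P(2) y by simp
    also have "\<dots> = unit_vec n 1" unfolding P(5) u[of 1] ..
    finally show ?thesis .
  qed
  have c0: "M' $$ (i, 0) = (if i = 1 then 1 else 0)" if "i < n" for i
  proof -
    have "M' $$ (i, 0) = (M' *\<^sub>v unit_vec n 0) $ i" using that M'(1) n by simp
    then show ?thesis unfolding col0 using that n by simp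
  qed
  have sym: "M' $$ (i, j) = M' $$ (j, i)" if "i < n" "j < n" for i j
    using that M'(1,2) by (metis carrier_matD index_transpose_mat(1))
  obtain A B C D where sb: "split_block M' 2 2 = (A, B, C, D)" by (cases "split_block M' 2 2") auto
  note s = split_block[OF sb, of m m]
  have bl: "A \<in> carrier_mat 2 2" "B \<in> carrier_mat 2 m" "C \<in> carrier_mat m 2" "D \<in> carrier_mat m m"
    "M' = four_block_mat A B C D" using s M'(1) n by auto
  have eA: "A $$ (i, j) = M' $$ (i, j)" if "i < 2" "j < 2" for i j
    unfolding bl(5) using bl(1-4) that by auto
  have eB: "B $$ (i, j) = M' $$ (i, 2 + j)" if "i < 2" "j < m" for i j
    unfolding bl(5) using bl(1-4) that by auto
  have eC: "C $$ (i, j) = M' $$ (2 + i, j)" if "i < m" "j < 2" for i j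
    unfolding bl(5) using bl(1-4) that by auto
  have eD: "D $$ (i, j) = M' $$ (2 + i, 2 + j)" if "i < m" "j < m" for i j
    unfolding bl(5) using bl(1-4) that by auto
  have CB: "C = B\<^sup>T"
  proof (rule eq_matI)
    fix i j assume "i < dim_row B\<^sup>T" "j < dim_col B\<^sup>T"
    then have "i < m" "j < 2" using bl(2) by auto
    then show "C $$ (i, j) = B\<^sup>T $$ (i, j)" using eC[of i j] eB[of j i] sym[of "2 + i" j] bl(2) n by simp
  qed (use bl(2,3) in auto)
  have AT: "A\<^sup>T = A"
  proof (rule eq_matI)
    fix i j assume "i < dim_row A" "j < dim_col A"
    then have "i < 2" "j < 2" using bl(1) by auto
    then show "A\<^sup>T $$ (i, j) = A $$ (i, j)" using eA[of i j] eA[of j i] sym[of i j] bl(1) n by simp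
  qed (use bl(1) in auto)
  have DT: "D\<^sup>T = D"
  proof (rule eq_matI)
    fix i j assume "i < dim_row D" "j < dim_col D"
    then have "i < m" "j < m" using bl(4) by auto
    then show "D\<^sup>T $$ (i, j) = D $$ (i, j)"
      using eD[of i j] eD[of j i] sym[of "2 + i" "2 + j"] bl(4) n by simp
  qed (use bl(4) in auto)
  have A0: "A $$ (0, 0) = 0" "A $$ (1, 0) = 1" "A $$ (0, 1) = 1"
    using c0[of 0] c0[of 1] sym[of 0 1] n eA[of 0 0] eA[of 1 0] eA[of 0 1] by simp_all
  have B0: "B $$ (0, j) = 0" if "j < m" for j
    using that n eB[of 0 j] sym[of 0 "2 + j"] c0[of "2 + j"] by simp
  \<comment> \<open>The first row of \<open>B\<close> is 0, so a solution with only its first row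
    nonzero exists. Then \<open>B\<^sup>T * Y = 0\<close>, and the complement is \<open>D\<close>
    itself.\<close>
  define Y where "Y = mat 2 m (\<lambda>(i, j). if i = 0 then - B $$ (1, j) else 0)"
  have Y: "Y \<in> carrier_mat 2 m" by (simp add: Y_def)
  have AY: "A * Y = - B"
  proof (rule eq_matI)
    fix i j assume "i < dim_row (- B)" "j < dim_col (- B)"
    then have "i = 0 \<or> i = 1" and j: "j < m" using bl by auto
    then show "(A * Y) $$ (i, j) = (- B) $$ (i, j)"
      using bl(1,2) A0 B0[OF j] j by (auto simp: Y_def scalar_prod_def numeral_2_eq_2)
  qed (use bl(1,2) Y in auto)
  have BY: "B\<^sup>T * Y = 0\<^sub>m m m"
    using bl(2) B0 by (intro eq_matI) (auto simp: Y_def scalar_prod_def numeral_2_eq_2)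
  obtain R where R: "R \<in> carrier_mat (2 + m) (2 + m)" "det R = 1"
    "R\<^sup>T * four_block_mat A B B\<^sup>T D * R = four_block_mat A (0\<^sub>m 2 m) (0\<^sub>m m 2) (D + B\<^sup>T * Y)"
    using schur_complement[OF bl(1) AT bl(2,4) Y AY] .
  define M'' where "M'' = four_block_mat A (0\<^sub>m 2 m) (0\<^sub>m m 2) D"
  have RM: "R\<^sup>T * M' * R = M''" using R(3) bl(4) unfolding M''_def BY bl(5) CB by simp
  have Rn: "R \<in> carrier_mat n n" using R(1) n by simp
  have dM'': "det M'' dvd 1" unfolding RM[symmetric]
    using det_congruence_dvd_1[OF M'(1) Rn _ M'(3)] R(2) by simp
  have "det M'' = det A * det D" unfolding M''_def
    using bl(1,4) by (subst det_four_block_mat_upper_right_zero[of _ 2 _ m]) auto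
  then have dD: "det D dvd 1" using dM'' by (metis dvd_mult_right)
  have "isom_forms (ev_mat t M) (orth_sum (metabolic (diag [poly (A $$ (1, 1)) t])) (ev_mat t D))" for t
  proof -
    have 1: "isom_forms (ev_mat t M) (ev_mat t M')"
      by (rule isom_forms_ev_mat[OF M(1) CP _ M'(3)]) (simp add: M'_def)
    have 2: "isom_forms (ev_mat t M') (ev_mat t M'')"
      by (rule isom_forms_ev_mat[OF M'(1) Rn RM dM''])
    have 3: "ev_mat t A = metabolic (diag [poly (A $$ (1, 1)) t])"
    proof (rule eq_matI)
      fix i j assume "i < dim_row (metabolic (diag [poly (A $$ (1, 1)) t]))"
          "j < dim_col (metabolic (diag [poly (A $$ (1, 1)) t]))"
      then have "i = 0 \<or> i = 1" "j = 0 \<or> j = 1" by (auto simp: metabolic_def diag_def)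
      then show "ev_mat t A $$ (i, j) = metabolic (diag [poly (A $$ (1, 1)) t]) $$ (i, j)"
        using bl(1) A0 by (auto simp: metabolic_def diag_def)
    qed (use bl(1) in \<open>auto simp: metabolic_def diag_def\<close>)
    have 4: "ev_mat t M'' = orth_sum (ev_mat t A) (ev_mat t D)"
      unfolding M''_def using bl(1,4) orth_sum_eq[of "ev_mat t A" 2 "ev_mat t D" m]
      by (subst map_four_block_mat[of _ 2 2 _ m _ m]) (auto intro!: cong_four_block_mat eq_matI)
    show ?thesis using isom_forms_trans[OF 1 2] M(1) unfolding 4 3 by simp
  qed
  moreover have "degree (D $$ (i, j)) \<le> d" if "i < m" "j < m" for i j
    using that dM' n by (simp add: eD)
  ultimately show thesis using that[OF n bl(4) DT dD] by blast
qed

section \<open>Stable diagonalisation\<close>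

lemma diag_single_carrier [simp]: "diag [c] \<in> carrier_mat 1 1"
  using diag_carrier[of "[c]"] by simp

lemma metabolic_diag_nondeg: "metabolic (diag [c]) \<in> nondeg_sym 2"
  using metabolic_nondeg[OF diag_single_carrier transpose_diag, of c] by (simp add: numeral_2_eq_2)

lemma stably_isom_metabolic_diag: "stably_isom (metabolic (diag [c])) (metabolic (diag [c']))"
  by (rule stably_isom_metabolic[OF diag_single_carrier transpose_diag diag_single_carrier transpose_diag])

text \<open>A nonzero corner entry is split off. If it vanishes, the first basis vector is isotropic
  and a metabolic plane splits off, which is stably the diagonal form with entries 1, -1.
  Diagonalising only stably covers alternating forms in characteristic 2.\<close>

lemma stably_isom_diag_ex:
  fixes M :: "'a::field mat"
  assumes "M \<in> nondeg_sym n"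
  shows "\<exists>us. length us = n \<and> 0 \<notin> set us \<and> stably_isom M (diag us)"
  using assms
proof (induction n arbitrary: M rule: less_induct)
  case (less n)
  note M = nondeg_symD[OF less.prems]
  show ?case
  proof (cases n)
    case 0
    then have "M = diag []" using M by (intro eq_matI) (auto simp: diag_def)
    then show ?thesis using 0 stably_isom_refl[OF less.prems] by (intro exI[of _ "[]"]) auto
  next
    case (Suc m)
    show ?thesis
    proof (cases "M $$ (0, 0) = 0")
      case False
      obtain A B C D where sb: "split_block M 1 1 = (A, B, C, D)" by (cases "split_block M 1 1") auto
      note s = split_block[OF sb, of m m]
      have bl: "A \<in> carrier_mat 1 1" "B \<in> carrier_mat 1 m" "C \<in> carrier_mat m 1" "D \<in> carrier_mat m m"
        "M = four_block_mat A B C D" using s M Suc by auto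
      have "M\<^sup>T = four_block_mat A\<^sup>T C\<^sup>T B\<^sup>T D\<^sup>T"
        unfolding bl(5) using bl(1-4) by (rule transpose_four_block_mat)
      then have eq: "four_block_mat A\<^sup>T C\<^sup>T B\<^sup>T D\<^sup>T = four_block_mat A B C D" using M(2) bl(5) by simp
      have "C = B\<^sup>T"
      proof (rule eq_matI)
        fix i j assume "i < dim_row B\<^sup>T" "j < dim_col B\<^sup>T"
        then have ij: "i < m" "j < 1" using bl(2) by auto
        then have "four_block_mat A\<^sup>T C\<^sup>T B\<^sup>T D\<^sup>T $$ (1 + i, j) = four_block_mat A B C D $$ (1 + i, j)"
          unfolding eq by simp
        then show "C $$ (i, j) = B\<^sup>T $$ (i, j)" using bl(1-4) ij by simp
      qed (use bl(2,3) in auto)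
      define c where "c = M $$ (0, 0)"
      have A: "A = diag [c]" using bl(1) unfolding c_def bl(5) by (intro eq_matI) (auto simp: diag_def)
      define Y where "Y = (- inverse c) \<cdot>\<^sub>m B"
      have Y: "Y \<in> carrier_mat 1 m" using bl(2) by (simp add: Y_def)
      have AY: "A * Y = - B"
        using bl(2) False unfolding A Y_def c_def
        by (intro eq_matI) (auto simp: diag_def scalar_prod_def)
      have AT: "A\<^sup>T = A" unfolding A by simp
      obtain P where P: "P \<in> carrier_mat (1 + m) (1 + m)" "det P = 1"
        "P\<^sup>T * four_block_mat A B B\<^sup>T D * P = four_block_mat A (0\<^sub>m 1 m) (0\<^sub>m m 1) (D + B\<^sup>T * Y)"
        using schur_complement[OF bl(1) AT bl(2,4) Y AY] .
      define D' where "D' = D + B\<^sup>T * Y"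
      have D': "D' \<in> carrier_mat m m" unfolding D'_def using bl(2,4) Y by simp
      have PM: "P\<^sup>T * M * P = orth_sum (diag [c]) D'"
        using P(3) unfolding bl(5) \<open>C = B\<^sup>T\<close> A D'_def[symmetric] orth_sum_eq[OF diag_single_carrier D'] .
      have i: "isom_forms M (orth_sum (diag [c]) D')" unfolding isom_forms_def
        using P(1,2) PM M Suc by (intro exI[of _ P]) auto
      note n1 = isom_forms_nondeg[OF i less.prems]
      have diag_c: "diag [c] \<in> nondeg_sym 1" using diag_nondeg[of "[c]"] False by (simp add: c_def)
      have "D'\<^sup>T = D'"
      proof (rule eq_matI)
        fix i j assume "i < dim_row D'" "j < dim_col D'"
        then have ij: "i < m" "j < m" using D' by auto
        have "(orth_sum (diag [c]) D')\<^sup>T $$ (1 + i, 1 + j) = orth_sum (diag [c]) D' $$ (1 + i, 1 + j)"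
          using nondeg_symD(2)[OF n1] by simp
        then show "D'\<^sup>T $$ (i, j) = D' $$ (i, j)"
          using ij D' unfolding orth_sum_def by (simp add: diag_def)
      qed (use D' in auto)
      moreover have "det D' \<noteq> 0"
        using nondeg_symD(3)[OF n1] det_orth_sum[OF diag_single_carrier D', of c] by auto
      ultimately have D'n: "D' \<in> nondeg_sym m" using D' by (intro nondeg_symI)
      obtain us where us: "length us = m" "0 \<notin> set us" "stably_isom D' (diag us)"
        using less.IH[OF _ D'n] Suc by auto
      have dgn: "diag us \<in> nondeg_sym m" "diag (c # us) \<in> nondeg_sym n"
        using us Suc diag_nondeg[of us] diag_nondeg[of "c # us"] False by (auto simp: c_def)
      have "stably_isom M (diag (c # us))"
        unfolding diag_Cons[of c us]
        by (rule stably_isom_trans[OF isom_forms_stably_isom[OF i less.prems]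
            stably_isom_orth_sum_left[OF us(3) diag_c D'n dgn(1)] less.prems n1])
          (use dgn(2) in \<open>simp add: diag_Cons[of c us]\<close>)
      then show ?thesis using us Suc False by (intro exI[of _ "c # us"]) (auto simp: c_def)
    next
      case True
      \<comment> \<open>The matrix is regarded as a constant path, so that the splitting over k[T]
        applies with degree bound 0.\<close>
      let ?C = "map_mat (\<lambda>c::'a. [:c:])"
      let ?e = "unit_vec n 0"
      have CM: "?C M \<in> carrier_mat n n" "(?C M)\<^sup>T = ?C M" "det (?C M) dvd 1"
      proof -
        have "(?C M)\<^sup>T = ?C M\<^sup>T" by (rule eq_matI) auto
        then show "(?C M)\<^sup>T = ?C M" using M(2) by simp
      qed (use M in \<open>auto simp: const_hom.hom_det is_unit_triv\<close>)
      have n0: "0 < n" using Suc by simp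
      have e: "?e \<in> carrier_vec n" "?e \<noteq> 0\<^sub>v n"
        using n0 by (auto dest!: arg_cong[of _ _ "\<lambda>v. v $ 0"])
      have y: "M *\<^sub>v ?e \<in> carrier_vec n" using M by simp
      have Mx: "?C M *\<^sub>v map_vec (\<lambda>c. [:c:]) ?e = map_vec (\<lambda>c. [:c:]) (M *\<^sub>v ?e)"
        using const_hom.mult_mat_vec_hom[OF M(1) e(1)] by simp
      have xy: "?e \<bullet> (M *\<^sub>v ?e) = 0" using True M n0 by simp
      have deg: "degree (?C M $$ (i, j)) \<le> 0" if "i < n" "j < n" for i j using that M(1) by simp
      obtain m' c D where D: "n = 2 + m'" "D \<in> carrier_mat m' m'" "D\<^sup>T = D" "det D dvd 1"
        "\<And>t. isom_forms (ev_mat t (?C M)) (orth_sum (metabolic (diag [poly c t])) (ev_mat t D))"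
        using split_metabolic_plane[OF CM deg e y Mx xy] by blast
      have "ev_mat 0 (?C M) = M" by (rule eq_matI) auto
      then have i: "isom_forms M (orth_sum (metabolic (diag [poly c 0])) (ev_mat 0 D))" using D(5)[of 0] by simp
      have D'n: "ev_mat 0 D \<in> nondeg_sym m'" by (rule ev_mat_nondeg[OF D(2-4)])
      obtain us where us: "length us = m'" "0 \<notin> set us" "stably_isom (ev_mat 0 D) (diag us)"
        using less.IH[OF _ D'n] D(1) by auto
      have dgn: "diag us \<in> nondeg_sym m'" "diag [1, - 1 :: 'a] \<in> nondeg_sym 2"
        using us diag_nondeg[of us] diag_nondeg[of "[1, -1 :: 'a]"] by (auto simp: numeral_2_eq_2)
      have "isom_forms (diag [1, -1]) (metabolic (diag [-1 :: 'a]))" by (rule isom_diag_metabolic[of _ _ 1]) auto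
      note 1 = stably_isom_sym[OF isom_forms_stably_isom[OF this dgn(2)] dgn(2)]
      have 2: "stably_isom (metabolic (diag [poly c 0])) (diag [1, -1])"
        by (rule stably_isom_trans[OF stably_isom_metabolic_diag 1 metabolic_diag_nondeg metabolic_diag_nondeg
            dgn(2)])
      note mn = metabolic_diag_nondeg[of "poly c 0"]
      have "stably_isom M (orth_sum (diag [1, -1]) (diag us))"
        by (rule stably_isom_trans[OF isom_forms_stably_isom[OF i less.prems]
           stably_isom_trans[OF stably_isom_orth_sum_left[OF us(3) mn D'n dgn(1)]
              stably_isom_orth_sum_right[OF 2 dgn(1) mn dgn(2)]]])
          (use D(1) less.prems orth_sum_nondeg[OF mn D'n] orth_sum_nondeg[OF mn dgn(1)]
             orth_sum_nondeg[OF dgn(2,1)] in auto)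
      then show ?thesis using us D(1)
        by (intro exI[of _ "1 # (-1) # us"]) (auto simp: diag_Cons2[of 1 "-1" us])
    qed
  qed
qed

section \<open>Paths of forms over k[T]\<close>

lemma degree_le_1_iff_pCons: "degree (p :: 'a::zero poly) \<le> 1 \<Longrightarrow> p = [:coeff p 0, coeff p 1:]"
  by (auto simp: poly_eq_iff coeff_pCons coeff_eq_0 split: nat.splits)

lemma coeff_mult_degree_le_1:
  fixes p q :: "'a::comm_ring_1 poly"
  assumes "degree p \<le> 1"
  shows "coeff (p * q) (Suc i) = coeff p 0 * coeff q (Suc i) + coeff p 1 * coeff q i"
    "coeff (p * q) 0 = coeff p 0 * coeff q 0"
proof -
  have "p * q = [:coeff p 0, coeff p 1:] * q" using degree_le_1_iff_pCons[OF assms] by simp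
  then show "coeff (p * q) (Suc i) = coeff p 0 * coeff q (Suc i) + coeff p 1 * coeff q i"
    "coeff (p * q) 0 = coeff p 0 * coeff q 0" by simp_all
qed

text \<open>Compare coefficients in \<open>M * Q = 1\<close>, where \<open>Q\<close> is the inverse of \<open>M\<close>: a column of the
  leading coefficient of \<open>Q\<close> is killed by the linear coefficient of \<open>M\<close>, and it is isotropic.\<close>

lemma linear_unimodular_isotropic:
  fixes M :: "'a::field poly mat"
  assumes M: "M \<in> carrier_mat n n" "M\<^sup>T = M" "det M dvd 1"
    and dM: "\<And>i j. i < n \<Longrightarrow> j < n \<Longrightarrow> degree (M $$ (i, j)) \<le> 1"
    and nc: "i0 < n" "j0 < n" "coeff (M $$ (i0, j0)) 1 \<noteq> 0"
  obtains x y where "x \<in> carrier_vec n" "x \<noteq> 0\<^sub>v n" "y \<in> carrier_vec n"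
    "M *\<^sub>v map_vec (\<lambda>c. [:c:]) x = map_vec (\<lambda>c. [:c:]) y" "x \<bullet> y = 0"
proof -
  obtain Q where Q: "Q \<in> carrier_mat n n" "M * Q = 1\<^sub>m n" "Q * M = 1\<^sub>m n"
    using unit_det_inverse[OF M(1,3)] by blast
  define M0 where "M0 = map_mat (\<lambda>p. coeff p 0) M"
  define M1 where "M1 = map_mat (\<lambda>p. coeff p 1) M"
  have M01: "M0 \<in> carrier_mat n n" "M1 \<in> carrier_mat n n" using M by (auto simp: M0_def M1_def)
  have sym: "M $$ (i, j) = M $$ (j, i)" if "i < n" "j < n" for i j
    using that M(1,2) by (metis carrier_matD index_transpose_mat(1))
  have M1T: "M1\<^sup>T = M1" using M(1) sym by (intro eq_matI) (auto simp: M1_def)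
  define Qc where "Qc r = map_mat (\<lambda>p. coeff p r) Q" for r
  have Qc: "Qc r \<in> carrier_mat n n" for r using Q by (simp add: Qc_def)
  have co: "coeff ((M * Q) $$ (i, j)) r = (\<Sum>k<n. coeff (M $$ (i, k) * Q $$ (k, j)) r)"
    if "i < n" "j < n" for i j r
    using that M(1) Q(1) by (simp add: scalar_prod_def atLeast0LessThan coeff_sum)
  have step: "M0 * Qc (Suc r) + M1 * Qc r = 0\<^sub>m n n" for r
  proof (rule eq_matI)
    fix i j assume "i < dim_row (0\<^sub>m n n)" "j < dim_col (0\<^sub>m n n)"
    then have ij: "i < n" "j < n" by auto
    have "(M0 * Qc (Suc r) + M1 * Qc r) $$ (i, j) =
        (\<Sum>k<n. coeff (M $$ (i, k)) 0 * coeff (Q $$ (k, j)) (Suc r) + coeff (M $$ (i, k)) 1 * coeff (Q $$ (k, j)) r)"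
      using ij M(1) Q(1) by (simp add: M0_def M1_def Qc_def scalar_prod_def atLeast0LessThan sum.distrib)
    also have "\<dots> = coeff ((M * Q) $$ (i, j)) (Suc r)"
      unfolding co[OF ij] using ij by (intro sum.cong) (auto simp: coeff_mult_degree_le_1[OF dM])
    also have "\<dots> = 0" unfolding Q(2) using ij by simp
    finally show "(M0 * Qc (Suc r) + M1 * Qc r) $$ (i, j) = 0\<^sub>m n n $$ (i, j)" using ij by simp
  qed (use M01 Qc in auto)
  have start: "M0 * Qc 0 = 1\<^sub>m n"
  proof (rule eq_matI)
    fix i j assume "i < dim_row (1\<^sub>m n)" "j < dim_col (1\<^sub>m n)"
    then have ij: "i < n" "j < n" by auto
    have "(M0 * Qc 0) $$ (i, j) = (\<Sum>k<n. coeff (M $$ (i, k)) 0 * coeff (Q $$ (k, j)) 0)"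
      using ij M(1) Q(1) by (simp add: M0_def Qc_def scalar_prod_def atLeast0LessThan)
    also have "\<dots> = coeff ((M * Q) $$ (i, j)) 0"
      unfolding co[OF ij] using ij by (intro sum.cong) (auto simp: coeff_mult_degree_le_1[OF dM])
    finally show "(M0 * Qc 0) $$ (i, j) = 1\<^sub>m n $$ (i, j)" unfolding Q(2) using ij by simp
  qed (use M01 Qc in auto)
  define S where "S = (\<lambda>(i, j). degree (Q $$ (i, j))) ` ({..<n} \<times> {..<n})"
  have S: "finite S" "S \<noteq> {}" using nc by (auto simp: S_def)
  define r where "r = Max S"
  have "r \<in> S" unfolding r_def using S by (rule Max_in)
  have le: "degree (Q $$ (i, j)) \<le> r" if "i < n" "j < n" for i j
    unfolding r_def using that S(1) by (intro Max_ge) (auto simp: S_def)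
  have Qr1: "Qc (Suc r) = 0\<^sub>m n n"
    using Q(1) le by (intro eq_matI) (auto simp: Qc_def coeff_eq_0 le_imp_less_Suc)
  have M1Qr: "M1 * Qc r = 0\<^sub>m n n" using step[of r] M01 Qc[of r] unfolding Qr1 by simp
  \<comment> \<open>If the inverse \<open>Q\<close> were constant, \<open>M1 * Qc 0 = 0\<close>
    would force \<open>M1 = 0\<close>, and \<open>M\<close> would be constant.\<close>
  have "r \<noteq> 0"
  proof
    assume r: "r = 0"
    have "Qc 0 * M0 = 1\<^sub>m n" by (rule mat_mult_left_right_inverse[OF M01(1) Qc start])
    then have "M1 = M1 * (Qc 0 * M0)" using M01 by simp
    also have "\<dots> = M1 * Qc 0 * M0" using M01 Qc[of 0] by (intro assoc_mult_mat[symmetric]) auto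
    also have "\<dots> = 0\<^sub>m n n" using M1Qr M01 unfolding r by simp
    finally have "M1 $$ (i0, j0) = 0" using nc by simp
    then show False using nc M(1) by (simp add: M1_def)
  qed
  then obtain r' where r': "r = Suc r'" by (cases r) auto
  from \<open>r \<in> S\<close> obtain i j where ij: "i < n" "j < n" "degree (Q $$ (i, j)) = r" by (auto simp: S_def)
  define x where "x = col (Qc r) j"
  define q where "q = col (Qc r') j"
  define y where "y = M0 *\<^sub>v x"
  have x: "x \<in> carrier_vec n" and q: "q \<in> carrier_vec n" unfolding x_def q_def using Qc ij
      by (auto intro: col_carrier_vec)
  have y: "y \<in> carrier_vec n" using M01 x by (simp add: y_def)
  have "Q $$ (i, j) \<noteq> 0" using ij(3) r' by auto
  then have "x $ i \<noteq> 0" using ij Q(1) unfolding x_def Qc_def by (simp flip: ij(3))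
  then have x0: "x \<noteq> 0\<^sub>v n" using ij by auto
  have M1x: "M1 *\<^sub>v x = 0\<^sub>v n"
  proof -
    have "M1 *\<^sub>v x = col (M1 * Qc r) j" unfolding x_def using M01 Qc ij by (simp add: col_mult2[of _ n n _ n])
    then show ?thesis unfolding M1Qr using ij by simp
  qed
  \<comment> \<open>The coefficient of T^r in \<open>M * Q = 1\<close>, one degree below the top. It
    turns \<open>x \<bullet> y\<close> into the negative of
    \<open>x \<bullet> (M1 *\<^sub>v q)\<close>, which vanishes by symmetry since \<open>M1\<close>
    kills \<open>x\<close>.\<close>
  have yq: "y + M1 *\<^sub>v q = 0\<^sub>v n"
  proof -
    have "col (M0 * Qc r + M1 * Qc r') j = col (M0 * Qc r) j + col (M1 * Qc r') j"
      using M01 Qc[of r] Qc[of r'] ij by (intro col_add) auto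
    also have "\<dots> = y + M1 *\<^sub>v q" unfolding y_def x_def q_def using M01 Qc[of r] Qc[of r'] ij
      by (intro eq_vecI) auto
    finally show ?thesis using step[of r'] ij unfolding r' by simp
  qed
  have "x \<bullet> y + x \<bullet> (M1 *\<^sub>v q) = x \<bullet> (y + M1 *\<^sub>v q)"
    using x y M01 q by (simp add: scalar_prod_add_distrib[of _ n])
  also have "\<dots> = 0" unfolding yq using x by simp
  also have "x \<bullet> (M1 *\<^sub>v q) = (M1 *\<^sub>v x) \<bullet> q"
    using bl_move[OF M01(2) M1T x q] by (simp add: bl_def)
  also have "\<dots> = 0" unfolding M1x using q by simp
  finally have xy: "x \<bullet> y = 0" by simp
  have "M *\<^sub>v map_vec (\<lambda>c. [:c:]) x = map_vec (\<lambda>c. [:c:]) y"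
  proof (rule eq_vecI)
    fix i assume "i < dim_vec (map_vec (\<lambda>c. [:c:]) y)"
    then have i: "i < n" using y by simp
    have "(M *\<^sub>v map_vec (\<lambda>c. [:c:]) x) $ i = (\<Sum>k<n. M $$ (i, k) * [:x $ k:])"
      using i M(1) x by (auto simp: scalar_prod_def atLeast0LessThan)
    also have "\<dots> = (\<Sum>k<n. [:M0 $$ (i, k) * x $ k:] + [:0, 1:] * [:M1 $$ (i, k) * x $ k:])"
      using i M(1) by (intro sum.cong refl)
        (subst degree_le_1_iff_pCons[OF dM], auto simp: M0_def M1_def mult.commute)
    also have "\<dots> = [:y $ i:] + [:0, 1:] * [:(M1 *\<^sub>v x) $ i:]"
      using i M01 x unfolding y_def
      by (simp add: sum.distrib scalar_prod_def atLeast0LessThan sum_distrib_left[symmetric] const_hom.hom_sum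
          del: mult_pCons_left mult_pCons_right)
    also have "\<dots> = [:y $ i:]" unfolding M1x using i by simp
    finally show "(M *\<^sub>v map_vec (\<lambda>c. [:c:]) x) $ i = map_vec (\<lambda>c. [:c:]) y $ i" using i y by simp
  qed (use M y in auto)
  with that[OF x x0 y _ xy] show thesis by blast
qed

text \<open>Induction on the size. A non-constant path loses a metabolic plane; the parameter of
  that plane may depend on T, but its stable class does not.\<close>

lemma stably_isom_linear_path:
  fixes M :: "'a::field poly mat"
  assumes "M \<in> carrier_mat n n" "M\<^sup>T = M" "det M dvd 1"
    and "\<And>i j. i < n \<Longrightarrow> j < n \<Longrightarrow> degree (M $$ (i, j)) \<le> 1"
  shows "stably_isom (ev_mat 0 M) (ev_mat 1 M)"
  using assms
proof (induction n arbitrary: M rule: less_induct)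
  case (less n)
  note n = ev_mat_nondeg[OF less.prems(1-3)]
  show ?case
  proof (cases "\<exists>i<n. \<exists>j<n. coeff (M $$ (i, j)) 1 \<noteq> 0")
    case False
    then have e: "M $$ (i, j) = [:coeff (M $$ (i, j)) 0:]" if "i < n" "j < n" for i j
      using degree_le_1_iff_pCons[OF less.prems(4)[OF that]] that by auto
    then have "poly (M $$ (i, j)) 0 = poly (M $$ (i, j)) 1" if "i < n" "j < n" for i j
      by (subst (1 2) e[OF that]) simp
    then have "ev_mat 0 M = ev_mat 1 M" using less.prems(1) by (intro eq_matI) auto
    then show ?thesis using stably_isom_refl[OF n] by simp
  next
    case True
    then obtain i j where ij: "i < n" "j < n" "coeff (M $$ (i, j)) 1 \<noteq> 0" by blast
    obtain x y where xy: "x \<in> carrier_vec n" "x \<noteq> 0\<^sub>v n" "y \<in> carrier_vec n"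
      "M *\<^sub>v map_vec (\<lambda>c. [:c:]) x = map_vec (\<lambda>c. [:c:]) y" "x \<bullet> y = 0"
      using linear_unimodular_isotropic[OF less.prems ij] .
    obtain m c D where D: "n = 2 + m" "D \<in> carrier_mat m m" "D\<^sup>T = D" "det D dvd 1"
      "\<And>i j. i < m \<Longrightarrow> j < m \<Longrightarrow> degree (D $$ (i, j)) \<le> 1"
      "\<And>t. isom_forms (ev_mat t M) (orth_sum (metabolic (diag [poly c t])) (ev_mat t D))"
      using split_metabolic_plane[OF less.prems xy] by blast
    note Dn = ev_mat_nondeg[OF D(2-4)] and mn = metabolic_diag_nondeg
    have 1: "stably_isom (ev_mat 0 D) (ev_mat 1 D)" using less.IH[OF _ D(2-5)] D(1) by simp
    have on: "orth_sum (metabolic (diag [poly c t])) (ev_mat t' D) \<in> nondeg_sym n" for t t'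
      using orth_sum_nondeg[OF mn Dn] D(1) by simp
    have "stably_isom (orth_sum (metabolic (diag [poly c 0])) (ev_mat 0 D)) (orth_sum (metabolic (diag [poly c
        1])) (ev_mat 1 D))"
      by (rule stably_isom_trans[OF stably_isom_orth_sum_left[OF 1 mn Dn Dn]
          stably_isom_orth_sum_right[OF stably_isom_metabolic_diag Dn mn mn] on on on])
    then show ?thesis
      using stably_isom_trans[OF isom_forms_stably_isom[OF D(6) n] stably_isom_trans[OF _
         stably_isom_sym[OF isom_forms_stably_isom[OF D(6) n] n] on on n] n on n] by blast
  qed
qed

lemma degree_le_pred: "degree p \<le> d \<Longrightarrow> coeff p d = 0 \<Longrightarrow> degree p \<le> d - 1"
  by (metis One_nat_def Suc_pred' degree_0 le_antisym le_less_Suc_eq leading_coeff_0_iff less_Suc_eq_le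
      linorder_not_less nat_less_le zero_le)

text \<open>Higman's linearization: after adding a metabolic form, the basis change \<open>e \<mapsto> e + T ^ s g\<close>
  with \<open>g\<close> of square \<open>- T ^ (d mod 2) M_d\<close> and \<open>s = d div 2\<close> removes the terms of degree \<open>d\<close> in \<open>T\<close>.\<close>

lemma stably_isom_path_degree:
  fixes M :: "'a::field poly mat"
  assumes "M \<in> carrier_mat n n" "M\<^sup>T = M" "det M dvd 1"
    and "\<And>i j. i < n \<Longrightarrow> j < n \<Longrightarrow> degree (M $$ (i, j)) \<le> Suc d"
  shows "stably_isom (ev_mat 0 M) (ev_mat 1 M)"
  using assms
proof (induction d arbitrary: M n)
  case 0
  then show ?case by (intro stably_isom_linear_path) auto
next
  case (Suc d')
  define d where "d = Suc (Suc d')"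
  note M = Suc.prems(1-3) and dM = Suc.prems(4)[folded d_def]
  define s where "s = d div 2"
  define C where "C = mat n n (\<lambda>(i, j). - monom (coeff (M $$ (i, j)) d) (d mod 2))"
  define L :: "'a poly mat" where "L = mat (n + n) n (\<lambda>(i, j). if i = n + j then monom 1 s else 0)"
  define K where "K = metabolic C"
  have sym: "M $$ (i, j) = M $$ (j, i)" if "i < n" "j < n" for i j
    using that M(1,2) by (metis carrier_matD index_transpose_mat(1))
  have C: "C \<in> carrier_mat n n" by (simp add: C_def)
  have CT: "C\<^sup>T = C" using sym by (intro eq_matI) (auto simp: C_def)
  have K: "K \<in> carrier_mat (n + n) (n + n)" "K\<^sup>T = K" "det K dvd 1"
    unfolding K_def by (rule metabolic_carrier[OF C], rule transpose_metabolic[OF C CT], rule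
        det_metabolic_dvd_1[OF C])
  have L: "L \<in> carrier_mat (n + n) n" by (simp add: L_def)
  define D where "D = four_block_mat M (0\<^sub>m n (n + n)) (0\<^sub>m (n + n) n) K"
  have D: "D \<in> carrier_mat (n + (n + n)) (n + (n + n))" unfolding D_def using M K by simp
  have DT: "D\<^sup>T = D" unfolding D_def using M K by (simp add: transpose_four_block_mat[of _ n n _ "n+n" _ "n+n"])
  have "det D = det M * det K"
    unfolding D_def using M K by (intro det_four_block_mat_upper_right_zero) auto
  then have dD: "det D dvd 1" using M(3) K(3) by (metis mult.right_neutral mult_dvd_mono)
  define P where "P = four_block_mat (1\<^sub>m n) (0\<^sub>m n (n + n)) L (1\<^sub>m (n + n))"
  have P: "P \<in> carrier_mat (n + (n + n)) (n + (n + n))" unfolding P_def using L by simp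
  have "det P = 1" unfolding P_def using L by (subst det_four_block_mat_upper_right_zero[of _ n _ "n + n"]) auto
  then have dP: "det P dvd 1" by simp
  have PT: "P\<^sup>T = four_block_mat (1\<^sub>m n) L\<^sup>T (0\<^sub>m (n + n) n) (1\<^sub>m (n + n))"
    unfolding P_def using L by (simp add: transpose_four_block_mat[of _ n n _ "n+n" _ "n+n"])
  define N where "N = P\<^sup>T * D * P"
  have PD: "P\<^sup>T * D = four_block_mat M (L\<^sup>T * K) (0\<^sub>m (n + n) n) K"
    unfolding PT D_def using M K L
    by (subst mult_four_block_mat[of _ n n _ "n+n" _ "n+n" _ _ n _ "n+n"]) auto
  have N_eq: "N = four_block_mat (M + L\<^sup>T * K * L) (L\<^sup>T * K) (K * L) K"
    unfolding N_def PD unfolding P_def using M K L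
    by (subst mult_four_block_mat[of _ n n _ "n+n" _ "n+n" _ _ n _ "n+n"]) auto
  have N: "N \<in> carrier_mat (n + (n + n)) (n + (n + n))" "N\<^sup>T = N" "det N dvd 1"
    unfolding N_def using D P congruence_transpose[OF D P DT] det_congruence_dvd_1[OF D P dP dD]
    by (auto simp del: is_unit_iff_degree)
  have KL: "(K * L) $$ (i, j) = K $$ (i, n + j) * monom 1 s" if "i < n + n" "j < n" for i j
  proof -
    have "(K * L) $$ (i, j) = (\<Sum>k<n+n. K $$ (i, k) * (if k = n + j then monom 1 s else 0))"
      using that K(1) by (simp add: L_def scalar_prod_def atLeast0LessThan)
    also have "\<dots> = (\<Sum>k<n+n. if k = n + j then K $$ (i, k) * monom 1 s else 0)"
      by (rule sum.cong) auto
    finally show ?thesis using that by simp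
  qed
  have LK: "L\<^sup>T * K = (K * L)\<^sup>T" using transpose_mult[OF K(1) L] K(2) by simp
  have LKL: "(L\<^sup>T * K * L) $$ (i, j) = monom 1 s * K $$ (n + i, n + j) * monom 1 s"
    if "i < n" "j < n" for i j
  proof -
    have "L\<^sup>T * K * L = L\<^sup>T * (K * L)" using K L by (simp add: assoc_mult_mat[of _ n "n+n" _ "n+n" _ n])
    then have "(L\<^sup>T * K * L) $$ (i, j) = (\<Sum>k<n+n. (if k = n + i then monom 1 s else 0) * (K * L) $$ (k, j))"
      using that K(1) L by (simp add: L_def scalar_prod_def atLeast0LessThan)
    also have "\<dots> = (\<Sum>k<n+n. if k = n + i then monom 1 s * (K * L) $$ (k, j) else 0)"
      by (rule sum.cong) auto
    finally show ?thesis using that by (simp add: KL mult.assoc)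
  qed
  have KC: "K $$ (n + i, n + j) = C $$ (i, j)" if "i < n" "j < n" for i j
    using that C by (simp add: K_def metabolic_def)
  \<comment> \<open>The identity makes the new term cancel the one of degree \<open>d\<close>; the
    inequalities keep all new entries below degree \<open>d\<close>. They hold because
    \<open>d \<ge> 2\<close>.\<close>
  have ds: "2 * s + d mod 2 = d" "s + d mod 2 \<le> Suc d'" "s \<le> Suc d'" "d mod 2 \<le> Suc d'"
    unfolding s_def d_def by auto
  have dC: "degree (C $$ (i, j)) \<le> d mod 2" if "i < n" "j < n" for i j
    using that degree_monom_le[of _ "d mod 2"] by (simp add: C_def)
  have dK: "degree (K $$ (i, j)) \<le> d mod 2" if "i < n + n" "j < n + n" for i j
    using that C dC by (auto simp: K_def metabolic_def)
  have dKL: "degree ((K * L) $$ (i, j)) \<le> Suc d'" if "i < n + n" "j < n" for i j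
    unfolding KL[OF that]
    using degree_mult_le[of "K $$ (i, n + j)" "monom 1 s"] dK[of i "n + j"] that degree_monom_le[of "1::'a" s] ds
    by linarith
  have top: "(L\<^sup>T * K * L) $$ (i, j) = - monom (coeff (M $$ (i, j)) d) d" if "i < n" "j < n" for i j
    unfolding LKL[OF that] KC[OF that] using that ds(1)[unfolded mult_2]
    by (simp add: C_def mult_monom add.assoc[symmetric] add.commute[of "s + s"] add.commute[of "d mod 2" s])
  have dA: "degree ((M + L\<^sup>T * K * L) $$ (i, j)) \<le> Suc d'" if "i < n" "j < n" for i j
  proof -
    have e: "(M + L\<^sup>T * K * L) $$ (i, j) = M $$ (i, j) + - monom (coeff (M $$ (i, j)) d) d"
      using that L K M(1) by (simp add: top[OF that, symmetric])
    have "degree ((M + L\<^sup>T * K * L) $$ (i, j)) \<le> d - 1"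
      unfolding e using dM[OF that] degree_monom_le[of "coeff (M $$ (i, j)) d" d]
      by (intro degree_le_pred degree_add_le) auto
    then show ?thesis by (simp add: d_def)
  qed
  have dN: "degree (N $$ (i, j)) \<le> Suc d'" if "i < n + (n + n)" "j < n + (n + n)" for i j
  proof -
    have "N $$ (i, j) = (if i < n then if j < n then (M + L\<^sup>T * K * L) $$ (i, j) else (K * L) $$ (j - n, i)
       else if j < n then (K * L) $$ (i - n, j) else K $$ (i - n, j - n))"
      unfolding N_eq LK using that M K L by auto
    then show ?thesis using that dA dKL[of "j - n" i] dKL[of "i - n" j]
        order_trans[OF dK[of "i - n" "j - n"] ds(4)] by auto
  qed
  have 1: "stably_isom (ev_mat 0 N) (ev_mat 1 N)" by (rule Suc.IH[OF N dN])
  have eC: "ev_mat t C \<in> carrier_mat n n" for t using C by simp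
  have evK: "ev_mat t K = metabolic (ev_mat t C)" for t
    unfolding K_def metabolic_eq[OF C] metabolic_eq[OF eC]
    using C by (subst map_four_block_mat[of _ n n _ n _ n]) (auto intro!: cong_four_block_mat eq_matI)
  have evC: "ev_mat t C \<in> carrier_mat n n" "(ev_mat t C)\<^sup>T = ev_mat t C" for t
  proof -
    have "(ev_mat t C)\<^sup>T = ev_mat t C\<^sup>T" by (rule eq_matI) auto
    then show "(ev_mat t C)\<^sup>T = ev_mat t C" using CT by simp
  qed (use C in auto)
  have evD: "ev_mat t D = orth_sum (ev_mat t M) (ev_mat t K)" for t
    unfolding D_def using M K orth_sum_eq[of "ev_mat t M" n "ev_mat t K" "n + n"]
    by (subst map_four_block_mat[of _ n n _ "n+n" _ "n+n"]) (auto intro!: cong_four_block_mat eq_matI)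
  have 2: "isom_forms (orth_sum (ev_mat t M) (ev_mat t K)) (ev_mat t N)" for t
    unfolding evD[symmetric] by (rule isom_forms_ev_mat[OF D P _ N(3)]) (simp add: N_def)
  note nM = ev_mat_nondeg[OF M] and nK = ev_mat_nondeg[OF K] and nN = ev_mat_nondeg[OF N]
  note o = orth_sum_nondeg[OF nM nK]
  note a = isom_forms_stably_isom[OF 2 o]
  have "stably_isom (orth_sum (ev_mat 0 M) (ev_mat 0 K)) (orth_sum (ev_mat 1 M) (ev_mat 1 K))"
    by (rule stably_isom_trans[OF a stably_isom_trans[OF 1 stably_isom_sym[OF a o] nN nN o] o nN o])
  \<comment> \<open>The added form is itself a path, but its two ends are metabolic and hence stably
    isometric, so it can be cancelled.\<close>
  moreover have "stably_isom (orth_sum (ev_mat 1 M) (ev_mat 1 K)) (orth_sum (ev_mat 1 M) (ev_mat 0 K))"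
    by (rule stably_isom_orth_sum_left[OF _ nM nK nK]) (simp only: evK stably_isom_metabolic[OF evC evC])
  ultimately have "stably_isom (orth_sum (ev_mat 0 M) (ev_mat 0 K)) (orth_sum (ev_mat 1 M) (ev_mat 0 K))"
    by (rule stably_isom_trans[OF _ _ o o o])
  then show ?case by (rule stably_isom_cancel[OF _ nK nM nM])
qed

theorem stably_isom_path:
  fixes M :: "'a::field poly mat"
  assumes M: "M \<in> carrier_mat n n" "M\<^sup>T = M" "det M dvd 1"
  shows "stably_isom (ev_mat 0 M) (ev_mat 1 M)"
proof -
  define S where "S = (\<lambda>(i, j). degree (M $$ (i, j))) ` ({..<n} \<times> {..<n})"
  have "degree (M $$ (i, j)) \<le> Suc (Max S)" if "i < n" "j < n" for i j
    using that by (intro le_SucI Max_ge) (auto simp: S_def)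
  then show ?thesis by (rule stably_isom_path_degree[OF M])
qed

section \<open>Bezout matrices and resultants\<close>

text \<open>Comparing coefficients of X^p Y^q in the defining identity multiplied by X - Y gives
  c(p-1, q) - c(p, q-1) = a(p) b(q) - b(p) a(q), solved here for increasing \<open>p\<close>.
  Without a division the definition makes sense over k[T] too.\<close>

primrec bez_coeff :: "'a::comm_ring_1 poly \<Rightarrow> 'a poly \<Rightarrow> nat \<Rightarrow> nat \<Rightarrow> 'a" where
  "bez_coeff A B 0 q = coeff B 0 * coeff A (Suc q) - coeff A 0 * coeff B (Suc q)"
| "bez_coeff A B (Suc p) q = bez_coeff A B p (Suc q) + coeff B (Suc p) * coeff A (Suc q) - coeff A (Suc p) *
    coeff B (Suc q)"

lemma bez_coeff_sum:
  "bez_coeff A B p q = (\<Sum>i\<le>p. coeff B i * coeff A (Suc (p + q) - i) - coeff A i * coeff B (Suc (p + q) - i))"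
proof (induction p arbitrary: q)
  case (Suc p)
  show ?case by (simp add: Suc.IH)
qed simp

text \<open>Both sides are sums of the antisymmetric \<open>w\<close> along the antidiagonal i + j =
  p + q + 1. The two ranges are complementary after reflection, and the sum over the whole
  antidiagonal is 0.\<close>

lemma bez_coeff_commute: "bez_coeff A B p q = bez_coeff A B q p"
proof -
  define w where "w i j = coeff B i * coeff A j - coeff A i * coeff B j" for i j
  have w: "w i j = - w j i" for i j by (simp add: w_def mult.commute)
  let ?s = "Suc (p + q)"
  have "bez_coeff A B p q = (\<Sum>i\<in>{..<Suc p}. w i (?s - i))"
    unfolding bez_coeff_sum w_def lessThan_Suc_atMost ..
  moreover have "bez_coeff A B q p = (\<Sum>j\<in>{..<Suc q}. w j (?s - j))"
    unfolding bez_coeff_sum w_def lessThan_Suc_atMost by (simp add: add.commute)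
  moreover have "(\<Sum>j\<in>{..<Suc q}. w j (?s - j)) = (\<Sum>i\<in>{Suc p..<Suc ?s}. w (?s - i) i)"
    by (rule sum.reindex_bij_witness[of _ "\<lambda>i. ?s - i" "\<lambda>j. ?s - j"]) auto
  moreover have "\<dots> = - (\<Sum>i\<in>{Suc p..<Suc ?s}. w i (?s - i))"
    unfolding sum_negf[symmetric] by (rule sum.cong) (auto intro: w)
  moreover have "(\<Sum>i\<in>{..<Suc p}. w i (?s - i)) + (\<Sum>i\<in>{Suc p..<Suc ?s}. w i (?s - i)) = (\<Sum>i\<in>{..<Suc ?s}. w i (?s - i))"
  proof -
    have "{..<Suc ?s} = {..<Suc p} \<union> {Suc p..<Suc ?s}" by auto
    then show ?thesis by (metis (no_types, lifting) ivl_disj_int_one(2) sum.union_disjoint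
          finite_lessThan finite_atLeastLessThan)
  qed
  \<comment> \<open>Antisymmetry alone would give only that the sum equals its negative, which is
    not enough in characteristic 2. The two halves of \<open>w\<close> are therefore compared
    directly.\<close>
  moreover have "(\<Sum>i\<in>{..<Suc ?s}. w i (?s - i)) = 0"
  proof -
    have "(\<Sum>i\<in>{..<Suc ?s}. w i (?s - i)) = (\<Sum>i\<in>{..<Suc ?s}. coeff B i * coeff A (?s - i))
        - (\<Sum>i\<in>{..<Suc ?s}. coeff A i * coeff B (?s - i))"
      by (simp add: w_def sum_subtractf)
    also have "(\<Sum>i\<in>{..<Suc ?s}. coeff A i * coeff B (?s - i)) = (\<Sum>i\<in>{..<Suc ?s}. coeff B i * coeff A (?s - i))"
      by (rule sum.reindex_bij_witness[of _ "\<lambda>i. ?s - i" "\<lambda>i. ?s - i"]) (auto simp: mult.commute)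
    finally show ?thesis by simp
  qed
  ultimately show ?thesis by (metis eq_neg_iff_add_eq_0)
qed

lemma bez_coeff_eq_0:
  assumes "degree A \<le> n" "degree B \<le> n" "n \<le> p \<or> n \<le> q"
  shows "bez_coeff A B p q = 0"
proof -
  have *: "bez_coeff A B p q = 0" if "n \<le> q" for p q
  proof -
    have "degree A < Suc (p + q) - i" "degree B < Suc (p + q) - i" if "i \<le> p" for i
      using that \<open>n \<le> q\<close> assms by auto
    then show ?thesis unfolding bez_coeff_sum by (intro sum.neutral) (auto simp: coeff_eq_0)
  qed
  show ?thesis using assms(3) * bez_coeff_commute by metis
qed

definition bez_mat :: "nat \<Rightarrow> 'a::comm_ring_1 poly \<Rightarrow> 'a poly \<Rightarrow> 'a mat" where
  "bez_mat n A B = mat n n (\<lambda>(p, q). bez_coeff A B p q)"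

text \<open>The polynomial with the recursive coefficients, multiplied by X - Y, is the numerator;
  hence the division is exact.\<close>

lemma coeff_bez_quot: "coeff (coeff (bez_quot A B) p) q = bez_coeff A B p (q :: nat)"
proof -
  define n where "n = max (degree A) (degree B)"
  have dn: "degree A \<le> n" "degree B \<le> n" by (auto simp: n_def)
  define \<beta> where "\<beta> = (\<Sum>p<n. monom (\<Sum>q<n. monom (bez_coeff A B p q) q) p)"
  have inner: "coeff (\<Sum>q<n. monom (bez_coeff A B p q) q) q = bez_coeff A B p q" for p q
    using bez_coeff_eq_0[OF dn, of p q] by (simp add: coeff_sum)
  have \<beta>: "coeff (coeff \<beta> p) q = bez_coeff A B p q" for p q
  proof -
    have "coeff \<beta> p = (if p < n then \<Sum>q<n. monom (bez_coeff A B p q) q else 0)"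
      unfolding \<beta>_def by (simp add: coeff_sum)
    then show ?thesis using inner bez_coeff_eq_0[OF dn, of p q] by simp
  qed
  have "\<beta> * [: - [:0, 1:], 1 :] = map_poly (\<lambda>a. [:a:]) A * [:B:] - map_poly (\<lambda>a. [:a:]) B * [:A:]"
  proof (intro poly_eqI)
    fix p q
    have "coeff (coeff (\<beta> * [: - [:0, 1:], 1 :]) p) q =
        (case p of 0 \<Rightarrow> 0 | Suc p' \<Rightarrow> bez_coeff A B p' q) - (case q of 0 \<Rightarrow> 0 | Suc q' \<Rightarrow> bez_coeff A B p q')"
      by (cases p; cases q) (simp_all add: coeff_pCons \<beta>)
    also have "\<dots> = coeff A p * coeff B q - coeff B p * coeff A q"
      by (cases p; cases q) (auto simp: bez_coeff_commute[of A B _ 0])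
    also have "\<dots> = coeff (coeff (map_poly (\<lambda>a. [:a:]) A * [:B:] - map_poly (\<lambda>a. [:a:]) B * [:A:]) p) q"
      by (simp add: coeff_map_poly mult.commute)
    finally show "coeff (coeff (\<beta> * [: - [:0, 1:], 1 :]) p) q =
      coeff (coeff (map_poly (\<lambda>a. [:a:]) A * [:B:] - map_poly (\<lambda>a. [:a:]) B * [:A:]) p) q" .
  qed
  note eq = this
  have "bez_quot A B = \<beta>" unfolding bez_quot_def eq[symmetric]
    by (rule nonzero_mult_div_cancel_right) simp
  then show ?thesis using \<beta> by simp
qed

lemma bez_eq: "bez n A B = bez_mat n A B"
  unfolding bez_def bez_mat_def coeff_bez_quot ..

lemma bez_mat_carrier [simp]: "bez_mat n A B \<in> carrier_mat n n"
  by (simp add: bez_mat_def)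

lemma transpose_bez_mat: "(bez_mat n A B)\<^sup>T = bez_mat n A B"
  by (rule eq_matI) (auto simp: bez_mat_def bez_coeff_commute)

lemma bez_coeff_swap: "bez_coeff B A p q = - bez_coeff A B p q"
  by (induction p arbitrary: q) auto

section \<open>The resultant as a solvability condition\<close>

text \<open>The space of polynomials with \<open>n\<close> coefficients. Unlike a strict bound on
  \<open>degree\<close>, it contains the zero polynomial also for \<open>n = 0\<close>.\<close>

definition deg_lt :: "nat \<Rightarrow> 'a::zero poly \<Rightarrow> bool" where
  "deg_lt n p \<longleftrightarrow> (\<forall>i\<ge>n. coeff p i = 0)"

lemma deg_lt_0 [simp]: "deg_lt n 0" by (simp add: deg_lt_def)

lemma deg_lt_add: "deg_lt n p \<Longrightarrow> deg_lt n q \<Longrightarrow> deg_lt n (p + q)" by (simp add: deg_lt_def)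

lemma deg_lt_degree: "deg_lt (Suc n) p \<longleftrightarrow> degree p \<le> n"
  unfolding deg_lt_def using degree_le[of n p] coeff_eq_0[of p] by (auto simp: Suc_le_eq)

lemma deg_lt_mult:
  fixes p q :: "'a::comm_semiring_0 poly"
  assumes "deg_lt n p" "degree q \<le> m"
  shows "deg_lt (n + m) (p * q)"
proof (cases n)
  case 0
  then have "p = 0" using assms(1) by (intro poly_eqI) (simp add: deg_lt_def)
  then show ?thesis by simp
next
  case (Suc k)
  then have "degree p \<le> k" using assms(1) deg_lt_degree by blast
  then have "degree (p * q) \<le> k + m" using degree_mult_le[of p q] assms(2) by linarith
  then show ?thesis unfolding Suc by (simp add: deg_lt_degree)
qed

text \<open>Coefficients are listed from the highest monomial down, matching the order of the rows
  X^(n-1-i) A and X^(n-1-i) B of the Sylvester matrix.\<close>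

definition syl_vec :: "nat \<Rightarrow> 'a::zero poly \<Rightarrow> 'a poly \<Rightarrow> 'a vec" where
  "syl_vec n U V = vec (n + n) (\<lambda>i. if i < n then coeff U (n - 1 - i) else coeff V (2 * n - 1 - i))"

text \<open>Column \<open>j\<close> of the Sylvester matrix belongs to the monomial \<open>X^(2n-1-j)\<close>.\<close>

lemma syl_vec_mult:
  fixes A B :: "'a::comm_ring_1 poly"
  assumes "degree A \<le> n" "degree B \<le> n" "deg_lt n U" "deg_lt n V" "j < n + n"
  shows "((sylvester_mat_sub n n A B)\<^sup>T *\<^sub>v syl_vec n U V) $ j = coeff (U * A + V * B) (2 * n - 1 - j)"
proof -
  define m where "m = 2 * n - 1 - j"
  have co: "coeff (U * A) m = (\<Sum>k<n. coeff U k * (if k \<le> m then coeff A (m - k) else 0))"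
    if "deg_lt n U" for U A :: "'a poly"
  proof -
    have "coeff (U * A) m = (\<Sum>k\<in>{..m}. coeff U k * coeff A (m - k))" by (simp add: coeff_mult)
    also have "\<dots> = (\<Sum>k\<in>{..m} \<union> {..<n}. coeff U k * (if k \<le> m then coeff A (m - k) else 0))"
      by (rule sum.mono_neutral_cong_left) auto
    also have "\<dots> = (\<Sum>k<n. coeff U k * (if k \<le> m then coeff A (m - k) else 0))"
      using that by (intro sum.mono_neutral_right) (auto simp: deg_lt_def)
    finally show ?thesis .
  qed
  have SA: "sylvester_mat_sub n n A B $$ (i, j) = (if n - 1 - i \<le> m then coeff A (m - (n - 1 - i)) else 0)"
    if "i < n" for i
  proof -
    have 1: "coeff A (n + i - j) = 0" if "j < i" using assms(1) that by (intro coeff_eq_0) auto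
    have 2: "n - 1 - i \<le> m \<longleftrightarrow> j \<le> n + i" "m - (n - 1 - i) = n + i - j"
      using that assms(5) by (auto simp: m_def)
    show ?thesis unfolding 2 using that assms(5) 1 by (auto simp: sylvester_mat_sub_index)
  qed
  have SB: "sylvester_mat_sub n n A B $$ (n + i, j) = (if n - 1 - i \<le> m then coeff B (m - (n - 1 - i)) else 0)"
    if "i < n" for i
  proof -
    have 1: "coeff B (n + i - j) = 0" if "j < i" using assms(2) that by (intro coeff_eq_0) auto
    have 2: "n - 1 - i \<le> m \<longleftrightarrow> j \<le> n + i" "m - (n - 1 - i) = n + i - j"
      using that assms(5) by (auto simp: m_def)
    show ?thesis unfolding 2 using that assms(5) 1 by (auto simp: sylvester_mat_sub_index)
  qed
  have "((sylvester_mat_sub n n A B)\<^sup>T *\<^sub>v syl_vec n U V) $ j =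
      (\<Sum>i<n+n. sylvester_mat_sub n n A B $$ (i, j) * syl_vec n U V $ i)"
    using assms(5) by (auto simp: scalar_prod_def atLeast0LessThan syl_vec_def)
  also have "\<dots> = (\<Sum>i<n. sylvester_mat_sub n n A B $$ (i, j) * syl_vec n U V $ i) +
      (\<Sum>i<n. sylvester_mat_sub n n A B $$ (n + i, j) * syl_vec n U V $ (n + i))"
  proof -
    have *: "(\<Sum>i<n+n. f i) = (\<Sum>i<n. f i) + (\<Sum>i<n. f (n + i))" for f :: "nat \<Rightarrow> 'a"
    proof -
      have "(\<Sum>i<n+n. f i) = sum f {0..<n} + sum f {n..<n + n}"
        by (simp add: atLeast0LessThan[symmetric] sum.atLeastLessThan_concat)
      also have "sum f {n..<n + n} = (\<Sum>i\<in>{0..<n}. f (n + i))"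
        using sum.shift_bounds_nat_ivl[of f 0 n n] by (simp add: add.commute)
      finally show ?thesis by (simp add: atLeast0LessThan)
    qed
    show ?thesis by (rule *)
  qed
  also have "(\<Sum>i<n. sylvester_mat_sub n n A B $$ (i, j) * syl_vec n U V $ i) =
      (\<Sum>k<n. coeff U k * (if k \<le> m then coeff A (m - k) else 0))"
    by (rule sum.reindex_bij_witness[of _ "\<lambda>k. n - 1 - k" "\<lambda>i. n - 1 - i"])
      (auto simp: SA syl_vec_def)
  also have "(\<Sum>i<n. sylvester_mat_sub n n A B $$ (n + i, j) * syl_vec n U V $ (n + i)) =
      (\<Sum>k<n. coeff V k * (if k \<le> m then coeff B (m - k) else 0))"
  proof (rule sum.reindex_bij_witness[of _ "\<lambda>k. n - 1 - k" "\<lambda>i. n - 1 - i"])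
    fix i assume "i \<in> {..<n}"
    then have i: "i < n" by simp
    have "2 * n - 1 - (n + i) = n - 1 - i" by simp
    then show "coeff V (n - 1 - i) * (if n - 1 - i \<le> m then coeff B (m - (n - 1 - i)) else 0) =
         sylvester_mat_sub n n A B $$ (n + i, j) * syl_vec n U V $ (n + i)"
      using i unfolding SB[OF i] by (simp add: syl_vec_def)
  qed auto
  finally show ?thesis unfolding m_def[symmetric] using co assms(3,4) by simp
qed

lemma deg_lt_combination:
  fixes A B :: "'a::comm_ring_1 poly"
  assumes "degree A \<le> n" "degree B \<le> n" "deg_lt n U" "deg_lt n V"
  shows "deg_lt (n + n) (U * A + V * B)"
  using assms by (intro deg_lt_add deg_lt_mult)

lemma diff_eq_diff_iff_nat: "i \<le> N \<Longrightarrow> j \<le> N \<Longrightarrow> N - j = N - i \<longleftrightarrow> i = (j::nat)"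
  by arith

text \<open>The transposed Sylvester matrix is the matrix of (U, V) \<mapsto> U A + V B, and over a
  commutative ring surjectivity already makes its determinant a unit. In this form, elementary
  operations on (A, B) can be checked without determinants.\<close>

lemma resultant_sub_unit_iff:
  fixes A B :: "'a::idom poly"
  assumes d: "degree A \<le> n" "degree B \<le> n"
  shows "resultant_sub n n A B dvd 1 \<longleftrightarrow>
    (\<forall>F. deg_lt (n + n) F \<longrightarrow> (\<exists>U V. deg_lt n U \<and> deg_lt n V \<and> U * A + V * B = F))"
proof
  let ?S = "sylvester_mat_sub n n A B"
  have S: "?S \<in> carrier_mat (n + n) (n + n)" by (rule sylvester_mat_sub_carrier)
  assume "resultant_sub n n A B dvd 1"
  then have "det ?S\<^sup>T dvd 1" unfolding resultant_sub_def using det_transpose[OF S] by simp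
  then obtain W where W: "W \<in> carrier_mat (n + n) (n + n)" "?S\<^sup>T * W = 1\<^sub>m (n + n)"
    using unit_det_inverse[of "?S\<^sup>T" "n + n"] S by auto
  show "\<forall>F. deg_lt (n + n) F \<longrightarrow> (\<exists>U V. deg_lt n U \<and> deg_lt n V \<and> U * A + V * B = F)"
  proof (intro allI impI)
    fix F :: "'a poly" assume F: "deg_lt (n + n) F"
    define f where "f = vec (n + n) (\<lambda>j. coeff F (2 * n - 1 - j))"
    define w where "w = W *\<^sub>v f"
    have w: "w \<in> carrier_vec (n + n)" unfolding w_def f_def using W by simp
    have Sw: "?S\<^sup>T *\<^sub>v w = f" unfolding w_def
      using assoc_mult_mat_vec[of "?S\<^sup>T" "n+n" "n+n" W "n+n" f] S W by (simp add: f_def)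
    define U where "U = (\<Sum>k<n. monom (w $ (n - 1 - k)) k)"
    define V where "V = (\<Sum>k<n. monom (w $ (2 * n - 1 - k)) k)"
    have cU: "coeff U k = (if k < n then w $ (n - 1 - k) else 0)" for k unfolding U_def by (simp add: coeff_sum)
    have cV: "coeff V k = (if k < n then w $ (2 * n - 1 - k) else 0)" for k unfolding V_def by (simp add: coeff_sum)
    have UV: "deg_lt n U" "deg_lt n V" by (auto simp: deg_lt_def cU cV)
    have "syl_vec n U V = w" using w by (intro eq_vecI) (auto simp: syl_vec_def cU cV)
    then have e: "coeff (U * A + V * B) (2 * n - 1 - j) = coeff F (2 * n - 1 - j)" if "j < n + n" for j
      using syl_vec_mult[OF d UV that] Sw that by (simp add: f_def)
    have "U * A + V * B = F"
    proof (rule poly_eqI)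
      fix i
      show "coeff (U * A + V * B) i = coeff F i"
      proof (cases "i < n + n")
        case True
        then show ?thesis using e[of "2 * n - 1 - i"] by simp
      next
        case False
        then show ?thesis using F deg_lt_combination[OF d UV] unfolding deg_lt_def by simp
      qed
    qed
    then show "\<exists>U V. deg_lt n U \<and> deg_lt n V \<and> U * A + V * B = F" using UV by blast
  qed
next
  let ?S = "sylvester_mat_sub n n A B"
  have S: "?S \<in> carrier_mat (n + n) (n + n)" by (rule sylvester_mat_sub_carrier)
  assume *: "\<forall>F. deg_lt (n + n) F \<longrightarrow> (\<exists>U V. deg_lt n U \<and> deg_lt n V \<and> U * A + V * B = F)"
  have "\<exists>x. i < n + n \<longrightarrow> deg_lt n (fst x) \<and> deg_lt n (snd x) \<and>
      fst x * A + snd x * B = monom 1 (2 * n - 1 - i)" for i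
  proof (cases "i < n + n")
    case True
    then have "deg_lt (n + n) (monom (1::'a) (2 * n - 1 - i))" by (auto simp: deg_lt_def)
    from *[rule_format, OF this] obtain U V where
      "deg_lt n U" "deg_lt n V" "U * A + V * B = monom 1 (2 * n - 1 - i)" by (elim exE conjE)
    then show ?thesis by (intro exI[of _ "(U, V)"]) simp
  qed simp
  then have "\<exists>f. \<forall>i. i < n + n \<longrightarrow> deg_lt n (fst (f i)) \<and> deg_lt n (snd (f i)) \<and>
      fst (f i) * A + snd (f i) * B = monom 1 (2 * n - 1 - i)" by (intro choice allI)
  then obtain UV where *: "\<forall>i. i < n + n \<longrightarrow> deg_lt n (fst (UV i)) \<and> deg_lt n (snd (UV i)) \<and>
      fst (UV i) * A + snd (UV i) * B = monom 1 (2 * n - 1 - i)" by (elim exE)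
  define U where "U i = fst (UV i)" for i
  define V where "V i = snd (UV i)" for i
  have UV: "\<And>i. i < n + n \<Longrightarrow> deg_lt n (U i)" "\<And>i. i < n + n \<Longrightarrow> deg_lt n (V i)"
    "\<And>i. i < n + n \<Longrightarrow> U i * A + V i * B = monom 1 (2 * n - 1 - i)" using * by (simp_all add: U_def V_def)
  define W where "W = mat (n + n) (n + n) (\<lambda>(i, j). syl_vec n (U j) (V j) $ i)"
  have W: "W \<in> carrier_mat (n + n) (n + n)" by (simp add: W_def)
  have "?S\<^sup>T * W = 1\<^sub>m (n + n)"
  proof (rule eq_matI)
    fix i j assume "i < dim_row (1\<^sub>m (n + n))" "j < dim_col (1\<^sub>m (n + n))"
    then have ij: "i < n + n" "j < n + n" by auto
    have "col W j = syl_vec n (U j) (V j)" using ij by (intro eq_vecI) (auto simp: W_def syl_vec_def)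
    then have 1: "(?S\<^sup>T * W) $$ (i, j) = (?S\<^sup>T *\<^sub>v syl_vec n (U j) (V j)) $ i"
      using ij S W by simp
    have 2: "2 * n - 1 - j = 2 * n - 1 - i \<longleftrightarrow> i = j"
      by (rule diff_eq_diff_iff_nat) (use ij in auto)
    show "(?S\<^sup>T * W) $$ (i, j) = 1\<^sub>m (n + n) $$ (i, j)"
      unfolding 1 syl_vec_mult[OF d UV(1,2)[OF ij(2)] ij(1)] UV(3)[OF ij(2)] coeff_monom 2 using ij by simp
  qed (use S W in auto)
  then have "det ?S\<^sup>T * det W = 1" using det_mult[of "?S\<^sup>T" "n+n" W] S W by simp
  then have "1 = det ?S * det W" unfolding det_transpose[OF S] ..
  then show "resultant_sub n n A B dvd 1" unfolding resultant_sub_def by (rule dvdI)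
qed

section \<open>The resultant and the determinant of the Bezout form\<close>

text \<open>Each row of the Bezout form is thus an explicit combination of \<open>A\<close> and
  \<open>B\<close>, which links it to the row space of the Sylvester matrix.\<close>

lemma coeff_bez_coeff_combination:
  "coeff (poly_shift (Suc q) A * B - poly_shift (Suc q) B * A) p = bez_coeff A B p q"
proof -
  have *: "coeff (poly_shift (Suc q) A * B) p = (\<Sum>i\<le>p. coeff B i * coeff A (Suc (p + q) - i))" for A B :: "'a poly"
  proof -
    have "coeff (B * poly_shift (Suc q) A) p = (\<Sum>i\<le>p. coeff B i * coeff A (Suc (p + q) - i))"
      unfolding coeff_mult by (intro sum.cong refl) (auto simp: coeff_poly_shift Suc_diff_le)
    then show ?thesis by (simp add: mult.commute)
  qed
  show ?thesis unfolding coeff_diff * bez_coeff_sum sum_subtractf ..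
qed

lemma det_upper_triangular_nonzero:
  fixes T :: "'a::idom mat"
  assumes "T \<in> carrier_mat n n" "\<And>i j. i < n \<Longrightarrow> j < i \<Longrightarrow> T $$ (i, j) = 0" "\<And>i. i < n \<Longrightarrow> T $$ (i, i) \<noteq> 0"
  shows "det T \<noteq> 0"
proof -
  have "upper_triangular T" using assms(1,2) by (auto simp: upper_triangular_def)
  then have "det T = prod_list (diag_mat T)" by (rule det_upper_triangular[OF _ assms(1)])
  then show ?thesis using assms(1,3) by (auto simp: diag_mat_def prod_list_zero_iff)
qed

text \<open>Multiply the Sylvester matrix by the matrix whose rows are the coefficient vectors of the pairs
  \<open>(X^i, 0)\<close> and \<open>(- B_{>q}, A_{>q})\<close>, where \<open>A_{>q}\<close> is \<open>A\<close> divided by \<open>X^(q+1)\<close>.\<close>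

lemma det_sylvester_bez:
  fixes A B :: "'a::idom poly"
  assumes d: "degree A \<le> n" "degree B \<le> n" and an: "coeff A n \<noteq> 0"
  shows "resultant_sub n n A B = det (mat n n (\<lambda>(q, m). bez_coeff A B (n - 1 - m) q))"
proof -
  let ?S = "sylvester_mat_sub n n A B"
  have S: "?S \<in> carrier_mat (n + n) (n + n)" by (rule sylvester_mat_sub_carrier)
  define U where "U r = (if r < n then monom 1 (n - 1 - r) else - poly_shift (Suc (r - n)) B)" for r
  define V where "V r = (if r < n then 0 else poly_shift (Suc (r - n)) A)" for r
  have UV: "deg_lt n (U r)" "deg_lt n (V r)" if "r < n + n" for r
    using that d by (auto simp: U_def V_def deg_lt_def coeff_poly_shift coeff_eq_0)
  define Q where "Q = mat (n + n) (n + n) (\<lambda>(r, l). syl_vec n (U r) (V r) $ l)"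
  have Q: "Q \<in> carrier_mat (n + n) (n + n)" by (simp add: Q_def)
  define T where "T = mat n n (\<lambda>(i, j). coeff A (n + i - j))"
  have T: "T \<in> carrier_mat n n" by (simp add: T_def)
  have dT: "det T \<noteq> 0"
    by (rule det_upper_triangular_nonzero[OF T]) (use d an in \<open>auto simp: T_def coeff_eq_0\<close>)
  define X where "X = mat n n (\<lambda>(i, j). Q $$ (n + i, j))"
  define B' where "B' = mat n n (\<lambda>(q, m). bez_coeff A B (n - 1 - m) q)"
  have "Q = four_block_mat (1\<^sub>m n) (0\<^sub>m n n) X T"
  proof (rule eq_matI)
    fix r l assume "r < dim_row (four_block_mat (1\<^sub>m n) (0\<^sub>m n n) X T)"
        "l < dim_col (four_block_mat (1\<^sub>m n) (0\<^sub>m n n) X T)"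
    then have rl: "r < n + n" "l < n + n" by (auto simp: T_def)
    consider "r < n" "l < n" | "r < n" "n \<le> l" | "n \<le> r" "l < n" | "n \<le> r" "n \<le> l" by linarith
    then show "Q $$ (r, l) = four_block_mat (1\<^sub>m n) (0\<^sub>m n n) X T $$ (r, l)"
    proof cases
      case 1
      then have "n - Suc r = n - Suc l \<longleftrightarrow> r = l" by linarith
      then show ?thesis using 1 rl by (simp add: Q_def X_def T_def syl_vec_def U_def)
    next
      case 2
      then show ?thesis using rl by (simp add: Q_def X_def T_def syl_vec_def V_def)
    next
      case 3
      then show ?thesis using rl by (simp add: X_def T_def)
    next
      case 4
      have e: "Suc (2 * n - 1 - l + (r - n)) = r - n + n - (l - n)" using 4 rl by linarith
      show ?thesis using 4 rl e by (simp add: Q_def X_def T_def syl_vec_def V_def coeff_poly_shift add.commute)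
    qed
  qed (auto simp: Q_def T_def)
  then have dQ: "det Q = det T"
    using det_four_block_mat_upper_right_zero[of "1\<^sub>m n" n "0\<^sub>m n n" n X T] T by (simp add: X_def)
  have QS: "(Q * ?S) $$ (r, j) = coeff (U r * A + V r * B) (2 * n - 1 - j)" if "r < n + n" "j < n + n" for r j
  proof -
    have "row Q r = syl_vec n (U r) (V r)" using that by (intro eq_vecI) (auto simp: Q_def syl_vec_def)
    then have "(Q * ?S) $$ (r, j) = syl_vec n (U r) (V r) \<bullet> col ?S j" using that Q S by simp
    also have "\<dots> = col ?S j \<bullet> syl_vec n (U r) (V r)"
      by (intro comm_scalar_prod[of _ "n + n"] carrier_vecI) (simp_all add: syl_vec_def)
    also have "\<dots> = (?S\<^sup>T *\<^sub>v syl_vec n (U r) (V r)) $ j" using that S by simp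
    finally show ?thesis using syl_vec_mult[OF d UV[OF that(1)] that(2)] by simp
  qed
  have UVn: "coeff (U (n + q) * A + V (n + q) * B) p = bez_coeff A B p q" for q p
    using coeff_bez_coeff_combination[of q A B p] by (simp add: U_def V_def)
  define Y where "Y = mat n n (\<lambda>(i, j). (Q * ?S) $$ (i, n + j))"
  have "Q * ?S = four_block_mat T Y (0\<^sub>m n n) B'"
  proof (rule eq_matI)
    fix r j assume "r < dim_row (four_block_mat T Y (0\<^sub>m n n) B')" "j < dim_col (four_block_mat T Y (0\<^sub>m n n) B')"
    then have rj: "r < n + n" "j < n + n" by (auto simp: T_def B'_def)
    consider "r < n" "j < n" | "r < n" "n \<le> j" | q where "r = n + q" "q < n" "j < n"
      | q m where "r = n + q" "j = n + m" "q < n" "m < n"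
      using rj by (metis add_less_cancel_left le_Suc_ex not_le)
    then show "(Q * ?S) $$ (r, j) = four_block_mat T Y (0\<^sub>m n n) B' $$ (r, j)"
    proof cases
      case 1
      then have e: "n - Suc r \<le> 2 * n - Suc j" "2 * n - Suc j - (n - Suc r) = n + r - j" by linarith+
      show ?thesis unfolding QS[OF rj] using 1 rj e by (simp add: T_def B'_def U_def V_def coeff_monom_mult)
    next
      case 2
      then show ?thesis using rj by (simp add: T_def Y_def B'_def)
    next
      case (3 q)
      then have "bez_coeff A B (2 * n - 1 - j) q = 0" by (intro bez_coeff_eq_0[OF d]) linarith
      then show ?thesis unfolding QS[OF rj] using 3 unfolding 3(1) UVn by (simp add: T_def B'_def)
    next
      case (4 q m)
      have e: "2 * n - 1 - (n + m) = n - 1 - m" by linarith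
      show ?thesis unfolding QS[OF rj] using 4(3,4) unfolding 4(1,2) UVn e by (simp add: T_def B'_def)
    qed
  qed (auto simp: Q_def T_def B'_def)
  then have "det (Q * ?S) = det T * det B'"
    using det_four_block_mat_lower_left_zero[of T n Y n "0\<^sub>m n n" B'] T by (simp add: Y_def B'_def)
  \<comment> \<open>\<open>det T\<close> occurs twice: as the determinant of the multiplier
    \<open>Q\<close>, and as that of the top block of the product. Its diagonal entries are the
    leading coefficient of \<open>A\<close>, so it cancels.\<close>
  then have "det T * det ?S = det T * det B'" using det_mult[OF Q S] dQ by simp
  then show ?thesis using dT unfolding resultant_sub_def B'_def by simp
qed

text \<open>The matrix in \<open>det_sylvester_bez\<close> is the Bezout matrix with its columns
  reversed. Since only divisibility matters, the sign of the reversal is never computed.\<close>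

lemma det_bez_mat_dvd_1:
  fixes A B :: "'a::idom poly"
  assumes d: "degree A \<le> n" "degree B \<le> n" and an: "coeff A n \<noteq> 0" and r: "resultant_sub n n A B dvd 1"
  shows "det (bez_mat n A B) dvd 1"
proof -
  define J :: "'a mat" where "J = mat n n (\<lambda>(i, j). if i = n - 1 - j then 1 else 0)"
  have J: "J \<in> carrier_mat n n" by (simp add: J_def)
  have "mat n n (\<lambda>(q, m). bez_coeff A B (n - 1 - m) q) = bez_mat n A B * J"
  proof (rule eq_matI)
    fix i j assume "i < dim_row (bez_mat n A B * J)" "j < dim_col (bez_mat n A B * J)"
    then have ij: "i < n" "j < n" by (auto simp: bez_mat_def J_def)
    have "(bez_mat n A B * J) $$ (i, j) = (\<Sum>k<n. bez_coeff A B i k * (if k = n - 1 - j then 1 else 0))"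
      using ij by (simp add: bez_mat_def J_def scalar_prod_def atLeast0LessThan)
    also have "\<dots> = (\<Sum>k<n. if k = n - 1 - j then bez_coeff A B i k else 0)" by (rule sum.cong) auto
    also have "\<dots> = bez_coeff A B (n - 1 - j) i" using ij by (simp add: bez_coeff_commute[of A B i])
    finally show "mat n n (\<lambda>(q, m). bez_coeff A B (n - 1 - m) q) $$ (i, j) = (bez_mat n A B * J) $$ (i, j)"
        using ij by simp
  qed (auto simp: bez_mat_def J_def)
  then have "det (bez_mat n A B) * det J dvd 1"
    using r unfolding det_sylvester_bez[OF d an] by (simp add: det_mult[OF bez_mat_carrier J])
  then show ?thesis by (rule dvd_mult_left)
qed

lemma inU_iff:
  fixes A B :: "'a::idom poly"
  shows "inU n (A, B) \<longleftrightarrow> degree A \<le> n \<and> degree B \<le> n \<and>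
    (\<forall>F. deg_lt (n + n) F \<longrightarrow> (\<exists>U V. deg_lt n U \<and> deg_lt n V \<and> U * A + V * B = F))"
  unfolding inU_def using resultant_sub_unit_iff[of A n B] by auto

lemma inU_solve:
  fixes A B :: "'a::idom poly"
  assumes "inU n (A, B)" "deg_lt (n + n) F"
  obtains U V where "deg_lt n U" "deg_lt n V" "U * A + V * B = F"
  using assms unfolding inU_iff by (elim conjE allE[of _ F] impE exE) simp_all

text \<open>If both formal leading coefficients vanished, no combination U A + V B could reach the
  monomial X^(2n-1).\<close>

lemma inU_leading_coeff:
  fixes A B :: "'a::idom poly"
  assumes "inU n (A, B)" "n \<ge> 1"
  shows "coeff A n \<noteq> 0 \<or> coeff B n \<noteq> 0"
proof (rule ccontr)
  assume "\<not> ?thesis"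
  then have c: "coeff A n = 0" "coeff B n = 0" by simp_all
  obtain m where m: "n = Suc m" using assms(2) by (cases n) auto
  have d: "degree A \<le> n" "degree B \<le> n" using assms(1) by (auto simp: inU_def)
  have dm: "degree A \<le> m" "degree B \<le> m" using degree_le_pred[OF d(1) c(1)] degree_le_pred[OF d(2) c(2)] m
    by simp_all
  have "deg_lt (n + n) (monom (1::'a) (n + m))" unfolding deg_lt_def m coeff_monom by simp
  from inU_solve[OF assms(1) this] obtain U V where
    UV: "deg_lt n U" "deg_lt n V" "U * A + V * B = monom 1 (n + m)" .
  have "deg_lt (n + m) (U * A + V * B)" using UV dm by (intro deg_lt_add deg_lt_mult)
  then have "coeff (monom (1::'a) (n + m)) (n + m) = 0" unfolding UV(3) deg_lt_def by blast
  then show False by simp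
qed

lemma inU_swap: "inU n (A, B) \<Longrightarrow> inU n (B, A :: 'a::idom poly)"
  unfolding inU_iff by (metis add.commute)

text \<open>Comparison with the resultant requires a nonzero coefficient of \<open>A\<close> in
  degree \<open>n\<close>. If it vanishes, \<open>A\<close> and \<open>B\<close> are exchanged,
  which only changes the sign of the form.\<close>

lemma inU_det_bez_mat:
  fixes A B :: "'a::idom poly"
  assumes "inU n (A, B)"
  shows "det (bez_mat n A B) dvd 1"
proof -
  have d: "degree A \<le> n" "degree B \<le> n" using assms by (auto simp: inU_def)
  consider "coeff A n \<noteq> 0" | "coeff B n \<noteq> 0" | "n = 0" using inU_leading_coeff[OF assms] by force
  then show ?thesis
  proof cases
    case 1
    then show ?thesis using det_bez_mat_dvd_1[OF d 1] assms by (auto simp: inU_def)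
  next
    case 2
    have "det (bez_mat n B A) dvd 1"
      using det_bez_mat_dvd_1[OF d(2,1) 2] inU_swap[OF assms] by (auto simp: inU_def)
    moreover have "bez_mat n B A = (-1) \<cdot>\<^sub>m bez_mat n A B"
        by (rule eq_matI) (auto simp: bez_mat_def bez_coeff_swap[of B A])
    ultimately have "(-1) ^ n * det (bez_mat n A B) dvd 1" by (simp add: bez_mat_def)
    then show ?thesis by (rule dvd_mult_right)
  next
    case 3
    then show ?thesis using det_dim_zero[OF bez_mat_carrier[of 0]] by simp
  qed
qed

section \<open>Pointed rational functions\<close>

abbreviation evp :: "'a::comm_ring_1 \<Rightarrow> 'a poly poly \<Rightarrow> 'a poly" where
  "evp t \<equiv> map_poly (\<lambda>c. poly c t)"

abbreviation cst :: "'a::comm_ring_1 poly \<Rightarrow> 'a poly poly" where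
  "cst \<equiv> map_poly (\<lambda>c. [:c:])"

interpretation evp_hom: map_poly_comm_ring_hom "\<lambda>c. poly c t" for t :: "'a::comm_ring_1" ..

interpretation cst_hom: map_poly_comm_ring_hom "\<lambda>c::'a::comm_ring_1. [:c:]" ..

lemma evp_cst [simp]: "evp t (cst A) = A"
  by (rule poly_eqI) (simp add: coeff_map_poly)

lemma coeff_evp [simp]: "coeff (evp t A) i = poly (coeff A i) t"
  by (simp add: coeff_map_poly)

lemma coeff_cst [simp]: "coeff (cst A) i = [:coeff A i:]"
  by (simp add: coeff_map_poly)

lemma evp_pCons [simp]: "evp t (pCons a p) = pCons (poly a t) (evp t p)"
  by (rule poly_eqI) (simp add: coeff_pCons split: nat.splits)

lemma evp_smult [simp]: "evp t (smult a p) = smult (poly a t) (evp t p)"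
  by (rule poly_eqI) simp

lemma evp_monom [simp]: "evp t (monom a n) = monom (poly a t) n"
  by (rule poly_eqI) simp

lemma ev_hom_Pair [simp]: "ev_hom t (A, B) = (evp t A, evp t B)"
  by (simp add: ev_hom_def)

lemma degree_eqI: "coeff p n \<noteq> 0 \<Longrightarrow> deg_lt (Suc n) p \<Longrightarrow> degree p = n"
  using deg_lt_degree le_degree by (metis le_antisym)

text \<open>Functions sending infinity to infinity, normalised to a monic numerator. Coprimality is
  a Bezout identity with unrestricted cofactors, which is visibly stable under matrices of
  determinant 1 and under specialisation.\<close>

definition pointed :: "nat \<Rightarrow> 'a::idom poly \<times> 'a poly \<Rightarrow> bool" where
  "pointed n AB \<longleftrightarrow> coeff (fst AB) n = 1 \<and> deg_lt (Suc n) (fst AB) \<and> deg_lt n (snd AB) \<and>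
     (\<exists>U V. U * fst AB + V * snd AB = 1)"

lemma deg_lt_mono: "deg_lt n p \<Longrightarrow> n \<le> m \<Longrightarrow> deg_lt m p"
  by (simp add: deg_lt_def)

lemma deg_lt_le: "deg_lt n p \<Longrightarrow> degree p \<le> n"
  using deg_lt_degree deg_lt_mono[of n p "Suc n"] by auto

lemma deg_lt_diff: "deg_lt n p \<Longrightarrow> deg_lt n q \<Longrightarrow> deg_lt n (p - q :: 'a::ab_group_add poly)"
  by (simp add: deg_lt_def)

lemma monic_division:
  fixes A P :: "'a::comm_ring_1 poly"
  assumes "coeff A n = 1" "deg_lt (Suc n) A" "deg_lt m P"
  shows "\<exists>Q R. P = Q * A + R \<and> deg_lt n R"
  using assms(3)
proof (induction m arbitrary: P)
  case 0
  then show ?case by (intro exI[of _ 0] exI[of _ P]) (simp add: deg_lt_def)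
next
  case (Suc m)
  show ?case
  proof (cases "m < n")
    case True
    then show ?thesis using Suc.prems by (intro exI[of _ 0] exI[of _ P]) (simp add: deg_lt_def)
  next
    case False
    define S where "S = monom (coeff P m) (m - n)"
    have "coeff (S * A) i = (if m - n \<le> i then coeff P m * coeff A (i - (m - n)) else 0)" for i
      unfolding S_def by (simp add: coeff_monom_mult)
    note cS = this
    have "deg_lt m (P - S * A)" unfolding deg_lt_def
    proof (intro allI impI)
      fix i assume i: "m \<le> i"
      show "coeff (P - S * A) i = 0"
      proof (cases "i = m")
        case True
        have "m - (m - n) = n" using False by simp
        then show ?thesis using True assms(1) by (simp add: cS)
      next
        case neq: False
        have "coeff A (i - (m - n)) = 0" using assms(2) i neq False by (simp add: deg_lt_def)
        moreover have "coeff P i = 0" using Suc.prems i neq by (simp add: deg_lt_def)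
        ultimately show ?thesis by (simp add: cS)
      qed
    qed
    from Suc.IH[OF this] obtain Q R where "P - S * A = Q * A + R" "deg_lt n R" by blast
    then have "P = (S + Q) * A + R" by (simp add: algebra_simps)
    then show ?thesis using \<open>deg_lt n R\<close> by blast
  qed
qed

text \<open>The cofactor of \<open>B\<close> matters only modulo \<open>A\<close>. Division by the
  monic \<open>A\<close> brings it below degree \<open>n\<close>, and the degree of \<open>F\<close>
  then bounds the other cofactor.\<close>

lemma pointed_inU:
  assumes "pointed n (A, B)"
  shows "inU n (A, B)"
proof -
  have A: "coeff A n = 1" "deg_lt (Suc n) A" and B: "deg_lt n B" using assms by (auto simp: pointed_def)
  obtain U V where UV: "U * A + V * B = 1" using assms unfolding pointed_def by auto
  have dA: "degree A = n" using degree_eqI[of A n] A by simp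
  have dB: "degree B \<le> n" using deg_lt_le[OF B] .
  have "\<exists>U V. deg_lt n U \<and> deg_lt n V \<and> U * A + V * B = F" if F: "deg_lt (n + n) F" for F
  proof -
    have "deg_lt (Suc (degree (V * F))) (V * F)" using deg_lt_degree by blast
    from monic_division[OF A this] obtain Q R where QR: "V * F = Q * A + R" "deg_lt n R" by blast
    define W where "W = U * F + Q * B"
    have "W * A + R * B = F * (U * A + V * B)"
      using QR(1) unfolding W_def by (simp add: algebra_simps)
    then have e: "W * A + R * B = F" using UV by simp
    then have "W * A = F - R * B" by (simp add: algebra_simps)
    moreover have "deg_lt (n + n) (F - R * B)" using F QR(2) dB by (intro deg_lt_diff deg_lt_mult)
    ultimately have WA: "deg_lt (n + n) (W * A)" by simp
    have "deg_lt n W"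
    proof (cases "W = 0")
      case False
      have "A \<noteq> 0" using A by auto
      then have "degree (W * A) = degree W + n" using False dA by (simp add: degree_mult_eq)
      moreover have "coeff (W * A) (degree (W * A)) \<noteq> 0" using False \<open>A \<noteq> 0\<close> by simp
      ultimately have "degree W < n" using WA unfolding deg_lt_def by (metis add_le_cancel_right not_le)
      then show ?thesis by (auto simp: deg_lt_def intro: coeff_eq_0)
    qed simp
    then show ?thesis using QR(2) e by blast
  qed
  then show ?thesis unfolding inU_iff using dA dB by blast
qed

text \<open>The first column (P, Q) of the acting matrix is itself a pointed function of degree
  \<open>d\<close>; this is the naive sum of P/Q and A/B, under which degrees add.\<close>

lemma pointed_act:
  assumes "pointed n (A, B)" and P: "coeff P d = 1" "deg_lt (Suc d) P"
    and QRS: "deg_lt d Q" "deg_lt d R" "deg_lt d S" and det: "P * S - Q * R = 1"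
  shows "pointed (n + d) (P * A + R * B, Q * A + S * B)"
proof -
  have A: "coeff A n = 1" "deg_lt (Suc n) A" and B: "deg_lt n B" using assms by (auto simp: pointed_def)
  obtain U V where UV: "U * A + V * B = 1" using assms unfolding pointed_def by auto
  have dA: "degree A = n" using degree_eqI[of A n] A by simp
  have dP: "degree P = d" using degree_eqI[of P d] P by simp
  have dB: "degree B \<le> n" using deg_lt_le[OF B] .
  have lt: "deg_lt (n + d) (R * B)" "deg_lt (n + d) (Q * A)" "deg_lt (n + d) (S * B)"
    using deg_lt_mult[OF QRS(2) dB] deg_lt_mult[OF QRS(1), of A n] deg_lt_mult[OF QRS(3) dB] dA
    by (auto simp: add.commute)
  have "coeff (P * A) (n + d) = coeff P d * coeff A n"
    using coeff_mult_degree_sum[of P A] dP dA by (simp add: add.commute)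
  then have c: "coeff (P * A + R * B) (n + d) = 1" using lt(1) A P by (simp add: deg_lt_def)
  have "deg_lt (Suc (n + d)) (P * A)" using deg_lt_mult[OF P(2), of A n] dA by (simp add: add.commute)
  then have m: "deg_lt (Suc (n + d)) (P * A + R * B)"
    using deg_lt_mono[OF lt(1), of "Suc (n + d)"] by (intro deg_lt_add) auto
  have "(U * S - V * Q) * (P * A + R * B) + (V * P - U * R) * (Q * A + S * B) =
      (P * S - Q * R) * (U * A + V * B)" by (simp add: algebra_simps)
  then have "(U * S - V * Q) * (P * A + R * B) + (V * P - U * R) * (Q * A + S * B) = 1"
    unfolding det UV by simp
  then show ?thesis unfolding pointed_def using c m lt(2,3) deg_lt_add by (metis fst_conv snd_conv)
qed

lemma pointed_ev:
  fixes A B :: "'a::field poly poly"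
  assumes "pointed n (A, B)"
  shows "pointed n (evp t A, evp t B)"
proof -
  obtain U V where "U * A + V * B = 1" using assms unfolding pointed_def by auto
  then have "evp t (U * A + V * B) = 1" by simp
  then have "evp t U * evp t A + evp t V * evp t B = 1" by (simp add: evp_hom.hom_add evp_hom.hom_mult)
  then show ?thesis using assms unfolding pointed_def by (auto simp: deg_lt_def)
qed

lemma pointed_cst:
  fixes A B :: "'a::field poly"
  assumes "pointed n (A, B)"
  shows "pointed n (cst A, cst B)"
proof -
  obtain U V where "U * A + V * B = 1" using assms unfolding pointed_def by auto
  then have "cst (U * A + V * B) = 1" by simp
  then have "cst U * cst A + cst V * cst B = 1" by (simp add: cst_hom.hom_add cst_hom.hom_mult)
  then show ?thesis using assms unfolding pointed_def by (auto simp: deg_lt_def pCons_one)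
qed

section \<open>Homotopies between pointed functions\<close>

text \<open>The paths consist of pointed functions because \<open>estep\<close> and
  \<open>gact\<close> act on these; \<open>phom_naive_rel\<close> forgets the base point
  later.\<close>

inductive phom :: "nat \<Rightarrow> 'a::field poly \<times> 'a poly \<Rightarrow> 'a poly \<times> 'a poly \<Rightarrow> bool" for n where
  phom_refl: "phom n x x"
| phom_path: "pointed n H \<Longrightarrow> phom n (ev_hom 0 H) (ev_hom 1 H)"
| phom_sym: "phom n x y \<Longrightarrow> phom n y x"
| phom_trans: "phom n x y \<Longrightarrow> phom n y z \<Longrightarrow> phom n x z"

lemma phom_pathI: "pointed n (A, B) \<Longrightarrow> phom n (evp 0 A, evp 0 B) (evp 1 A, evp 1 B)"
  using phom_path[of n "(A, B)"] by simp

text \<open>On fractions this is \<open>f \<mapsto> X/u - 1/(u^2 f)\<close>.\<close>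

definition estep :: "'a::field \<Rightarrow> 'a poly \<times> 'a poly \<Rightarrow> 'a poly \<times> 'a poly" where
  "estep u AB = ([:0, 1:] * fst AB + [:- inverse u:] * snd AB, [:u:] * fst AB + 0 * snd AB)"

lemma deg_lt_pCons: "deg_lt n p \<Longrightarrow> deg_lt (Suc n) (pCons a p)"
  by (auto simp: deg_lt_def coeff_pCons split: nat.splits)

lemma deg_lt_const [simp]: "deg_lt (Suc 0) [:a:]"
  by (simp add: deg_lt_pCons)

lemma deg_lt_one [simp]: "deg_lt (Suc 0) 1"
  by (simp add: deg_lt_def coeff_1)

lemma pointed_estep: "u \<noteq> 0 \<Longrightarrow> pointed n (A, B) \<Longrightarrow> pointed (Suc n) (estep u (A, B))"
  unfolding estep_def fst_conv snd_conv
  using pointed_act[of n A B "[:0, 1:]" 1 "[:u:]" "[:- inverse u:]" 0] by (simp add: deg_lt_pCons)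

lemma phom_estep:
  assumes "phom n x y" "u \<noteq> 0"
  shows "phom (Suc n) (estep u x) (estep u y)"
  using assms(1)
proof (induction rule: phom.induct)
  case (phom_path H)
  obtain A B where H: "H = (A, B)" by (cases H)
  let ?A = "[:0, 1:] * A + [:[:- inverse u:]:] * B" and ?B = "[:[:u:]:] * A + 0 * B"
  have "pointed (n + 1) (?A, ?B)"
    using phom_path assms(2) unfolding H by (intro pointed_act) (auto simp: deg_lt_pCons)
  then have "phom (Suc n) (evp 0 ?A, evp 0 ?B) (evp 1 ?A, evp 1 ?B)" by (intro phom_pathI) simp
  moreover have "(evp t ?A, evp t ?B) = estep u (ev_hom t H)" for t
    unfolding estep_def H by (simp add: evp_hom.hom_add)
  ultimately show ?case by simp
qed (auto intro: phom.intros)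

text \<open>For \<open>d = 1/(b^2 - a c)\<close> the acting matrix has determinant 1, and its first column is a pointed
  function of degree 2 with Bezout matrix \<open>[[a, b], [b, c]]\<close>. Since it is polynomial in \<open>a, b, c\<close>, paths of binary
  forms of constant determinant lift to homotopies.\<close>

definition gact :: "'a::comm_ring_1 \<Rightarrow> 'a \<Rightarrow> 'a \<Rightarrow> 'a \<Rightarrow> 'a poly \<times> 'a poly \<Rightarrow> 'a poly \<times> 'a poly" where
  "gact d a b c AB = ([:a * a * d, a * b * d, 1:] * fst AB + [:b * (a * c - (b * b - a * c)) * d * d, c * d:] *
      snd AB,
     [:b, c:] * fst AB + [:c * c * d:] * snd AB)"

lemma pointed_gact:
  fixes a b c d :: "'a::idom"
  assumes "pointed n (A, B)" "(b * b - a * c) * d = 1"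
  shows "pointed (n + 2) (gact d a b c (A, B))"
  unfolding gact_def fst_conv snd_conv
proof (rule pointed_act[OF assms(1)])
  let ?e = "(b * b - a * c) * d"
  have "b * (c * d) + c * (b * (a * c - (b * b - a * c)) * d * d) =
      b * (c * d) + a * b * d * (c * c * d) - b * c * d * ?e"
    by (simp add: algebra_simps)
  then have e1: "a * b * d * (c * c * d) = b * (c * d) + c * (b * (a * c - (b * b - a * c)) * d * d)"
    unfolding assms(2) by simp
  have "b * (b * (a * c - (b * b - a * c)) * d * d) + ?e * ?e = a * a * d * (c * c * d)"
    by (simp add: algebra_simps)
  then have e2: "a * a * d * (c * c * d) = b * (b * (a * c - (b * b - a * c)) * d * d) + 1"
    unfolding assms(2) by simp
  show "[:a * a * d, a * b * d, 1:] * [:c * c * d:] - [:b, c:] * [:b * (a * c - (b * b - a * c)) * d * d, c * d:] = 1"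
    using e1 e2 by (simp add: algebra_simps)
qed (auto simp: deg_lt_pCons numeral_2_eq_2)

lemma phom_gact:
  fixes a b c :: "'a::field poly"
  assumes "pointed n x" "(b * b - a * c) * [:d:] = 1"
  shows "phom (n + 2) (gact d (poly a 0) (poly b 0) (poly c 0) x) (gact d (poly a 1) (poly b 1) (poly c 1) x)"
proof -
  obtain A B where x: "x = (A, B)" by (cases x)
  have "pointed (n + 2) (gact [:d:] a b c (cst A, cst B))"
    using pointed_gact[OF pointed_cst assms(2)] assms(1) unfolding x by blast
  then have "phom (n + 2) (ev_hom 0 (gact [:d:] a b c (cst A, cst B))) (ev_hom 1 (gact [:d:] a b c (cst A, cst B)))"
    by (rule phom_path)
  moreover have "ev_hom t (gact [:d:] a b c (cst A, cst B)) = gact d (poly a t) (poly b t) (poly c t) x" for t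
    unfolding gact_def x by (simp add: evp_hom.hom_add evp_hom.hom_mult ac_simps)
  ultimately show ?thesis by simp
qed

text \<open>The new entries are those of the form after adding \<open>t\<close> times the first
  basis vector to the second. Replacing \<open>t\<close> by t T makes this a path of constant
  determinant.\<close>

lemma phom_gact_upper:
  fixes a b c d t :: "'a::field"
  assumes "pointed n x" "(b * b - a * c) * d = 1"
  shows "phom (n + 2) (gact d a b c x) (gact d a (b + t * a) (c + 2 * t * b + t * t * a) x)"
  using phom_gact[OF assms(1), of "[:b, t * a:]" "[:a:]" "[:c, 2 * t * b, t * t * a:]" d] assms(2)
  by (simp add: algebra_simps)

lemma phom_gact_lower:
  fixes a b c d t :: "'a::field"
  assumes "pointed n x" "(b * b - a * c) * d = 1"
  shows "phom (n + 2) (gact d a b c x) (gact d (a + 2 * t * b + t * t * c) (b + t * c) c x)"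
  using phom_gact[OF assms(1), of "[:b, t * c:]" "[:a, 2 * t * b, t * t * c:]" "[:c:]" d] assms(2)
  by (simp add: algebra_simps)

text \<open>With \<open>a = 0\<close> the determinant does not involve \<open>c\<close>, which can
  therefore be moved along a line.\<close>

lemma phom_gact_isotropic:
  fixes b c d :: "'a::field"
  assumes "pointed n x" "b * b * d = 1"
  shows "phom (n + 2) (gact d 0 b c x) (gact d 0 b c' x)"
  using phom_gact[OF assms(1), of "[:b:]" 0 "[:c, c' - c:]" d] assms(2)
  by (simp add: ac_simps)

primrec cfrac :: "'a::field list \<Rightarrow> 'a poly \<times> 'a poly" where
  "cfrac [] = (1, 0)"
| "cfrac (u # us) = estep u (cfrac us)"

lemma pointed_cfrac: "0 \<notin> set us \<Longrightarrow> pointed (length us) (cfrac us)"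
proof (induction us)
  case Nil
  have "1 * 1 + 0 * 0 = (1 :: 'a poly)" by simp
  then show ?case unfolding pointed_def by (auto simp: deg_lt_def coeff_1)
next
  case (Cons u us)
  then show ?case using pointed_estep[of u "length us" "fst (cfrac us)" "snd (cfrac us)"] by simp
qed

text \<open>Two steps of a continued fraction act through the binary form with diagonal entries
  \<open>v\<close>, \<open>u\<close>: the inner parameter comes first.\<close>

lemma estep_estep:
  fixes u v :: "'a::field"
  assumes "u \<noteq> 0" "v \<noteq> 0"
  shows "estep u (estep v x) = gact (- inverse (u * v)) v 0 u x"
proof -
  define d where "d = - inverse (u * v)"
  have e: "v * v * d = - (inverse u * v)" "u * d = - inverse v" "u * u * d = - (u * inverse v)"
    using assms by (auto simp: d_def field_simps)
  have g: "[:v * v * d, v * 0 * d, 1:] = [:- (inverse u * v), 0, 1:]"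
    "[:0 * (v * u - (0 * 0 - v * u)) * d * d, u * d:] = [:0, - inverse v:]" "[:u * u * d:] = [:- (u * inverse v):]"
    unfolding e by simp_all
  show ?thesis unfolding estep_def gact_def d_def[symmetric] g fst_conv snd_conv
    by (simp add: algebra_simps smult_diff_right)
qed

text \<open>The isometry [[p, y], [r, z]] between the diagonal forms has determinant 1. For
  \<open>r \<noteq> 0\<close> it is the product of an upper, a lower and an upper unipotent matrix
  with entries \<open>s = (p - 1) / r\<close>, \<open>r\<close> and \<open>t = (z - 1) / r\<close>,
  and each factor is realised by a path. The condition \<open>y \<noteq> 0\<close> ensures
  \<open>r \<noteq> 0\<close>.\<close>

lemma phom_pair_aux:
  fixes u v u' v' y z :: "'a::field"
  assumes "pointed n x" "u' = u * z\<^sup>2 + v * y\<^sup>2" "u' * v' = u * v" "u \<noteq> 0" "v \<noteq> 0" "u' \<noteq> 0" "v' \<noteq> 0" "y \<noteq> 0"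
  shows "phom (n + 2) (estep u (estep v x)) (estep u' (estep v' x))"
proof -
  define d where "d = - inverse (u * v)"
  define p where "p = u * z / u'"
  define r where "r = - (v * y / u')"
  have r: "r \<noteq> 0" using assms by (simp add: r_def)
  have v': "v' = u * v / u'" using assms by (simp add: field_simps)
  have det: "p * z - r * y = 1"
  proof -
    have "p * z - r * y = (u * z\<^sup>2 + v * y\<^sup>2) / u'"
      by (simp add: p_def r_def add_divide_distrib power2_eq_square mult.assoc)
    then show ?thesis unfolding assms(2)[symmetric] using assms(6) by simp
  qed
  define s where "s = (p - 1) / r"
  define t where "t = (z - 1) / r"
  have d0: "(0 * 0 - v * u) * d = 1" using assms by (simp add: d_def field_simps)
  note s1 = phom_gact_upper[OF assms(1) d0, of s]
  define b1 c1 where "b1 = 0 + s * v" and "c1 = u + 2 * s * 0 + s * s * v"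
  have d1: "(b1 * b1 - v * c1) * d = 1" using d0 unfolding b1_def c1_def by (simp add: algebra_simps)
  note s2 = phom_gact_lower[OF assms(1) d1, of r]
  define a2 b2 where "a2 = v + 2 * r * b1 + r * r * c1" and "b2 = b1 + r * c1"
  have d2: "(b2 * b2 - a2 * c1) * d = 1" using d1 unfolding a2_def b2_def by (simp add: algebra_simps)
  note s3 = phom_gact_upper[OF assms(1) d2, of t]
  have rs: "r * s = p - 1" "r * t = z - 1" using r by (auto simp: s_def t_def)
  have a2p: "a2 = v * p\<^sup>2 + u * r\<^sup>2"
  proof -
    have "a2 = v * (1 + r * s)\<^sup>2 + u * r\<^sup>2" unfolding a2_def b1_def c1_def
        by (simp add: algebra_simps power2_eq_square)
    then show ?thesis unfolding rs by simp
  qed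
  have a2: "a2 = v'"
  proof -
    note a2p
    also have "\<dots> = u * v * (u * z\<^sup>2 + v * y\<^sup>2) / u'\<^sup>2"
      unfolding p_def r_def by (simp add: power_divide power_mult_distrib add_divide_distrib[symmetric]
          algebra_simps power2_eq_square)
    also have "\<dots> = v'" unfolding assms(2)[symmetric] v' using assms(6) by (simp add: power2_eq_square)
    finally show ?thesis .
  qed
  have "r * b2 = (r * s) * v * (1 + r * s) + r * r * u" unfolding b2_def b1_def c1_def by (simp add: algebra_simps)
  then have b2': "r * b2 = v * (p - 1) * p + r * r * u" unfolding rs by (simp add: mult.commute)
  have y: "r * y = p * z - 1" using det by (simp add: algebra_simps)
  have ortho: "v * p * y + u * r * z = 0" unfolding p_def r_def by simp
  have "r * (b2 + t * a2) = r * b2 + r * t * a2" by (simp add: distrib_left mult.assoc)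
  also have "\<dots> = v * (p - 1) * p + r * r * u + (z - 1) * (v * p\<^sup>2 + u * r\<^sup>2)"
    unfolding b2' rs a2p ..
  also have "\<dots> = v * p * (p * z - 1) + u * r * r * z"
    by (simp add: algebra_simps power2_eq_square)
  also have "\<dots> = r * (v * p * y + u * r * z)" unfolding y[symmetric] by (simp add: algebra_simps)
  finally have b3: "b2 + t * a2 = 0" unfolding ortho using r by simp
  define c3 where "c3 = c1 + 2 * t * b2 + t * t * a2"
  have "(0 * 0 - v' * c3) * d = 1"
  proof -
    have "((b2 + t * a2) * (b2 + t * a2) - a2 * c3) * d = 1"
      using d2 unfolding c3_def by (simp add: algebra_simps)
    then show ?thesis unfolding b3 unfolding a2 .
  qed
  then have "v' * c3 = u * v" unfolding d_def using assms(4,5) by (simp add: field_simps)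
  then have c3: "c3 = u'" using assms(3,7) by (metis mult.commute mult_cancel_left)
  have "phom (n + 2) (gact d v 0 u x) (gact d v' 0 u' x)"
    using phom_trans[OF s1[folded b1_def c1_def] phom_trans[OF s2[folded a2_def b2_def] s3[folded c3_def]]]
    unfolding b3 c3 unfolding a2 .
  moreover have "d = - inverse (u' * v')" by (simp add: d_def assms(3))
  ultimately show ?thesis unfolding estep_estep[OF assms(4,5)] estep_estep[OF assms(6,7)] d_def by simp
qed

text \<open>For \<open>y = 0\<close> the factorisation breaks down; exchanging the two parameters
  first leads back to the generic case, used twice.\<close>

lemma phom_pair:
  fixes u v u' v' y z :: "'a::field"
  assumes "pointed n x" "u' = u * z\<^sup>2 + v * y\<^sup>2" "u' * v' = u * v" "u \<noteq> 0" "v \<noteq> 0" "u' \<noteq> 0" "v' \<noteq> 0"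
  shows "phom (n + 2) (estep u (estep v x)) (estep u' (estep v' x))"
proof (cases "y = 0")
  case False
  then show ?thesis using phom_pair_aux[OF assms] by blast
next
  case True
  have "phom (n + 2) (estep u (estep v x)) (estep v (estep u x))"
    by (rule phom_pair_aux[of n x v u 0 v 1 u]) (use assms in auto)
  moreover have "phom (n + 2) (estep v (estep u x)) (estep u' (estep v' x))"
    by (rule phom_pair_aux[of n x u' v 0 u z v']) (use assms True in auto)
  ultimately show ?thesis by (rule phom_trans)
qed

text \<open>A lower unipotent path makes the first basis vector isotropic, giving [[0, w], [w, u]].
  The remaining diagonal entry is then moved from \<open>u\<close> to \<open>u'\<close>, and the
  same path for the other pair is run backwards.\<close>

lemma phom_hyperbolic:
  fixes u v u' v' w :: "'a::field"
  assumes "pointed n x" "u * v = - w\<^sup>2" "u' * v' = - w\<^sup>2" "u \<noteq> 0" "v \<noteq> 0" "u' \<noteq> 0" "v' \<noteq> 0"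
  shows "phom (n + 2) (estep u (estep v x)) (estep u' (estep v' x))"
proof -
  define d where "d = - inverse (u * v)"
  have "w \<noteq> 0" using assms by auto
  then have w: "w * w * d = 1" unfolding d_def assms(2) by (simp add: power2_eq_square field_simps)
  have *: "phom (n + 2) (gact d v 0 u x) (gact d 0 w u x)"
    if "u * v = - w\<^sup>2" "u \<noteq> 0" for u v
  proof -
    have "(0 * 0 - v * u) * d = 1" using that w by (simp add: power2_eq_square mult.commute)
    from phom_gact_lower[OF assms(1) this, of "w / u"]
    have "phom (n + 2) (gact d v 0 u x) (gact d (v + w * w / u) w u x)" using that by simp
    moreover have "u * (v + w * w / u) = 0" using that by (simp add: distrib_left power2_eq_square)
    then have "v + w * w / u = 0" using that by simp
    ultimately show ?thesis by simp
  qed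
  have "phom (n + 2) (gact d v 0 u x) (gact d v' 0 u' x)"
    using phom_trans[OF *[OF assms(2,4)] phom_trans[OF phom_gact_isotropic[OF assms(1)
        w] phom_sym[OF *[OF assms(3,6)]]]] .
  moreover have "d = - inverse (u' * v')" by (simp add: d_def assms(2,3))
  ultimately show ?thesis unfolding estep_estep[OF assms(4,5)] estep_estep[OF assms(6,7)] d_def by simp
qed

lemma deq_phom: "deq us vs \<Longrightarrow> 0 \<notin> set us \<Longrightarrow> phom (length us) (cfrac us) (cfrac vs)"
proof (induction rule: deq.induct)
  case (deq_sym us vs)
  then show ?case using deq_nonzero[of us vs] deq_length[of us vs] by (auto intro: phom_sym)
next
  case (deq_trans us vs ws)
  then show ?case using deq_nonzero[of us vs] deq_length[of us vs] by (auto intro: phom_trans)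
next
  case (deq_Cons us vs c)
  then show ?case by (auto intro: phom_estep)
next
  case (deq_pair u' u x v y v' us)
  then have "phom (length us + 2) (estep u (estep v (cfrac us))) (estep u' (estep v' (cfrac us)))"
    by (intro phom_pair pointed_cfrac) auto
  then show ?case by simp
next
  case (deq_hyp u v w u' v' us)
  then have "phom (length us + 2) (estep u (estep v (cfrac us))) (estep u' (estep v' (cfrac us)))"
    by (intro phom_hyperbolic pointed_cfrac) auto
  then show ?case by simp
qed (rule phom_refl)

section \<open>Euclid's algorithm carried out by homotopies\<close>

lemma deg_lt_mult_const: "deg_lt n p \<Longrightarrow> deg_lt n ([:c:] * (p :: 'a::comm_ring_1 poly))"
  by (simp add: deg_lt_def)

lemma deg_lt_cst: "deg_lt n A \<Longrightarrow> deg_lt n (cst A)"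
  by (simp add: deg_lt_def)

text \<open>The path A - T C B stays monic by the degree bound, and subtracting a multiple of
  \<open>B\<close> keeps it coprime to \<open>B\<close>.\<close>

lemma phom_subtract_multiple:
  fixes A B C :: "'a::field poly"
  assumes "pointed n (A, B)" "deg_lt n (C * B)"
  shows "phom n (A, B) (A - C * B, B)"
proof -
  let ?A = "cst A - [:[:0, 1:]:] * cst (C * B)"
  obtain U V where UV: "U * cst A + V * cst B = 1" using pointed_cst[OF assms(1)] unfolding pointed_def by auto
  have lt: "deg_lt n ([:[:0, 1:]:] * cst (C * B))" using assms(2) by (intro deg_lt_mult_const deg_lt_cst)
  have "pointed n (?A, cst B)"
    unfolding pointed_def fst_conv snd_conv
  proof (intro conjI)
    show "coeff ?A n = 1" using lt pointed_cst[OF assms(1)] unfolding pointed_def by (simp add: deg_lt_def)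
    show "deg_lt (Suc n) ?A" using deg_lt_mono[OF lt, of "Suc n"] pointed_cst[OF assms(1)]
      unfolding pointed_def fst_conv by (intro deg_lt_diff) simp_all
    show "deg_lt n (cst B)" using pointed_cst[OF assms(1)] unfolding pointed_def by simp
    have "U * ?A + (V + [:[:0, 1:]:] * U * cst C) * cst B = U * cst A + V * cst B"
      unfolding cst_hom.hom_mult by (simp only: algebra_simps)
    then show "\<exists>U V. U * ?A + V * cst B = 1" using UV by metis
  qed
  then have "phom n (evp 0 ?A, evp 0 (cst B)) (evp 1 ?A, evp 1 (cst B))" by (rule phom_pathI)
  then show ?thesis by (simp add: evp_hom.hom_minus)
qed

lemma pointed_degree: "pointed n (A, B) \<Longrightarrow> degree A = n"
  using degree_eqI[of A n] by (simp add: pointed_def)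

lemma div_mod_pointed:
  fixes A B :: "'a::field poly"
  assumes pointed: "pointed n (A, B)" and B: "degree B = l" "B \<noteq> 0" "l < n"
  shows "coeff (A div B) (n - l) = inverse (lead_coeff B)" "degree (A div B) = n - l" "deg_lt l (A mod B)"
proof -
  have dA: "degree A = n" by (rule pointed_degree[OF pointed])
  show R: "deg_lt l (A mod B)"
    unfolding deg_lt_def using degree_mod_less[OF B(2), of A] B(1) by (auto intro: coeff_eq_0 less_le_trans)
  have eq: "A div B * B = A - A mod B" by (rule minus_mod_eq_div_mult[symmetric])
  have An: "coeff A n = 1" "deg_lt (Suc n) A" using pointed by (simp_all add: pointed_def)
  have Rn: "deg_lt n (A mod B)" using deg_lt_mono[OF R] B(3) by simp
  have c1: "coeff (A div B * B) n = 1" unfolding eq coeff_diff using An(1) Rn by (simp add: deg_lt_def)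
  have "deg_lt (Suc n) (A div B * B)" unfolding eq using An(2) deg_lt_mono[OF Rn, of "Suc n"]
    by (intro deg_lt_diff) simp_all
  then have dn: "degree (A div B * B) = n" using c1 by (intro degree_eqI) simp_all
  then have "A div B \<noteq> 0" using B(3) by (intro notI) simp
  then show dQ: "degree (A div B) = n - l" using dn B(1,2) by (simp add: degree_mult_eq)
  have "coeff (A div B) (n - l) * lead_coeff B = 1"
    using coeff_mult_degree_sum[of "A div B" B] dQ B c1 by simp
  then show "coeff (A div B) (n - l) = inverse (lead_coeff B)"
    by (metis inverse_unique mult.commute)
qed

text \<open>The lower terms of the quotient \<open>A div B\<close> are deformed away; only its
  leading monomial remains.\<close>

lemma phom_div_monom:
  fixes A B :: "'a::field poly"
  assumes pointed: "pointed n (A, B)" and B: "degree B = l" "B \<noteq> 0" "l < n"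
  defines "b \<equiv> lead_coeff B"
  shows "phom n (A, B) (monom 1 (n - l) * ([:inverse b:] * B) + A mod B, B)"
proof -
  note dm = div_mod_pointed[OF pointed B]
  define C where "C = A div B - monom (inverse b) (n - l)"
  have "deg_lt (n - l) C" unfolding deg_lt_def
  proof (intro allI impI)
    fix i assume "n - l \<le> i"
    then show "coeff C i = 0" using dm(1,2) unfolding C_def b_def
      by (cases "i = n - l") (auto simp: coeff_eq_0)
  qed
  then have "deg_lt (n - l + l) (C * B)" using B(1) by (intro deg_lt_mult) auto
  then have "phom n (A, B) (A - C * B, B)" using B(3) by (intro phom_subtract_multiple[OF pointed]) simp
  moreover have "A - C * B = monom 1 (n - l) * ([:inverse b:] * B) + A mod B"
  proof -
    have "monom 1 (n - l) * ([:inverse b:] * B) = monom (inverse b) (n - l) * B"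
      by (simp add: smult_monom flip: mult_smult_left)
    moreover have "A - A div B * B = A mod B" by (rule minus_div_mult_eq_mod)
    ultimately show ?thesis unfolding C_def by (simp add: algebra_simps)
  qed
  ultimately show ?thesis by simp
qed

text \<open>The next pair of Euclid's algorithm, with constants chosen so that the matrix with
  columns (X^(n-l), b) and (-1/b, 0) takes it back to the output of \<open>phom_div_monom\<close>.
  For n - l = 1 this matrix is the one of \<open>estep b\<close>.\<close>

lemma pointed_remainder:
  fixes A B :: "'a::field poly"
  assumes pointed: "pointed n (A, B)" and B: "degree B = l" "B \<noteq> 0" "l < n"
  defines "b \<equiv> lead_coeff B"
  shows "pointed l ([:inverse b:] * B, [:- b:] * (A mod B))"
proof -
  have b: "b \<noteq> 0" using B(2) unfolding b_def by (simp only: leading_coeff_0_iff not_False_eq_True)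
  note dm = div_mod_pointed[OF pointed B]
  obtain U V where UV: "U * A + V * B = 1" using pointed unfolding pointed_def by auto
  have eq: "A mod B = A - A div B * B" by (rule minus_div_mult_eq_mod[symmetric])
  have "(U * (A div B) + V) * B + U * (A mod B) = U * A + V * B"
    unfolding eq by (simp only: algebra_simps)
  then have "(U * (A div B) + V) * B + U * (A mod B) = 1" unfolding UV .
  moreover have "([:b:] * (U * (A div B) + V)) * ([:inverse b:] * B) = (U * (A div B) + V) * B"
    using b by simp
  moreover have "([:- inverse b:] * U) * ([:- b:] * (A mod B)) = U * (A mod B)" using b by simp
  ultimately have "([:b:] * (U * (A div B) + V)) * ([:inverse b:] * B) + ([:- inverse b:] * U) * ([:- b:] * (A
      mod B)) = 1"
    by simp
  then have "\<exists>U V. U * ([:inverse b:] * B) + V * ([:- b:] * (A mod B)) = 1" by blast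
  moreover have "deg_lt (Suc l) ([:inverse b:] * B)" using B(1) by (simp add: deg_lt_degree)
  moreover have "coeff ([:inverse b:] * B) l = 1" using b B(1) by (simp add: b_def)
  moreover have "deg_lt l ([:- b:] * (A mod B))" by (rule deg_lt_mult_const[OF dm(3)])
  ultimately show ?thesis unfolding pointed_def by simp
qed

text \<open>Raises the degree of the denominator to \<open>l + d - 1\<close>: in \<open>X^d / (b + T X^(d-1))\<close> the denominator
  stays invertible modulo \<open>X^d\<close>.\<close>

lemma phom_raise_degree:
  fixes A B :: "'a::field poly"
  assumes pointed: "pointed l (A, B)" and b: "b \<noteq> 0"
  obtains A' B' where "phom (l + Suc (Suc e)) (monom 1 (Suc (Suc e)) * A + [:- inverse b:] * B, [:b:] * A) (A', B')"
    "pointed (l + Suc (Suc e)) (A', B')" "coeff B' (l + Suc e) \<noteq> 0"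
proof -
  define d where "d = Suc (Suc e)"
  define P :: "'a poly poly" where "P = monom 1 d"
  \<comment> \<open>\<open>- R\<close> below is the inverse of \<open>Q\<close> modulo
    \<open>P\<close>, and \<open>S\<close> is the quotient that remains. At T = 0 the second column
    of the matrix is (-1/b, 0); at T = 1 the entry \<open>Q\<close> has degree
    \<open>d - 1\<close>.\<close>
  define Q where "Q = [:[:b:]:] + monom [:0, 1:] (Suc e)"
  define R where "R = - [:[:inverse b:]:] + monom [:0, inverse b * inverse b:] (Suc e)"
  define S where "S = monom [:0, 0, inverse b * inverse b:] e"
  have lt: "deg_lt (Suc d) P" "deg_lt d Q" "deg_lt d R" "deg_lt d S"
    by (auto simp: deg_lt_def P_def Q_def R_def S_def d_def coeff_pCons split: nat.splits)
  have P: "coeff P d = 1" by (simp add: P_def)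
  have 1: "P * S = monom [:0, 0, inverse b * inverse b:] (d + e)" by (simp add: P_def S_def mult_monom)
  have 2: "monom [:0, 1:] (Suc e) * monom [:0, inverse b * inverse b:] (Suc e) =
      monom [:0, 0, inverse b * inverse b:] (d + e)"
    by (simp add: mult_monom d_def)
  have 3: "[:[:b:]:] * monom [:0, inverse b * inverse b:] (Suc e) = monom [:0, inverse b:] (Suc e)"
    using b by (simp add: smult_monom)
  have 4: "monom [:0, 1:] (Suc e) * [:[:inverse b:]:] = monom [:0, inverse b:] (Suc e)"
    by (simp add: smult_monom)
  have 5: "[:[:b:]:] * [:[:inverse b:]:] = 1" using b by simp
  have det: "P * S - Q * R = 1"
  proof -
    have "Q * R = - ([:[:b:]:] * [:[:inverse b:]:]) + [:[:b:]:] * monom [:0, inverse b * inverse b:] (Suc e)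
       - monom [:0, 1:] (Suc e) * [:[:inverse b:]:] + monom [:0, 1:] (Suc e)
           * monom [:0, inverse b * inverse b:] (Suc e)"
    proof -
      have "(q0 + q1) * (- r0 + r1) = - (q0 * r0) + q0 * r1 - q1 * r0 + q1 * r1" for q0 q1 r0 r1 :: "'a poly poly"
        by (simp add: algebra_simps)
      then show ?thesis unfolding Q_def R_def by blast
    qed
    also have "\<dots> = - 1 + P * S" unfolding 1 2 3 4 5 by simp
    finally show ?thesis by simp
  qed
  let ?A = "P * cst A + R * cst B" and ?B = "Q * cst A + S * cst B"
  have ptH: "pointed (l + d) (?A, ?B)" by (rule pointed_act[OF pointed_cst[OF pointed] P lt det])
  have path: "phom (l + d) (evp 0 ?A, evp 0 ?B) (evp 1 ?A, evp 1 ?B)" by (rule phom_pathI[OF ptH])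
  have eA: "evp 0 ?A = monom 1 d * A + [:- inverse b:] * B"
    by (simp add: evp_hom.hom_add evp_hom.hom_mult evp_hom.hom_uminus P_def R_def)
  have eB: "evp 0 ?B = [:b:] * A"
    by (simp add: evp_hom.hom_add evp_hom.hom_mult Q_def S_def)
  have pt1: "pointed (l + d) (evp 1 ?A, evp 1 ?B)" by (rule pointed_ev[OF ptH])
  have co: "coeff (evp 1 ?B) (l + Suc e) \<noteq> 0"
  proof -
    have A: "coeff A l = 1" "deg_lt (Suc l) A" and B: "deg_lt l B" using pointed by (auto simp: pointed_def)
    have "evp 1 ?B = [:b:] * A + monom 1 (Suc e) * A + monom (inverse b * inverse b) e * B"
      by (simp add: evp_hom.hom_add evp_hom.hom_mult Q_def S_def distrib_right)
    moreover have "coeff A (l + Suc e) = 0" using A(2) by (simp add: deg_lt_def)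
    moreover have "coeff (monom 1 (Suc e) * A) (l + Suc e) = 1" using A by (simp add: coeff_monom_mult)
    moreover have "coeff (monom (inverse b * inverse b) e * B) (l + Suc e) = 0"
      using B by (simp add: coeff_monom_mult deg_lt_def)
    ultimately show ?thesis by simp
  qed
  show thesis by (rule that[OF path[unfolded eA eB, unfolded d_def] pt1[unfolded d_def] co])
qed

text \<open>A denominator of degree \<open>n - 1\<close> gives a quotient of degree 1, hence one
  step of a continued fraction and a pair of degree \<open>n - 1\<close>. Any other denominator is
  first raised to degree \<open>n - 1\<close>, so the induction always descends by one.\<close>

theorem phom_cfrac_ex:
  fixes AB :: "'a::field poly \<times> 'a poly"
  assumes "pointed n AB"
  shows "\<exists>us. length us = n \<and> 0 \<notin> set us \<and> phom n AB (cfrac us)"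
  using assms
proof (induction n arbitrary: AB)
  case 0
  obtain A B where AB: "AB = (A, B)" by (cases AB)
  have "A = 1" using 0 unfolding AB pointed_def
    by (intro poly_eqI) (auto simp: deg_lt_def)
  moreover have "B = 0" using 0 unfolding AB pointed_def by (intro poly_eqI) (auto simp: deg_lt_def)
  ultimately show ?case unfolding AB by (intro exI[of _ "[]"]) (auto intro: phom_refl)
next
  case (Suc m)
  have top: "\<exists>us. length us = Suc m \<and> 0 \<notin> set us \<and> phom (Suc m) (A, B) (cfrac us)"
    if pointed: "pointed (Suc m) (A, B)" and c: "coeff B m \<noteq> 0" for A B :: "'a poly"
  proof -
    have B: "degree B = m" "B \<noteq> 0" "m < Suc m" using pointed c degree_eqI[OF c] by (auto simp: pointed_def)
    define b where "b = lead_coeff B"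
    have b: "b \<noteq> 0" using B(2) unfolding b_def by (simp only: leading_coeff_0_iff not_False_eq_True)
    from Suc.IH[OF pointed_remainder[OF pointed B], folded b_def] obtain us where us: "length us = m" "0 \<notin> set us"
      "phom m ([:inverse b:] * B, [:- b:] * (A mod B)) (cfrac us)" by (elim exE conjE)
    have "phom (Suc m) (estep b ([:inverse b:] * B, [:- b:] * (A mod B))) (cfrac (b # us))"
      using phom_estep[OF us(3) b] by simp
    moreover have "estep b ([:inverse b:] * B, [:- b:] * (A mod B))
        = (monom 1 (Suc m - m) * ([:inverse b:] * B) + A mod B, B)"
      using b unfolding estep_def by (simp add: monom_altdef)
    ultimately have "phom (Suc m) (A, B) (cfrac (b # us))"
      using phom_div_monom[OF pointed B] unfolding b_def[symmetric] by (auto intro: phom_trans)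
    then show ?thesis using us b by (intro exI[of _ "b # us"]) auto
  qed
  obtain A B where AB: "AB = (A, B)" by (cases AB)
  note pointed = Suc.prems[unfolded AB]
  show ?case
  proof (cases "coeff B m = 0")
    case False
    then show ?thesis using top[OF pointed] AB by simp
  next
    case True
    define l where "l = degree B"
    define b where "b = lead_coeff B"
    have "B \<noteq> 0"
    proof
      assume "B = 0"
      then obtain U where "U * A = 1" using pointed unfolding pointed_def by auto
      then have "A dvd 1" by (metis dvd_triv_right)
      then have "degree A = 0" by (metis is_unit_iff_degree not_is_unit_0)
      then show False using pointed_degree[OF pointed] by simp
    qed
    then have b: "b \<noteq> 0" by (simp add: b_def)
    have "deg_lt (Suc m) B" using pointed by (simp add: pointed_def)
    then have "l \<le> m" unfolding l_def deg_lt_degree .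
    moreover have "l \<noteq> m" using True \<open>B \<noteq> 0\<close> by (auto simp: l_def)
    ultimately have lm: "l < m" by simp
    then obtain e where e: "m = l + Suc e" by (metis less_imp_Suc_add add_Suc_right)
    have B: "degree B = l" "B \<noteq> 0" "l < Suc m" using \<open>B \<noteq> 0\<close> lm by (auto simp: l_def)
    note p1 = phom_div_monom[OF pointed B, folded b_def]
    note p2 = pointed_remainder[OF pointed B, folded b_def]
    obtain A' B' where A': "phom (l + Suc (Suc e)) (monom 1 (Suc (Suc e)) * ([:inverse b:] * B)
        + [:- inverse b:] * ([:- b:] * (A mod B)), [:b:] * ([:inverse b:] * B)) (A', B')"
      "pointed (l + Suc (Suc e)) (A', B')" "coeff B' (l + Suc e) \<noteq> 0"
      using phom_raise_degree[OF p2 b] .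
    have n: "l + Suc (Suc e) = Suc m" "Suc m - l = Suc (Suc e)" using e by auto
    have h: "[:- inverse b:] * ([:- b:] * (A mod B)) = A mod B" "[:b:] * ([:inverse b:] * B) = B" using b by simp_all
    have p3: "phom (Suc m) (A, B) (A', B')"
      by (rule phom_trans[OF p1[unfolded n(2)] A'(1)[unfolded n(1) h]])
    obtain us where "length us = Suc m" "0 \<notin> set us" "phom (Suc m) (A', B') (cfrac us)"
      using top[of A' B'] A'(2,3) unfolding n e[symmetric] by blast
    then show ?thesis using phom_trans[OF p3] unfolding AB by blast
  qed
qed

section \<open>Unpointed homotopies\<close>

lemma inU_ev:
  fixes A B :: "'a::field poly poly"
  assumes "inU n (A, B)"
  shows "inU n (evp t A, evp t B)"
proof -
  have "map_mat (\<lambda>c. poly c t) (sylvester_mat_sub n n A B) = sylvester_mat_sub n n (evp t A) (evp t B)"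
    by (rule sylvester_mat_sub_map) simp
  then have "resultant_sub n n (evp t A) (evp t B) = poly (resultant_sub n n A B) t"
    unfolding resultant_sub_def by (metis det_ev_mat)
  moreover have "poly (resultant_sub n n A B) t \<noteq> 0"
    using assms by (intro poly_dvd_1_nonzero) (simp add: inU_def del: is_unit_iff_degree)
  moreover have "degree (evp t A) \<le> n" "degree (evp t B) \<le> n"
    using assms degree_map_poly_le le_trans unfolding inU_def by (metis fst_conv, metis snd_conv)
  ultimately show ?thesis unfolding inU_def by (simp add: dvd_field_iff)
qed

lemma inU_cst:
  fixes A B :: "'a::field poly"
  assumes "inU n (A, B)"
  shows "inU n (cst A, cst B)"
proof -
  have "map_mat (\<lambda>c. [:c:]) (sylvester_mat_sub n n A B) = sylvester_mat_sub n n (cst A) (cst B)"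
    by (rule sylvester_mat_sub_map) simp
  then have "resultant_sub n n (cst A) (cst B) = [:resultant_sub n n A B:]"
    unfolding resultant_sub_def by (metis const_hom.hom_det)
  moreover have "degree (cst A) \<le> n" "degree (cst B) \<le> n"
    using assms degree_map_poly_le le_trans unfolding inU_def by (metis fst_conv, metis snd_conv)
  moreover have "resultant_sub n n A B \<noteq> 0" using assms by (auto simp: inU_def)
  ultimately show ?thesis unfolding inU_def by (simp add: is_unit_triv)
qed

lemma inU_add_multiple:
  fixes A B :: "'a::idom poly"
  assumes "inU n (A, B)"
  shows "inU n (A + [:c:] * B, B)"
proof -
  have d: "degree A \<le> n" "degree B \<le> n" using assms by (auto simp: inU_def)
  have "degree (A + [:c:] * B) \<le> n"
    using d degree_smult_le[of c B] by (intro degree_add_le) auto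
  moreover have "\<exists>U V. deg_lt n U \<and> deg_lt n V \<and> U * (A + [:c:] * B) + V * B = F" if "deg_lt (n + n) F" for F
  proof -
    from inU_solve[OF assms that]
    obtain U V where UV: "deg_lt n U" "deg_lt n V" "U * A + V * B = F" .
    have "U * (A + [:c:] * B) + (V - [:c:] * U) * B = U * A + V * B" by (simp only: algebra_simps)
    then show ?thesis using UV deg_lt_diff[OF UV(2) deg_lt_mult_const[OF UV(1)]] by metis
  qed
  ultimately show ?thesis unfolding inU_iff using d(2) by blast
qed

lemma inU_scale:
  fixes A B :: "'a::field poly"
  assumes "inU n (A, B)" "c \<noteq> 0"
  shows "inU n (smult c A, smult c B)"
proof -
  have d: "degree A \<le> n" "degree B \<le> n" using assms by (auto simp: inU_def)
  have "\<exists>U V. deg_lt n U \<and> deg_lt n V \<and> U * smult c A + V * smult c B = F" if "deg_lt (n + n) F" for F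
  proof -
    from inU_solve[OF assms(1) that]
    obtain U V where UV: "deg_lt n U" "deg_lt n V" "U * A + V * B = F" .
    have "smult (inverse c) U * smult c A + smult (inverse c) V * smult c B = U * A + V * B" using assms(2) by simp
    moreover have "deg_lt n (smult (inverse c) U)" "deg_lt n (smult (inverse c) V)" using UV
        by (auto simp: deg_lt_def)
    ultimately show ?thesis using UV(3) by metis
  qed
  then show ?thesis unfolding inU_iff using d degree_smult_le le_trans by metis
qed

lemma naive_rel_refl: "(x, x) \<in> naive_rel n"
  by (simp add: naive_rel_def)

lemma naive_rel_trans: "(x, y) \<in> naive_rel n \<Longrightarrow> (y, z) \<in> naive_rel n \<Longrightarrow> (x, z) \<in> naive_rel n"
  unfolding naive_rel_def by (rule rtrancl_trans)

lemma naive_rel_sym: "(x, y) \<in> naive_rel n \<Longrightarrow> (y, x) \<in> naive_rel n"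
  unfolding naive_rel_def by (rule symD[OF sym_rtrancl]) (auto simp: sym_def)

lemma naive_rel_homotopy:
  assumes "inU n (A, B)"
  shows "((evp 0 A, evp 0 B), (evp 1 A, evp 1 B)) \<in> naive_rel n"
proof -
  have "((evp 0 A, evp 0 B), (evp 1 A, evp 1 B)) \<in> naive_step n"
    unfolding naive_step_def Upts_def using inU_ev[OF assms] assms
    by (auto intro!: exI[of _ "(A, B)"] disjI2)
  then show ?thesis unfolding naive_rel_def by auto
qed

lemma naive_rel_scale:
  assumes "inU n (A, B)" "c \<noteq> 0"
  shows "((A, B), (smult c A, smult c B)) \<in> naive_rel n"
proof -
  have "((A, B), (smult c A, smult c B)) \<in> naive_step n"
    unfolding naive_step_def Upts_def using inU_scale[OF assms] assms by auto
  then show ?thesis unfolding naive_rel_def by auto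
qed

lemma naive_rel_add_fst:
  fixes A B :: "'a::field poly"
  assumes "inU n (A, B)"
  shows "((A, B), (A + [:c:] * B, B)) \<in> naive_rel n"
  using naive_rel_homotopy[OF inU_add_multiple[OF inU_cst[OF assms], of "[:0, c:]"]]
  by (simp add: evp_hom.hom_add)

lemma naive_rel_add_snd:
  fixes A B :: "'a::field poly"
  assumes "inU n (A, B)"
  shows "((A, B), (A, B + [:c:] * A)) \<in> naive_rel n"
  using naive_rel_homotopy[OF inU_swap[OF inU_add_multiple[OF inU_swap[OF inU_cst[OF assms]], of "[:0, c:]"]]]
  by (simp add: evp_hom.hom_add)

lemma phom_naive_rel: "phom n x y \<Longrightarrow> (x, y) \<in> naive_rel n"
proof (induction rule: phom.induct)
  case (phom_path H)
  then show ?case using naive_rel_homotopy[of n "fst H" "snd H"] pointed_inU[of n "fst H" "snd H"]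
      by (simp add: ev_hom_def)
qed (auto intro: naive_rel_refl naive_rel_sym naive_rel_trans)

lemma naive_rel_pointed_ex:
  fixes A B :: "'a::field poly"
  assumes n: "n \<ge> 1" and U: "inU n (A, B)"
  shows "\<exists>x. pointed n x \<and> ((A, B), x) \<in> naive_rel n"
proof -
  have *: "\<exists>x. pointed n x \<and> ((A, B), x) \<in> naive_rel n" if U: "inU n (A, B)" and a: "coeff A n \<noteq> 0"
      for A B :: "'a poly"
  proof -
    define a b where "a = coeff A n" and "b = - coeff B n / coeff A n"
    define B1 where "B1 = B + [:b:] * A"
    have d: "degree A \<le> n" "degree B \<le> n" using U by (auto simp: inU_def)
    have U1: "inU n (A, B1)" unfolding B1_def by (rule inU_swap[OF inU_add_multiple[OF inU_swap[OF U]]])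
    have U2: "inU n (smult (inverse a) A, smult (inverse a) B1)"
      by (rule inU_scale[OF U1]) (use a in \<open>simp add: a_def\<close>)
    have B1: "coeff B1 n = 0" using a by (simp add: B1_def b_def)
    have "deg_lt n B1" unfolding deg_lt_def
    proof (intro allI impI)
      fix i assume "n \<le> i"
      then show "coeff B1 i = 0" using B1 U1
        by (cases "i = n") (auto simp: inU_def intro: coeff_eq_0)
    qed
    then have lB: "deg_lt n (smult (inverse a) B1)" by (simp add: deg_lt_def)
    have "deg_lt (n + n) (1 :: 'a poly)" using n by (auto simp: deg_lt_def)
    from inU_solve[OF U2 this] have "\<exists>U V. U * smult (inverse a) A + V * smult (inverse a) B1 = 1" by metis
    moreover have "deg_lt (Suc n) (smult (inverse a) A)" using d(1) by (simp add: deg_lt_def coeff_eq_0)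
    ultimately have "pointed n (smult (inverse a) A, smult (inverse a) B1)"
      using lB a unfolding pointed_def by (simp add: a_def)
    moreover have "((A, B), (A, B1)) \<in> naive_rel n" unfolding B1_def by (rule naive_rel_add_snd[OF U])
    moreover have "((A, B1), (smult (inverse a) A, smult (inverse a) B1)) \<in> naive_rel n"
      by (rule naive_rel_scale[OF U1]) (use a in \<open>simp add: a_def\<close>)
    ultimately show ?thesis by (intro exI[of _ "(smult (inverse a) A, smult (inverse a) B1)"])
        (blast intro: naive_rel_trans)
  qed
  consider "coeff A n \<noteq> 0" | "coeff A n = 0" "coeff B n \<noteq> 0" using inU_leading_coeff[OF U n] by blast
  then show ?thesis
  proof cases
    case 1
    then show ?thesis using *[OF U] by blast
  next
    case 2
    have "inU n (A + [:1:] * B, B)" by (rule inU_add_multiple[OF U])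
    moreover have "coeff (A + [:1:] * B) n \<noteq> 0" using 2 by simp
    ultimately obtain x where "pointed n x" "((A + [:1:] * B, B), x) \<in> naive_rel n" using * by blast
    then show ?thesis using naive_rel_trans[OF naive_rel_add_fst[OF U, of 1]] by blast
  qed
qed

text \<open>Whitehead's lemma: \<open>diag(1/w, w)\<close> is a product of four elementary matrices.\<close>

lemma naive_rel_square:
  fixes A B :: "'a::field poly"
  assumes U: "inU n (A, B)" and w: "w \<noteq> 0"
  shows "((A, B), (A, smult (w\<^sup>2) B)) \<in> naive_rel n"
proof -
  \<comment> \<open>The scalar \<open>w\<close> comes first: on (w A, w B) the matrix diag(1/w, w)
    gives (A, w^2 B).\<close>
  define x y where "x = smult w A" and "y = smult w B"
  define b where "b = inverse w - 1"
  define x1 where "x1 = x + [:- w:] * y"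
  define y1 where "y1 = y + [:b:] * x1"
  define x2 where "x2 = x1 + [:1:] * y1"
  define y2 where "y2 = y1 + [:w - 1:] * x2"
  have U0: "inU n (x, y)" unfolding x_def y_def by (rule inU_scale[OF U w])
  have U1: "inU n (x1, y)" unfolding x1_def by (rule inU_add_multiple[OF U0])
  have U2: "inU n (x1, y1)" unfolding y1_def by (rule inU_swap[OF inU_add_multiple[OF inU_swap[OF U1]]])
  have U3: "inU n (x2, y1)" unfolding x2_def by (rule inU_add_multiple[OF U2])
  have wb: "w * b = 1 - w" using w by (simp add: b_def algebra_simps)
  have "x2 = A"
  proof (rule poly_eqI)
    fix i
    have "coeff x2 i = (1 + b) * w * coeff A i + (1 - w * (1 + b)) * w * coeff B i"
      unfolding x2_def y1_def x1_def x_def y_def by (simp add: algebra_simps)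
    then show "coeff x2 i = coeff A i" using w by (simp add: b_def)
  qed
  moreover have "y2 = smult (w\<^sup>2) B"
  proof (rule poly_eqI)
    fix i
    have "coeff y2 i = b * w * coeff A i + (1 - w * b) * w * coeff B i + (w - 1) * coeff x2 i"
      unfolding y2_def y1_def x1_def x_def y_def by (simp add: algebra_simps)
    also have "\<dots> = (w * b) * coeff A i + (1 - w * b) * w * coeff B i + (w - 1) * coeff A i"
      unfolding \<open>x2 = A\<close> by (simp add: mult.commute)
    also have "\<dots> = w\<^sup>2 * coeff B i" unfolding wb by (simp add: algebra_simps power2_eq_square)
    finally show "coeff y2 i = coeff (smult (w\<^sup>2) B) i" by simp
  qed
  moreover have "((A, B), (x, y)) \<in> naive_rel n" unfolding x_def y_def by (rule naive_rel_scale[OF U w])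
  moreover have "((x, y), (x1, y)) \<in> naive_rel n" unfolding x1_def by (rule naive_rel_add_fst[OF U0])
  moreover have "((x1, y), (x1, y1)) \<in> naive_rel n" unfolding y1_def by (rule naive_rel_add_snd[OF U1])
  moreover have "((x1, y1), (x2, y1)) \<in> naive_rel n" unfolding x2_def by (rule naive_rel_add_fst[OF U2])
  moreover have "((x2, y1), (x2, y2)) \<in> naive_rel n" unfolding y2_def by (rule naive_rel_add_snd[OF U3])
  ultimately show ?thesis by (metis naive_rel_trans)
qed

section \<open>Bezout forms of continued fractions\<close>

text \<open>Together with \<open>naive_rel_square\<close> this changes the product of the parameters
  by a 2n-th power within one class.\<close>

lemma cfrac_square: "w \<noteq> 0 \<Longrightarrow> cfrac (map ((*) (w\<^sup>2)) us) = (fst (cfrac us), smult (w\<^sup>2) (snd (cfrac us)))"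
proof (induction us)
  case (Cons a us)
  have e: "w\<^sup>2 * (inverse a * inverse (w\<^sup>2)) = inverse a" using Cons.prems by simp
  show ?case using Cons by (simp add: estep_def mult.commute) (subst e, rule refl)
qed simp

text \<open>For (X A - B/u, u A) the numerator of the Bezout form is u (X - Y) A(X) A(Y) plus that
  of (A, B), so division by X - Y adds a form of rank one.\<close>

lemma bez_coeff_estep:
  assumes "u \<noteq> 0"
  shows "bez_coeff (fst (estep u (A, B))) (snd (estep u (A, B))) p q = u * coeff A p * coeff A q + bez_coeff A B p q"
proof -
  have u: "u * (inverse u * x) = x" for x using assms by (simp add: mult.assoc[symmetric])
  show ?thesis
    by (induction p arbitrary: q) (simp_all add: estep_def algebra_simps u)
qed

text \<open>Since \<open>A\<close> is monic of degree \<open>n\<close>, its coefficient vector ends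
  in 1 and is the last row of the unipotent matrix \<open>P\<close>. The new parameter therefore
  appears as the last diagonal entry.\<close>

lemma bez_mat_estep:
  fixes A B :: "'a::field poly"
  assumes "u \<noteq> 0" "pointed n (A, B)"
  defines "M \<equiv> bez_mat (Suc n) (fst (estep u (A, B))) (snd (estep u (A, B)))"
  obtains P where "P \<in> carrier_mat (Suc n) (Suc n)" "det P = 1" "P\<^sup>T * orth_sum (bez_mat n A B) (diag [u]) * P = M"
proof -
  define Y where "Y = mat 1 n (\<lambda>(i, j). coeff A j)"
  define P where "P = four_block_mat (1\<^sub>m n) (0\<^sub>m n 1) Y (1\<^sub>m 1)"
  have Y: "Y \<in> carrier_mat 1 n" by (simp add: Y_def)
  have A: "coeff A n = 1" "degree A \<le> n" "degree B \<le> n"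
    using assms(2) pointed_degree[OF assms(2)] deg_lt_le[of n B] by (auto simp: pointed_def)
  have P: "P \<in> carrier_mat (n + 1) (n + 1)" unfolding P_def by (rule four_block_carrier_mat) auto
  have "det P = 1" unfolding P_def using Y by (subst det_four_block_mat_upper_right_zero[of _ n _ 1]) auto
  have PT: "P\<^sup>T = four_block_mat (1\<^sub>m n) Y\<^sup>T (0\<^sub>m 1 n) (1\<^sub>m 1)"
    unfolding P_def using Y by (simp add: transpose_four_block_mat[of _ n n _ 1 _ 1])
  define Z where "Z = bez_mat n A B"
  have Z: "Z \<in> carrier_mat n n" by (simp add: Z_def)
  have 1: "P\<^sup>T * orth_sum Z (diag [u]) = four_block_mat Z (Y\<^sup>T * diag [u]) (0\<^sub>m 1 n) (diag [u])"
    unfolding PT orth_sum_eq[OF Z diag_single_carrier] using Y Z diag_single_carrier[of u]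
    by (subst mult_four_block_mat[of _ n n _ 1 _ 1 _ _ n _ 1]) auto
  have 2: "P\<^sup>T * orth_sum Z (diag [u]) * P = four_block_mat (Z + Y\<^sup>T * diag [u] * Y) (Y\<^sup>T * diag [u]) (diag [u]
      * Y) (diag [u])"
    unfolding 1 unfolding P_def using Y Z diag_single_carrier[of u]
    by (subst mult_four_block_mat[of _ n n _ 1 _ 1 _ _ n _ 1]) auto
  have "P\<^sup>T * orth_sum Z (diag [u]) * P = M" unfolding 2
  proof (rule eq_matI)
    fix i j assume "i < dim_row M" "j < dim_col M"
    then have ij: "i < Suc n" "j < Suc n" by (auto simp: M_def Z_def bez_mat_def)
    have M: "M $$ (i, j) = u * coeff A i * coeff A j + bez_coeff A B i j"
      unfolding M_def bez_mat_def using ij by (simp add: bez_coeff_estep[OF assms(1)])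
    consider "i < n" "j < n" | "i = n" "j < n" | "i < n" "j = n" | "i = n" "j = n" using ij by linarith
    then show "four_block_mat (Z + Y\<^sup>T * diag [u] * Y) (Y\<^sup>T * diag [u]) (diag [u] * Y) (diag [u]) $$ (i, j) =
        M $$ (i, j)"
      unfolding M using A bez_coeff_eq_0[OF A(2,3), of i j]
      by cases (simp_all add: Z_def bez_mat_def Y_def diag_def scalar_prod_def mult_ac)
  qed (use Y in \<open>auto simp: M_def Z_def bez_mat_def diag_def\<close>)
  with that P \<open>det P = 1\<close> show thesis by (simp add: Z_def)
qed

text \<open>The unipotent base changes preserve the determinant, so the product of the parameters is
  recovered exactly and not only modulo squares.\<close>

lemma bez_mat_cfrac:
  assumes "0 \<notin> set us"
  shows "bez_mat (length us) (fst (cfrac us)) (snd (cfrac us)) \<in> nondeg_sym (length us) \<and>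
    isom_forms (bez_mat (length us) (fst (cfrac us)) (snd (cfrac us))) (diag us) \<and>
    det (bez_mat (length us) (fst (cfrac us)) (snd (cfrac us))) = prod_list us"
  using assms
proof (induction us)
  case Nil
  have e: "bez_mat 0 A B = diag []" for A B :: "'a poly" by (rule eq_matI) (auto simp: bez_mat_def diag_def)
  show ?case using diag_nondeg[of "[]"] isom_forms_refl[OF diag_carrier[of "[]"]] by (simp add: e det_diag)
next
  case (Cons u us)
  obtain A B where F: "cfrac us = (A, B)" by (cases "cfrac us")
  let ?n = "length us"
  have u: "u \<noteq> 0" and us: "0 \<notin> set us" using Cons.prems by auto
  have IH: "bez_mat ?n A B \<in> nondeg_sym ?n" "isom_forms (bez_mat ?n A B) (diag us)"
      "det (bez_mat ?n A B) = prod_list us"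
    using Cons.IH[OF us] unfolding F by auto
  have pointed: "pointed ?n (A, B)" using pointed_cfrac[OF us] F by simp
  let ?M = "bez_mat (Suc ?n) (fst (estep u (A, B))) (snd (estep u (A, B)))"
  let ?D = "orth_sum (bez_mat ?n A B) (diag [u])"
  obtain P where P: "P \<in> carrier_mat (Suc ?n) (Suc ?n)" "det P = 1" "P\<^sup>T * ?D * P = ?M"
    using bez_mat_estep[OF u pointed] .
  have du: "diag [u] \<in> nondeg_sym 1" using diag_nondeg[of "[u]"] u by simp
  have D: "?D \<in> nondeg_sym (Suc ?n)" using orth_sum_nondeg[OF IH(1) du] by simp
  note Dc = nondeg_symD[OF D]
  have i: "isom_forms ?D ?M" unfolding isom_forms_def
    using P Dc(4) by (intro exI[of _ P]) simp
  have Mn: "?M \<in> nondeg_sym (Suc ?n)" by (rule isom_forms_nondeg[OF i D])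
  note Mc = nondeg_symD[OF Mn]
  have "det ?M = det ?D" using det_congruence[OF Dc(1) P(1)] P by simp
  also have "\<dots> = prod_list us * u" using det_orth_sum[OF bez_mat_carrier diag_single_carrier, of ?n A B u] IH(3)
    by (simp add: det_diag)
  finally have det: "det ?M = prod_list (u # us)" by simp
  have "isom_forms ?D (orth_sum (diag [u]) (bez_mat ?n A B))" by (rule isom_forms_orth_sum_commute[OF IH(1) du])
  moreover have "isom_forms (orth_sum (diag [u]) (bez_mat ?n A B)) (diag (u # us))"
    unfolding diag_Cons[of u us]
    by (rule isom_forms_orth_sum[OF isom_forms_refl[OF diag_single_carrier] IH(2)
        diag_single_carrier bez_mat_carrier])
  moreover have "isom_forms ?M ?D" by (rule isom_forms_sym[OF i Dc(1)])
  moreover have "orth_sum (diag [u]) (bez_mat ?n A B) \<in> carrier_mat (Suc ?n) (Suc ?n)"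
    using orth_sum_carrier[OF diag_single_carrier[of u] bez_mat_carrier[of ?n A B]] by simp
  ultimately have "isom_forms ?M (diag (u # us))"
    using isom_forms_trans[OF _ isom_forms_trans[OF _ _ Dc(1)] Mc(1)] by blast
  then show ?case using Mn det F by simp
qed

lemma bez_mat_nondeg: "inU n (A, B) \<Longrightarrow> bez_mat n A B \<in> nondeg_sym n" for A B :: "'a::field poly"
  using inU_det_bez_mat[of n A B] by (intro nondeg_symI) (auto simp: transpose_bez_mat)

lemma ev_mat_bez_mat: "ev_mat t (bez_mat n A B) = bez_mat n (evp t A) (evp t B)"
proof -
  have "poly (bez_coeff A B p q) t = bez_coeff (evp t A) (evp t B) p q" for p q
    by (induction p arbitrary: q) simp_all
  then show ?thesis by (intro eq_matI) (auto simp: bez_mat_def)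
qed

section \<open>The complete invariant\<close>

text \<open>A scalar \<open>c\<close> acts on the form as the isometry c times the identity, whence
  the factor c^(2n). For a homotopy, the Bezout matrix over k[T] is a path of forms whose
  determinant is a unit of k[T], hence constant.\<close>

lemma naive_step_invariant:
  assumes "((A, B), (A', B')) \<in> naive_step n"
  shows "stably_isom (bez_mat n A B) (bez_mat n A' B') \<and>
    (\<exists>u. u \<noteq> 0 \<and> det (bez_mat n A' B') = u ^ (2 * n) * det (bez_mat n A B))"
proof -
  have U: "inU n (A, B)" "inU n (A', B')" using assms by (auto simp: naive_step_def Upts_def)
  consider c where "c \<noteq> 0" "A' = smult c A" "B' = smult c B"
    | C D where "inU n (C, D)" "A = evp 0 C" "B = evp 0 D" "A' = evp 1 C" "B' = evp 1 D"
    using assms unfolding naive_step_def by (auto simp: ev_hom_def)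
  then show ?thesis
  proof cases
    case (1 c)
    have "bez_coeff (smult c A) (smult c B) p q = c\<^sup>2 * bez_coeff A B p q" for p q
      by (induction p arbitrary: q) (simp_all add: algebra_simps power2_eq_square)
    then have e: "bez_mat n A' B' = c\<^sup>2 \<cdot>\<^sub>m bez_mat n A B" unfolding 1 by (intro eq_matI) (auto simp: bez_mat_def)
    have "(c \<cdot>\<^sub>m 1\<^sub>m n)\<^sup>T * bez_mat n A B * (c \<cdot>\<^sub>m 1\<^sub>m n) = c\<^sup>2 \<cdot>\<^sub>m bez_mat n A B"
    proof -
      have "(c \<cdot>\<^sub>m 1\<^sub>m n)\<^sup>T = c \<cdot>\<^sub>m 1\<^sub>m n" by (rule eq_matI) auto
      moreover have "c \<cdot>\<^sub>m 1\<^sub>m n * bez_mat n A B = c \<cdot>\<^sub>m bez_mat n A B"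
        using mult_smult_assoc_mat[OF one_carrier_mat bez_mat_carrier, of c] left_mult_one_mat[OF
            bez_mat_carrier] by metis
      moreover have "c \<cdot>\<^sub>m bez_mat n A B * (c \<cdot>\<^sub>m 1\<^sub>m n) = c \<cdot>\<^sub>m (c \<cdot>\<^sub>m bez_mat n A B)"
        using mult_smult_distrib[of "c \<cdot>\<^sub>m bez_mat n A B" n n "1\<^sub>m n" n c] right_mult_one_mat[of
            "c \<cdot>\<^sub>m bez_mat n A B" n n]
        by simp
      moreover have "c \<cdot>\<^sub>m (c \<cdot>\<^sub>m bez_mat n A B) = c\<^sup>2 \<cdot>\<^sub>m bez_mat n A B"
        by (rule eq_matI) (auto simp: power2_eq_square)
      ultimately show ?thesis by simp
    qed
    then have "isom_forms (bez_mat n A B) (bez_mat n A' B')"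
      using nondeg_symD(3)[OF bez_mat_nondeg[OF U(2)]] unfolding e
      by (intro isom_formsI[OF bez_mat_carrier, of "c \<cdot>\<^sub>m 1\<^sub>m n"]) simp_all
    moreover have "det (bez_mat n A' B') = c ^ (2 * n) * det (bez_mat n A B)"
      unfolding e by (simp add: power_mult bez_mat_def)
    ultimately show ?thesis using isom_forms_stably_isom[OF _ bez_mat_nondeg[OF U(1)]] 1(1) by blast
  next
    case (2 C D)
    note u = inU_det_bez_mat[OF 2(1)]
    have "stably_isom (ev_mat 0 (bez_mat n C D)) (ev_mat 1 (bez_mat n C D))"
      by (rule stably_isom_path[OF bez_mat_carrier transpose_bez_mat u])
    moreover have "det (ev_mat 1 (bez_mat n C D)) = det (ev_mat 0 (bez_mat n C D))"
    proof -
      have "degree (det (bez_mat n C D)) = 0" using u by simp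
      then show ?thesis unfolding det_ev_mat by (metis degree_0_id poly_pCons poly_0 mult_zero_right add_0_right)
    qed
    ultimately show ?thesis unfolding ev_mat_bez_mat 2(2-5)[symmetric] by (intro conjI exI[of _ 1]) auto
  qed
qed

lemma stab_class_eq_iff:
  assumes "M \<in> nondeg_sym n" "M' \<in> nondeg_sym n"
  shows "stab_class n M = stab_class n M' \<longleftrightarrow> stably_isom M M'"
proof
  assume "stab_class n M = stab_class n M'"
  then show "stably_isom M M'" using assms stably_isom_refl[OF assms(2)] by (auto simp: stab_class_def)
next
  assume *: "stably_isom M M'"
  have "stably_isom M N \<longleftrightarrow> stably_isom M' N" if "N \<in> nondeg_sym n" for N
    using stably_isom_trans[OF * _ assms that] stably_isom_trans[OF stably_isom_sym[OF * assms(1)] _ assms(2,1) that]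
    by blast
  then show "stab_class n M = stab_class n M'" by (auto simp: stab_class_def)
qed

lemma pow_class_eq_iff:
  assumes "d \<noteq> 0" "d' \<noteq> 0"
  shows "pow_class m d = pow_class m d' \<longleftrightarrow> (\<exists>u. u \<noteq> 0 \<and> d' = u ^ m * d)"
proof
  assume *: "pow_class m d = pow_class m d'"
  have "d' \<in> pow_class m d'" using assms by (auto simp: pow_class_def intro!: exI[of _ 1])
  then have "d' \<in> pow_class m d" unfolding * .
  then show "\<exists>u. u \<noteq> 0 \<and> d' = u ^ m * d" by (simp add: pow_class_def)
next
  assume "\<exists>u. u \<noteq> 0 \<and> d' = u ^ m * d"
  then obtain u where u: "u \<noteq> 0" "d' = u ^ m * d" by blast
  have "(\<exists>v. v \<noteq> 0 \<and> e = v ^ m * d) \<longleftrightarrow> (\<exists>v. v \<noteq> 0 \<and> e = v ^ m * d')" for e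
  proof
    assume "\<exists>v. v \<noteq> 0 \<and> e = v ^ m * d"
    then obtain v where "v \<noteq> 0" "e = v ^ m * d" by blast
    then show "\<exists>v. v \<noteq> 0 \<and> e = v ^ m * d'" using u
      by (intro exI[of _ "v / u"]) (simp add: power_divide)
  next
    assume "\<exists>v. v \<noteq> 0 \<and> e = v ^ m * d'"
    then obtain v where "v \<noteq> 0" "e = v ^ m * d'" by blast
    then show "\<exists>v. v \<noteq> 0 \<and> e = v ^ m * d" using u
      by (intro exI[of _ "v * u"]) (simp add: power_mult_distrib)
  qed
  then show "pow_class m d = pow_class m d'" by (simp add: pow_class_def)
qed

definition bez_inv :: "nat \<Rightarrow> 'a::field poly \<times> 'a poly \<Rightarrow> 'a mat set \<times> 'a set" where
  "bez_inv n x = (stab_class n (bez_mat n (fst x) (snd x)), pow_class (2 * n) (det (bez_mat n (fst x) (snd x))))"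

lemma bez_mat_nondeg': "inU n x \<Longrightarrow> bez_mat n (fst x) (snd x) \<in> nondeg_sym n"
  using bez_mat_nondeg[of n "fst x" "snd x"] by simp

lemma bez_inv_eq_iff:
  fixes x y :: "'a::field poly \<times> 'a poly"
  assumes "inU n x" "inU n y"
  shows "bez_inv n x = bez_inv n y \<longleftrightarrow> stably_isom (bez_mat n (fst x) (snd x)) (bez_mat n (fst y) (snd y)) \<and>
    (\<exists>u. u \<noteq> 0 \<and> det (bez_mat n (fst y) (snd y)) = u ^ (2 * n) * det (bez_mat n (fst x) (snd x)))"
proof -
  note nx = bez_mat_nondeg'[OF assms(1)] and ny = bez_mat_nondeg'[OF assms(2)]
  show ?thesis unfolding bez_inv_def prod.inject
    stab_class_eq_iff[OF nx ny] pow_class_eq_iff[OF nondeg_symD(3)[OF nx] nondeg_symD(3)[OF ny]] ..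
qed

lemma naive_rel_invariant:
  assumes "(x, y) \<in> naive_rel n" "inU n x"
  shows "inU n y \<and> bez_inv n x = bez_inv n y"
  using assms(1) unfolding naive_rel_def
proof (induction rule: rtrancl_induct)
  case base
  show ?case using assms(2) by simp
next
  case (step y z)
  have *: "inU n y \<and> inU n z \<and> bez_inv n y = bez_inv n z" if "(y, z) \<in> naive_step n" for y z
  proof -
    have U: "inU n y" "inU n z" using that by (auto simp: naive_step_def Upts_def)
    then show ?thesis using naive_step_invariant[of "fst y" "snd y" "fst z" "snd z" n] that
      by (simp add: bez_inv_eq_iff[OF U])
  qed
  from step.hyps(2) have "inU n z \<and> bez_inv n y = bez_inv n z" using *[of y z] *[of z y] by auto
  then show ?case using step.IH by simp
qed

lemma naive_rel_cfrac_ex: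
  fixes x :: "'a::field poly \<times> 'a poly"
  assumes "n \<ge> 1" "inU n x"
  shows "\<exists>us. length us = n \<and> 0 \<notin> set us \<and> (x, cfrac us) \<in> naive_rel n"
proof -
  obtain y where y: "pointed n y" "(x, y) \<in> naive_rel n"
      using naive_rel_pointed_ex[OF assms(1), of "fst x" "snd x"] assms(2) by auto
  obtain us where us: "length us = n" "0 \<notin> set us" "phom n y (cfrac us)" using phom_cfrac_ex[OF y(1)] by blast
  show ?thesis using us y(2) phom_naive_rel[OF us(3)] by (blast intro: naive_rel_trans)
qed

lemma inU_cfrac: "0 \<notin> set us \<Longrightarrow> inU (length us) (cfrac us)"
  using pointed_inU[of "length us" "fst (cfrac us)" "snd (cfrac us)"] pointed_cfrac[of us] by simp

lemma prod_list_map_mult: "prod_list (map ((*) c) us) = (c :: 'a::comm_monoid_mult) ^ length us * prod_list us"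
  by (induction us) (simp_all add: ac_simps)

text \<open>The two determinants agree only up to w^(2n). Absorbing this factor into the parameters
  of one side makes the products equal, which is what the classification of diagonal forms by
  \<open>deq\<close> requires.\<close>

lemma naive_rel_if_bez_inv_eq:
  fixes x y :: "'a::field poly \<times> 'a poly"
  assumes n: "n \<ge> 1" and U: "inU n x" "inU n y" and xy: "bez_inv n x = bez_inv n y"
  shows "(x, y) \<in> naive_rel n"
proof -
  obtain us where us: "length us = n" "0 \<notin> set us" "(x, cfrac us) \<in> naive_rel n"
    using naive_rel_cfrac_ex[OF n U(1)] by blast
  obtain vs where vs: "length vs = n" "0 \<notin> set vs" "(y, cfrac vs) \<in> naive_rel n"
    using naive_rel_cfrac_ex[OF n U(2)] by blast
  have Uu: "inU n (cfrac us)" and Uv: "inU n (cfrac vs)" and st: "bez_inv n (cfrac us) = bez_inv n (cfrac vs)"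
    using naive_rel_invariant[OF us(3) U(1)] naive_rel_invariant[OF vs(3) U(2)] xy by auto
  obtain w where w: "w \<noteq> 0"
    "det (bez_mat n (fst (cfrac vs)) (snd (cfrac vs))) =
        w ^ (2 * n) * det (bez_mat n (fst (cfrac us)) (snd (cfrac us)))"
    using st bez_inv_eq_iff[OF Uu Uv] by blast
  define us' where "us' = map ((*) (w\<^sup>2)) us"
  have us': "length us' = n" "0 \<notin> set us'" using us w by (auto simp: us'_def)
  have r: "(cfrac us, cfrac us') \<in> naive_rel n"
    using naive_rel_square[of n "fst (cfrac us)" "snd (cfrac us)" w] Uu w(1)
    by (simp add: us'_def cfrac_square)
  have "prod_list us' = prod_list vs"
    using w(2) bez_mat_cfrac[OF us(2)] bez_mat_cfrac[OF vs(2)] us(1) vs(1)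
    by (simp add: us'_def prod_list_map_mult power_mult)
  moreover have "stably_isom (diag us') (diag vs)"
  proof -
    have 1: "stably_isom (bez_mat n (fst (cfrac us')) (snd (cfrac us'))) (bez_mat n (fst (cfrac vs)) (snd (cfrac
        vs)))"
      using naive_rel_invariant[OF r Uu] st bez_inv_eq_iff[OF _ Uv, of "cfrac us'"] by simp
    note bu = bez_mat_cfrac[OF us'(2), unfolded us'(1)] and bv = bez_mat_cfrac[OF vs(2), unfolded vs(1)]
    note su = isom_forms_stably_isom[OF bu[THEN conjunct2, THEN conjunct1] bu[THEN conjunct1]]
    note sv = isom_forms_stably_isom[OF bv[THEN conjunct2, THEN conjunct1] bv[THEN conjunct1]]
    note nu = bu[THEN conjunct1] and nv = bv[THEN conjunct1]
    have du: "diag us' \<in> nondeg_sym n" and dv: "diag vs \<in> nondeg_sym n"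
        using diag_nondeg[of us'] diag_nondeg[of vs] us' vs(1,2) by auto
    show ?thesis
      by (rule stably_isom_trans[OF stably_isom_sym[OF su nu] stably_isom_trans[OF 1 sv nu nv dv] du nu dv])
  qed
  ultimately have "deq us' vs" using deq_if_stably_isom[of us' vs] us' vs(1,2) by auto
  then have "phom n (cfrac us') (cfrac vs)" using deq_phom[of us' vs] us' by simp
  then have "(cfrac us', cfrac vs) \<in> naive_rel n" by (rule phom_naive_rel)
  then show ?thesis using us(3) r naive_rel_sym[OF vs(3)] by (blast intro: naive_rel_trans)
qed

lemma naive_rel_iff:
  fixes x y :: "'a::field poly \<times> 'a poly"
  assumes "n \<ge> 1" "inU n x"
  shows "(x, y) \<in> naive_rel n \<longleftrightarrow> inU n y \<and> bez_inv n x = bez_inv n y"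
  using naive_rel_invariant[OF _ assms(2)] naive_rel_if_bez_inv_eq[OF assms] by blast

text \<open>By invariance the image of the class is a singleton, so \<open>the_elem\<close> picks a
  meaningful value.\<close>

lemma bez_map_class:
  fixes x :: "'a::field poly \<times> 'a poly"
  assumes "n \<ge> 1" "inU n x"
  shows "bez_map n (naive_rel n `` {x}) = bez_inv n x"
proof -
  have 1: "(\<lambda>(A, B). (stab_class n (bez n A B), pow_class (2 * n) (det (bez n A B)))) = bez_inv n"
    by (intro ext) (simp add: bez_eq bez_inv_def split: prod.splits)
  have 2: "bez_inv n ` (naive_rel n `` {x}) = (\<lambda>_. bez_inv n x) ` (naive_rel n `` {x})"
    by (rule image_cong) (use naive_rel_iff[OF assms] in auto)
  have 3: "(\<lambda>_. bez_inv n x) ` (naive_rel n `` {x}) = {bez_inv n x}"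
    by (rule image_constant[of x]) (simp add: naive_rel_refl)
  show ?thesis unfolding bez_map_def 1 2 3 by (rule the_elem_eq)
qed

lemma bez_inv_in_fibre_prod:
  fixes x :: "'a::field poly \<times> 'a poly"
  assumes "inU n x"
  shows "bez_inv n x \<in> fibre_prod n"
proof -
  define M where "M = bez_mat n (fst x) (snd x)"
  have M: "M \<in> nondeg_sym n" unfolding M_def by (rule bez_mat_nondeg'[OF assms])
  have "M \<in> stab_class n M" using M stably_isom_refl[OF M] by (simp add: stab_class_def)
  moreover have "det M \<in> pow_class (2 * n) (det M)"
    using nondeg_symD(3)[OF M] by (auto simp: pow_class_def intro!: exI[of _ 1])
  moreover have "det M = 1 ^ 2 * det M" by simp
  ultimately show ?thesis
    unfolding bez_inv_def M_def[symmetric] fibre_prod_def MWs_def units_mod_pow_def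
    using M nondeg_symD(3)[OF M] one_neq_zero by blast
qed

text \<open>A stable diagonalisation of the given form has the right determinant up to a square, and
  so has the given unit. Changing one entry by a square corrects the product without changing the
  form up to isometry; the continued fraction with these parameters is the preimage.\<close>

lemma fibre_prod_bez_inv_ex:
  fixes n :: nat
  assumes n: "n \<ge> 1" and p: "p \<in> (fibre_prod n :: ('a::field mat set \<times> 'a set) set)"
  shows "\<exists>x. inU n x \<and> bez_inv n x = p"
proof -
  obtain c e where ce1: "p = (c, e)" by (cases p)
  then have ce: "p = (c, e)" "c \<in> MWs n" "e \<in> units_mod_pow (2 * n)"
    "\<exists>M\<in>c. \<exists>d\<in>e. \<exists>s. s \<noteq> 0 \<and> d = s ^ 2 * det M" using p by (simp_all add: fibre_prod_def)
  then obtain M d s where M: "M \<in> c" and d: "d \<in> e" and s: "s \<noteq> 0" "d = s ^ 2 * det M" by blast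
  obtain M0 where M0: "M0 \<in> nondeg_sym n" "c = stab_class n M0" using ce(2) by (auto simp: MWs_def)
  have Mn: "M \<in> nondeg_sym n" and "stably_isom M0 M" using M M0 by (auto simp: stab_class_def)
  then have c: "c = stab_class n M" using stab_class_eq_iff[OF M0(1)] M0(2) by blast
  obtain d0 where d0: "d0 \<noteq> 0" "e = pow_class (2 * n) d0" using ce(3) by (auto simp: units_mod_pow_def)
  have dn: "d \<noteq> 0" using d d0 by (auto simp: pow_class_def)
  have e: "e = pow_class (2 * n) d" using pow_class_eq_iff[OF d0(1) dn] d d0(2) by (auto simp: pow_class_def)
  obtain us where us: "length us = n" "0 \<notin> set us" "stably_isom M (diag us)" using stably_isom_diag_ex[OF Mn] by blast
  obtain u us' where u: "us = u # us'" using us(1) n by (cases us) auto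
  have du: "diag us \<in> nondeg_sym n" using diag_nondeg[OF us(2)] us(1) by simp
  obtain m N where N: "N \<in> nondeg_sym m" and i: "isom_forms (orth_sum M N) (orth_sum (diag us) N)"
    using us(3) unfolding stably_isom_def by blast
  note o = nondeg_symD[OF orth_sum_nondeg[OF Mn N]]
  obtain P where P: "P \<in> carrier_mat (n + m) (n + m)" "det P \<noteq> 0" "P\<^sup>T * orth_sum M N * P = orth_sum (diag us) N"
    using isom_formsE[OF i o(1)] .
  have "prod_list us * det N = det P ^ 2 * (det M * det N)"
    using det_congruence[OF o(1) P(1)]
    unfolding P(3) det_orth_sum[OF nondeg_symD(1)[OF Mn] nondeg_symD(1)[OF N]]
      det_orth_sum[OF nondeg_symD(1)[OF du] nondeg_symD(1)[OF N]] det_diag .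
  then have "prod_list us * det N = det P ^ 2 * det M * det N" by (simp only: mult.assoc)
  then have pl: "prod_list us = det P ^ 2 * det M" using nondeg_symD(3)[OF N] mult_right_cancel by blast
  \<comment> \<open>The product of \<open>us\<close> is \<open>det P ^ 2 * det M\<close>, while
    \<open>d\<close> is \<open>s ^ 2 * det M\<close>; the factor \<open>r\<^sup>2\<close> turns one
    into the other.\<close>
  define r where "r = s / det P"
  have r: "r \<noteq> 0" using s P by (simp add: r_def)
  define vs where "vs = (r\<^sup>2 * u) # us'"
  have vs: "length vs = n" "0 \<notin> set vs" using us u r by (auto simp: vs_def)
  have "prod_list vs = r\<^sup>2 * prod_list us" by (simp add: vs_def u mult.assoc)
  also have "\<dots> = d" unfolding pl s(2) r_def using P(2) by (simp add: power_divide)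
  finally have pd: "prod_list vs = d" .
  have dv: "diag vs \<in> nondeg_sym n" using diag_nondeg[OF vs(2)] vs(1) by simp
  have "stably_isom (diag us) (diag vs)"
  proof -
    have n1: "diag [u] \<in> nondeg_sym 1" "diag [r\<^sup>2 * u] \<in> nondeg_sym 1" "diag us' \<in> nondeg_sym (length us')"
      using diag_nondeg[of "[u]"] diag_nondeg[of "[r\<^sup>2 * u]"] diag_nondeg[of us'] us(2) u r by auto
    have "(diag [r])\<^sup>T * diag [u] * diag [r] = diag [r\<^sup>2 * u]"
      by (rule eq_matI) (auto simp: diag_def scalar_prod_def power2_eq_square mult_ac)
    then have "isom_forms (diag [u]) (diag [r\<^sup>2 * u])"
      by (rule isom_formsI[OF diag_single_carrier diag_single_carrier]) (rule nondeg_symD(3)[OF n1(2)])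
    then show ?thesis unfolding u vs_def diag_Cons[of u us'] diag_Cons[of "r\<^sup>2 * u" us']
      by (intro stably_isom_orth_sum_right[OF isom_forms_stably_isom[OF _ n1(1)] n1(3,1,2)])
  qed
  then have Mv: "stably_isom M (diag vs)" by (rule stably_isom_trans[OF us(3) _ Mn du dv])
  note bv = bez_mat_cfrac[OF vs(2), unfolded vs(1)]
  note bn = bv[THEN conjunct1]
  have "stably_isom (bez_mat n (fst (cfrac vs)) (snd (cfrac vs))) M"
    by (rule stably_isom_trans[OF isom_forms_stably_isom[OF bv[THEN conjunct2, THEN conjunct1] bn]
        stably_isom_sym[OF Mv Mn] bn dv Mn])
  then have "stab_class n (bez_mat n (fst (cfrac vs)) (snd (cfrac vs))) = c"
    unfolding c using stab_class_eq_iff[OF bn Mn] by simp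
  moreover have "det (bez_mat n (fst (cfrac vs)) (snd (cfrac vs))) = d" using bv pd by simp
  ultimately have "bez_inv n (cfrac vs) = p" unfolding bez_inv_def ce(1) e by simp
  then show ?thesis using inU_cfrac[OF vs(2)] vs(1) by blast
qed

text \<open>Positive degree provides a nonzero leading coefficient to normalise and an entry that
  can absorb a square. For \<open>n = 0\<close> the 0-th power classes are single elements, so
  \<open>fibre_prod 0\<close> has one element for each nonzero square, while all constant pairs are
  homotopic.\<close>

theorem theorem4p3:
  fixes n :: nat
  assumes "n \<ge> 1"
  shows "bij_betw (bez_map n) (naive_classes n :: ('a::field poly \<times> 'a poly) set set) (fibre_prod n)"
proof (rule bij_betw_imageI)
  have classes: "(naive_classes n :: ('a poly \<times> 'a poly) set set) = (\<lambda>x. naive_rel n `` {x}) ` {x. inU n x}"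
    by (auto simp: naive_classes_def quotient_def Upts_def)
  show "inj_on (bez_map n) (naive_classes n :: ('a poly \<times> 'a poly) set set)"
  proof (rule inj_onI)
    fix C D :: "('a poly \<times> 'a poly) set"
    assume C: "C \<in> naive_classes n" and D: "D \<in> naive_classes n" and eq: "bez_map n C = bez_map n D"
    obtain x y where x: "inU n x" "C = naive_rel n `` {x}" and y: "inU n y" "D = naive_rel n `` {y}"
      using C D unfolding classes by blast
    have "bez_inv n x = bez_inv n y" using eq bez_map_class[OF assms x(1)] bez_map_class[OF assms y(1)] x(2)
        y(2) by simp
    then show "C = D" unfolding x(2) y(2) using naive_rel_iff[OF assms x(1)] naive_rel_iff[OF assms y(1)] by auto
  qed
  show "bez_map n ` (naive_classes n :: ('a poly \<times> 'a poly) set set) = fibre_prod n"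
  proof
    show "bez_map n ` (naive_classes n :: ('a poly \<times> 'a poly) set set) \<subseteq> fibre_prod n"
      unfolding classes using bez_map_class[OF assms] bez_inv_in_fibre_prod by force
    show "fibre_prod n \<subseteq> bez_map n ` (naive_classes n :: ('a poly \<times> 'a poly) set set)"
    proof
      fix p :: "'a mat set \<times> 'a set"
      assume "p \<in> fibre_prod n"
      then obtain x where x: "inU n x" "bez_inv n x = p" using fibre_prod_bez_inv_ex[OF assms] by blast
      then have "p = bez_map n (naive_rel n `` {x})" using bez_map_class[OF assms x(1)] by simp
      then show "p \<in> bez_map n ` naive_classes n" unfolding classes using x(1) by blast
    qed
  qed
qed

end
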